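(* Let $\mathsf{k}$ be a field of characteristic $0$ and $\pi=\mathbb{Z}\times\mathbb{Z}$ with fixed generators $g_1,g_2$ of the first and second components. Let $(V,r_i)$ and $(V',r'_i)$ be two finite dimensional representations of $\pi$ over $\mathsf{k}$, where $r_i\in GL(V)$ and $r'_i\in GL(V')$ denote the actions of $g_i$ for $i=1,2$. Then the following hold. (a) Any class of degree $1$ in $H^*(C^*_{PL}(T^2,\mathfrak{Hom}(V,V')))$ is represented by a cocycle of the form $\omega=P(t_1,t_2)\,dt_1+Q(t_1,t_2)\,dt_2$, where $P$ and $Q$ are polynomials in $t_1,t_2$ (not merely piecewise polynomial, but polynomials defined on the entire square $[0,1]^2$) with coefficients in the space of $\mathsf{k}$-linear maps $V\to V'$. (b) For such a cocycle $\omega$ there exists a unique polynomial $\mu(t_1,t_2)$ (with coefficients in the $\mathsf{k}$-linear maps $V\to V'$) satisfying $$\frac{\partial\mu}{\partial t_1}=P,\qquad \frac{\partial\mu}{\partial t_2}=Q,\qquad \mu(0,0)=0.$$ (c) A representation $(\tilde V,\tilde r_i)$ of $\pi$ which has the extension class $[\omega]$ (as an extension $V'\to\tilde V\to V$ in the dg-category $T_{PL}(T^2)$, with the obvious inclusion and projection) is given by $\tilde V=V'\oplus V$ with $g_i$ acting as $$\tilde r_i=\begin{bmatrix} r'_i & -r'_i\,\mu(2-i,\,i-1)\\ 0 & r_i\end{bmatrix}\qquad (i=1,2).$$ (d) A splitting $V'\stackrel{\alpha}{\leftarrow}\tilde V\stackrel{\beta}{\leftarrow}V$ of this extension is given by $$\alpha=\begin{bmatrix}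 id_{V'} & -\mu(t_1,t_2)\end{bmatrix},\qquad \beta=\begin{bmatrix}\mu(t_1,t_2)\\ id_V\end{bmatrix}.$$
   Context: All vector spaces are over $\mathsf{k}$; complexes are non-negatively and cohomologically graded. The torus: $T^2=[0,1]^2/\{(0,t_2)\sim(1,t_2),\ (t_1,0)\sim(t_1,1)\}$, with one $0$-cell, two $1$-cells $\sigma_1=\{(t_1,0)\}$, $\sigma_2=\{(0,t_2)\}$ and one $2$-cell $\tau=\{(t_1,t_2)\}$. Formally $T^2$ is a simplicial set, these cells being subdivided into simplices (e.g. the square is cut along its diagonal). Local systems: a local system on a simplicial set $K$ in a category is a functor from the opposite category of simplices of $K$. A local system of vector spaces is a locally constant one (all structure maps are isomorphisms) with values in vector spaces. A representation $V$ of $\pi$ is identified with the local system on $T^2$ with value $V$ on every cell (or simplex), for which on $\sigma_i$ the face map $d_0$ (corresponding to the inclusion $\{1\}\to[0,1]$) is the action of $g_i$ and the other face map $d_1$ (corresponding to $\{0\}\to[0,1]$) is the identity; correspondingly, on the square $\tau$ the restriction to the edge $t_i=1$ acts by $g_i$ and the restriction to the edge $t_i=0$ is the identity. $\mathfrak{Hom}(V,V')$ is the representation (local system) of $\mathsf{k}$-linear maps $V\to V'$ with conjugation action $f\mapsto r'_i f r_i^{-1}$ of $g_i$. $C^*_{PL}(T^2,L)$ is the complex of global sections of the local system of complexes $\sigma\mapsto A_{PL}(\Delta^{|\sigma|})\otimes L_\sigma$, where $A_{PL}(\Delta^n)$ is the commutative differential graded algebra of polynomial de Rham forms on the standard simplex.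 So an element is a family of $L$-valued polynomial forms on simplices compatible with the structure maps. In particular a polynomial form $\omega=P\,dt_1+Q\,dt_2$ on the entire square with values in $\mathfrak{Hom}(V,V')$ is an element when it is compatible with the face maps, i.e. $r'_2P(t_1,1)r_2^{-1}=P(t_1,0)$ and $r'_1Q(1,t_2)r_1^{-1}=Q(0,t_2)$ together with the compatibility of the remaining values as required for a global section. The dg-category $T_{PL}(T^2)$: objects are the finite dimensional local systems of vector spaces on $T^2$, $\mathrm{Hom}_{T_{PL}(T^2)}(V,V')=C^*_{PL}(T^2,\mathfrak{Hom}(V,V'))$, and composition is given by the product of forms and the composition of linear maps. Extensions: an extension in a dg-category $C$ is a pair of degree $0$ maps $V'\stackrel{p}{\to}\tilde V\stackrel{q}{\to}V$ with $dp=0$, $dq=0$, $qp=0$, for which a splitting exists; a splitting is a pair of degree $0$ maps $V'\stackrel{\alpha}{\leftarrow}\tilde V\stackrel{\beta}{\leftarrow}V$ (not necessarily closed) with $\alpha\beta=0$, $\alpha p=id_{V'}$, $q\beta=id_V$, $p\alpha+\beta q=id_{\tilde V}$. The extension class is $[\alpha\, d\beta]\in H^1(\mathrm{Hom}_C(V,V'))$. *)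

theory Defs
  imports
    "HOL-Analysis.Product_Vector"
    "HOL-Library.Poly_Mapping"
    "HOL-Library.Function_Algebras"
begin

section \<open>Polynomials and polynomial differential forms with coefficients\<close>

text \<open>
  Coefficients lie in an abelian group \<open>'l\<close>, usually a vector space given by its scalar
  multiplication \<open>s :: 'k \<Rightarrow> 'l \<Rightarrow> 'l\<close>. Thus \<open>'l mpoly\<close> is \<open>k[t\<^sub>0, t\<^sub>1, \<dots>] \<otimes> 'l\<close>, and the basis
  element \<open>t\<^sup>a dt\<^sub>I\<close> of the polynomial forms is indexed by the exponent \<open>a\<close> and the finite
  set \<open>I\<close>, where \<open>dt\<^sub>I\<close> is the product of the \<open>dt\<^sub>i\<close>, \<open>i \<in> I\<close>, in increasing order.
\<close>

type_synonym mono = "nat \<Rightarrow>\<^sub>0 nat"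
type_synonym 'l mpoly = "mono \<Rightarrow>\<^sub>0 'l"
type_synonym 'l form = "(mono \<times> nat set) \<Rightarrow>\<^sub>0 'l"

definition var :: "nat \<Rightarrow> 'k::comm_ring_1 mpoly" where
  "var i = Poly_Mapping.single (Poly_Mapping.single i 1) 1"

definition const_poly :: "'l::ab_group_add \<Rightarrow> 'l mpoly" where
  "const_poly c = Poly_Mapping.single 0 c"

definition poly_eval :: "('k::field \<Rightarrow> 'l \<Rightarrow> 'l) \<Rightarrow> 'l::ab_group_add mpoly \<Rightarrow> (nat \<Rightarrow> 'k) \<Rightarrow> 'l" where
  "poly_eval s p x =
     (\<Sum>a\<in>Poly_Mapping.keys p. s (\<Prod>i\<in>Poly_Mapping.keys a. x i ^ Poly_Mapping.lookup a i) (Poly_Mapping.lookup p a))"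

definition poly_deriv :: "('k::field \<Rightarrow> 'l \<Rightarrow> 'l) \<Rightarrow> nat \<Rightarrow> 'l::ab_group_add mpoly \<Rightarrow> 'l mpoly" where
  "poly_deriv s i p =
     (\<Sum>a\<in>Poly_Mapping.keys p. Poly_Mapping.single (a - Poly_Mapping.single i 1)
                    (s (of_nat (Poly_Mapping.lookup a i)) (Poly_Mapping.lookup p a)))"

text \<open>The form \<open>p dt\<^sub>I\<close>.\<close>

definition monoform :: "'l::ab_group_add mpoly \<Rightarrow> nat set \<Rightarrow> 'l form" where
  "monoform p I = (\<Sum>a\<in>Poly_Mapping.keys p. Poly_Mapping.single (a, I) (Poly_Mapping.lookup p a))"

text \<open>The product of forms with respect to a biadditive pairing \<open>B\<close> of the coefficients.\<close>

definition wedge :: "('a::ab_group_add \<Rightarrow> 'b::ab_group_add \<Rightarrow> 'c::ab_group_add)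
    \<Rightarrow> 'a form \<Rightarrow> 'b form \<Rightarrow> 'c form" where
  "wedge B \<omega> \<eta> =
     (\<Sum>(a, I)\<in>Poly_Mapping.keys \<omega>. \<Sum>(b, J)\<in>Poly_Mapping.keys \<eta>.
        if I \<inter> J = {}
        then Poly_Mapping.single (a + b, I \<union> J)
               (if even (card {(i, j). i \<in> I \<and> j \<in> J \<and> j < i})
                then B (Poly_Mapping.lookup \<omega> (a, I)) (Poly_Mapping.lookup \<eta> (b, J))
                else - B (Poly_Mapping.lookup \<omega> (a, I)) (Poly_Mapping.lookup \<eta> (b, J)))
        else 0)"

definition ext_deriv :: "('k::field \<Rightarrow> 'l \<Rightarrow> 'l) \<Rightarrow> 'l::ab_group_add form \<Rightarrow> 'l form" where
  "ext_deriv s \<omega> =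
     (\<Sum>(a, I)\<in>Poly_Mapping.keys \<omega>. \<Sum>i\<in>Poly_Mapping.keys a - I.
        Poly_Mapping.single (a - Poly_Mapping.single i 1, insert i I)
          (s ((-1) ^ card {j\<in>I. j < i} * of_nat (Poly_Mapping.lookup a i)) (Poly_Mapping.lookup \<omega> (a, I))))"

text \<open>
  The substitution \<open>t\<^sub>i := T i\<close>, \<open>dt\<^sub>i := d(T i)\<close>: first for scalar basis elements \<open>t\<^sup>a dt\<^sub>I\<close>,
  then extended linearly to forms with coefficients.
\<close>

definition subst_basis :: "(nat \<Rightarrow> 'k::field mpoly) \<Rightarrow> mono \<Rightarrow> nat set \<Rightarrow> 'k form" where
  "subst_basis T a I =
     wedge (*) (monoform (\<Prod>i\<in>Poly_Mapping.keys a. T i ^ Poly_Mapping.lookup a i) {})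
       (foldr (\<lambda>i. wedge (*) (ext_deriv (*) (monoform (T i) {})))
          (sorted_list_of_set I) (monoform 1 {}))"

definition form_subst :: "('k::field \<Rightarrow> 'l \<Rightarrow> 'l) \<Rightarrow> (nat \<Rightarrow> 'k mpoly)
    \<Rightarrow> 'l::ab_group_add form \<Rightarrow> 'l form" where
  "form_subst s T \<omega> =
     (\<Sum>(a, I)\<in>Poly_Mapping.keys \<omega>.
        wedge s (subst_basis T a I) (monoform (const_poly (Poly_Mapping.lookup \<omega> (a, I))) {}))"

section \<open>Polynomial de Rham forms on the standard simplices\<close>

text \<open>
  \<open>A\<^sub>P\<^sub>L(\<Delta>\<^sup>n)\<close> is generated by the barycentric coordinates \<open>t\<^sub>0, \<dots>, t\<^sub>n\<close> and their differentials,
  subject to \<open>t\<^sub>0 + \<dots> + t\<^sub>n = 1\<close> and \<open>dt\<^sub>0 + \<dots> + dt\<^sub>n = 0\<close>. Eliminating \<open>t\<^sub>0\<close>, it is free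
  on \<open>t\<^sub>1, \<dots>, t\<^sub>n\<close>. In particular \<open>t\<^sub>1\<close> is the coordinate of \<open>\<Delta>\<^sup>1 = [0,1]\<close> vanishing at the
  vertex 0.
\<close>

definition A_PL :: "nat \<Rightarrow> 'l::ab_group_add set \<Rightarrow> 'l form set" where
  "A_PL n L = {\<omega>. (\<forall>(a, I)\<in>Poly_Mapping.keys \<omega>. Poly_Mapping.keys a \<subseteq> {1..n} \<and> I \<subseteq> {1..n}) \<and> (\<forall>b. Poly_Mapping.lookup \<omega> b \<in> L)}"

definition bary :: "nat \<Rightarrow> nat \<Rightarrow> 'k::field mpoly" where
  "bary n j = (if j = 0 then 1 - (\<Sum>i=1..n. var i) else var j)"

definition simplicial_op :: "nat \<Rightarrow> nat \<Rightarrow> (nat \<Rightarrow> nat) \<Rightarrow> bool" where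
  "simplicial_op m n \<theta> \<longleftrightarrow> mono_on {..m} \<theta> \<and> \<theta> ` {..m} \<subseteq> {..n}"

text \<open>The coordinate \<open>t\<^sub>i\<close> of \<open>\<Delta>\<^sup>n\<close>, pulled back to \<open>\<Delta>\<^sup>m\<close> along \<open>\<theta> : [m] \<rightarrow> [n]\<close>.\<close>

definition bary_pull :: "nat \<Rightarrow> (nat \<Rightarrow> nat) \<Rightarrow> nat \<Rightarrow> 'k::field mpoly" where
  "bary_pull m \<theta> i = (\<Sum>j\<in>{j. j \<le> m \<and> \<theta> j = i}. bary m j)"

section \<open>Simplicial sets, local systems and the complex of PL forms\<close>

record 's sset =
  simps :: "nat \<Rightarrow> 's set"
  pull :: "nat \<Rightarrow> nat \<Rightarrow> (nat \<Rightarrow> nat) \<Rightarrow> 's \<Rightarrow> 's"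
    \<comment> \<open>\<open>pull K m n \<theta> : K\<^sub>n \<rightarrow> K\<^sub>m\<close> for \<open>\<theta> : [m] \<rightarrow> [n]\<close>\<close>

definition simplicial_set :: "'s sset \<Rightarrow> bool" where
  "simplicial_set K \<longleftrightarrow>
     (\<forall>m n \<theta>. simplicial_op m n \<theta> \<longrightarrow> pull K m n \<theta> ` simps K n \<subseteq> simps K m) \<and>
     (\<forall>m n \<theta> \<theta>'. simplicial_op m n \<theta> \<longrightarrow> (\<forall>j\<le>m. \<theta> j = \<theta>' j) \<longrightarrow>
        (\<forall>x\<in>simps K n. pull K m n \<theta> x = pull K m n \<theta>' x)) \<and>
     (\<forall>n. \<forall>x\<in>simps K n. pull K n n id x = x) \<and>
     (\<forall>l m n \<theta> \<phi>. simplicial_op l m \<phi> \<longrightarrow> simplicial_op m n \<theta> \<longrightarrow>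
        (\<forall>x\<in>simps K n. pull K l m \<phi> (pull K m n \<theta> x) = pull K l n (\<theta> \<circ> \<phi>) x))"

text \<open>
  The value of a local system on the simplex \<open>x\<close> of dimension \<open>n\<close> is a subspace
  \<open>fib L n x\<close> of an ambient vector space with scalar multiplication \<open>lscale L\<close>;
  \<open>res L m n \<theta> x\<close> maps it to the value on \<open>\<theta>\<^sup>*x\<close>.
\<close>

record ('k, 's, 'l) local_sys =
  lscale :: "'k \<Rightarrow> 'l \<Rightarrow> 'l"
  fib :: "nat \<Rightarrow> 's \<Rightarrow> 'l set"
  res :: "nat \<Rightarrow> nat \<Rightarrow> (nat \<Rightarrow> nat) \<Rightarrow> 's \<Rightarrow> 'l \<Rightarrow> 'l"

definition local_system :: "'s sset \<Rightarrow> ('k::field, 's, 'l::ab_group_add) local_sys \<Rightarrow> bool" where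
  "local_system K L \<longleftrightarrow>
     vector_space (lscale L) \<and>
     (\<forall>n. \<forall>x\<in>simps K n. module.subspace (lscale L) (fib L n x)) \<and>
     (\<forall>m n \<theta>. simplicial_op m n \<theta> \<longrightarrow> (\<forall>x\<in>simps K n.
        bij_betw (res L m n \<theta> x) (fib L n x) (fib L m (pull K m n \<theta> x)) \<and>
        (\<forall>u\<in>fib L n x. \<forall>v\<in>fib L n x.
           res L m n \<theta> x (u + v) = res L m n \<theta> x u + res L m n \<theta> x v) \<and>
        (\<forall>c. \<forall>u\<in>fib L n x. res L m n \<theta> x (lscale L c u) = lscale L c (res L m n \<theta> x u)))) \<and>
     (\<forall>n. \<forall>x\<in>simps K n. \<forall>u\<in>fib L n x. res L n n id x u = u) \<and>
     (\<forall>l m n \<theta> \<phi>. simplicial_op l m \<phi> \<longrightarrow> simplicial_op m n \<theta> \<longrightarrow>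
        (\<forall>x\<in>simps K n. \<forall>u\<in>fib L n x.
           res L l m \<phi> (pull K m n \<theta> x) (res L m n \<theta> x u) = res L l n (\<theta> \<circ> \<phi>) x u))"

text \<open>
  The degree \<open>p\<close> part of the global sections of \<open>\<sigma> \<mapsto> A\<^sub>P\<^sub>L(\<Delta>\<^bsup>|\<sigma>|\<^esup>) \<otimes> L\<^sub>\<sigma>\<close>. Families are
  extended by 0 to arguments that are not simplices, so that equality of sections is
  equality of functions.
\<close>

definition C_PL :: "'s sset \<Rightarrow> ('k::field, 's, 'l::ab_group_add) local_sys \<Rightarrow> nat
    \<Rightarrow> (nat \<Rightarrow> 's \<Rightarrow> 'l form) set" where
  "C_PL K L p = {\<omega>.
     (\<forall>n x. x \<notin> simps K n \<longrightarrow> \<omega> n x = 0) \<and>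
     (\<forall>n. \<forall>x\<in>simps K n. \<omega> n x \<in> A_PL n (fib L n x) \<and> (\<forall>(a, I)\<in>Poly_Mapping.keys (\<omega> n x). card I = p)) \<and>
     (\<forall>m n \<theta>. simplicial_op m n \<theta> \<longrightarrow> (\<forall>x\<in>simps K n.
        Poly_Mapping.map (res L m n \<theta> x) (form_subst (lscale L) (bary_pull m \<theta>) (\<omega> n x))
          = \<omega> m (pull K m n \<theta> x)))}"

definition d_PL :: "('k::field, 's, 'l::ab_group_add) local_sys
    \<Rightarrow> (nat \<Rightarrow> 's \<Rightarrow> 'l form) \<Rightarrow> (nat \<Rightarrow> 's \<Rightarrow> 'l form)" where
  "d_PL L \<omega> = (\<lambda>n x. ext_deriv (lscale L) (\<omega> n x))"

definition cocycles :: "'s sset \<Rightarrow> ('k::field, 's, 'l::ab_group_add) local_sys \<Rightarrow> nat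
    \<Rightarrow> (nat \<Rightarrow> 's \<Rightarrow> 'l form) set" where
  "cocycles K L p = {\<omega>\<in>C_PL K L p. d_PL L \<omega> = 0}"

definition coboundaries :: "'s sset \<Rightarrow> ('k::field, 's, 'l::ab_group_add) local_sys \<Rightarrow> nat
    \<Rightarrow> (nat \<Rightarrow> 's \<Rightarrow> 'l form) set" where
  "coboundaries K L p = (if p = 0 then {0} else d_PL L ` C_PL K L (p - 1))"

definition cohomologous :: "'s sset \<Rightarrow> ('k::field, 's, 'l::ab_group_add) local_sys \<Rightarrow> nat
    \<Rightarrow> (nat \<Rightarrow> 's \<Rightarrow> 'l form) rel" where
  "cohomologous K L p =
     {(\<omega>, \<omega>'). \<omega> \<in> cocycles K L p \<and> \<omega>' \<in> cocycles K L p \<and> \<omega>' - \<omega> \<in> coboundaries K L p}"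

definition H_PL :: "'s sset \<Rightarrow> ('k::field, 's, 'l::ab_group_add) local_sys \<Rightarrow> nat
    \<Rightarrow> (nat \<Rightarrow> 's \<Rightarrow> 'l form) set set" where
  "H_PL K L p = cocycles K L p // cohomologous K L p"

definition coh_class :: "'s sset \<Rightarrow> ('k::field, 's, 'l::ab_group_add) local_sys \<Rightarrow> nat
    \<Rightarrow> (nat \<Rightarrow> 's \<Rightarrow> 'l form) \<Rightarrow> (nat \<Rightarrow> 's \<Rightarrow> 'l form) set" where
  "coh_class K L p \<omega> = cohomologous K L p `` {\<omega>}"

section \<open>The torus\<close>

text \<open>
  \<open>T\<^sup>2 = S\<^sup>1 \<times> S\<^sup>1\<close> with \<open>S\<^sup>1 = \<Delta>\<^sup>1/\<partial>\<Delta>\<^sup>1\<close>; its nondegenerate simplices are the vertex, the edges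
  \<open>\<sigma>\<^sub>1\<close>, \<open>\<sigma>\<^sub>2\<close> and the diagonal, and the two triangles of the square cut along the diagonal.
  A simplex \<open>[n] \<rightarrow> [1]\<close> of \<open>\<Delta>\<^sup>1\<close> is encoded by the set \<open>U \<subseteq> {0..n}\<close> of vertices sent to 1. In
  \<open>S\<^sup>1\<close> the two constant maps (\<open>U = {}\<close> and \<open>U = {0..n}\<close>) are identified, and \<open>{}\<close> is
  chosen as representative.
\<close>

definition circle_simps :: "nat \<Rightarrow> nat set set" where
  "circle_simps n = {U. U \<subset> {..n} \<and> (\<forall>i\<in>U. \<forall>j. i \<le> j \<and> j \<le> n \<longrightarrow> j \<in> U)}"

definition circle_pull :: "nat \<Rightarrow> (nat \<Rightarrow> nat) \<Rightarrow> nat set \<Rightarrow> nat set" where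
  "circle_pull m \<theta> U =
     (if {j. j \<le> m \<and> \<theta> j \<in> U} = {..m} then {} else {j. j \<le> m \<and> \<theta> j \<in> U})"

lemma circle_pull_simps:
  assumes "simplicial_op m n \<theta>" "U \<in> circle_simps n"
  shows "circle_pull m \<theta> U \<in> circle_simps m"
  using assms unfolding circle_pull_def circle_simps_def simplicial_op_def mono_on_def
  by (auto split: if_splits)

lemma circle_simps_0: "U \<in> circle_simps n \<Longrightarrow> 0 \<notin> U"
  unfolding circle_simps_def by auto

lemma circle_pull_id: "U \<in> circle_simps n \<Longrightarrow> circle_pull n id U = U"
  unfolding circle_pull_def circle_simps_def by auto

lemma circle_pull_comp:
  assumes "simplicial_op l m \<phi>" "simplicial_op m n \<theta>" "U \<in> circle_simps n"
  shows "circle_pull l \<phi> (circle_pull m \<theta> U) = circle_pull l (\<theta> \<circ> \<phi>) U"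
proof -
  have \<phi>: "\<phi> j \<le> m" if "j \<le> l" for j
    using assms(1) that unfolding simplicial_op_def by auto
  show ?thesis
  proof (cases "{j. j \<le> m \<and> \<theta> j \<in> U} = {..m}")
    case True
    then have "\<theta> j \<in> U" if "j \<le> m" for j
      using that by blast
    then have "{j. j \<le> l \<and> (\<theta> \<circ> \<phi>) j \<in> U} = {..l}"
      using \<phi> by auto
    then show ?thesis
      using True by (simp add: circle_pull_def)
  next
    case False
    have "{j. j \<le> l \<and> \<phi> j \<in> {j. j \<le> m \<and> \<theta> j \<in> U}} = {j. j \<le> l \<and> (\<theta> \<circ> \<phi>) j \<in> U}"
      using \<phi> by auto
    then show ?thesis
      using False by (simp add: circle_pull_def)
  qed
qed

lemma circle_pull_cong: "(\<And>j. j \<le> m \<Longrightarrow> \<theta> j = \<theta>' j) \<Longrightarrow> circle_pull m \<theta> U = circle_pull m \<theta>' U"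
proof -
  assume "\<And>j. j \<le> m \<Longrightarrow> \<theta> j = \<theta>' j"
  then have "{j. j \<le> m \<and> \<theta> j \<in> U} = {j. j \<le> m \<and> \<theta>' j \<in> U}"
    by auto
  then show ?thesis
    by (simp add: circle_pull_def)
qed

type_synonym tsimplex = "nat set \<times> nat set"

definition torus :: "tsimplex sset" where
  "torus = \<lparr>simps = \<lambda>n. circle_simps n \<times> circle_simps n,
            pull = \<lambda>m n \<theta> x. (circle_pull m \<theta> (fst x), circle_pull m \<theta> (snd x))\<rparr>"

lemma simplicial_set_torus: "simplicial_set torus"
  unfolding simplicial_set_def
proof (intro conjI allI impI ballI)
  fix m n :: nat and \<theta> \<theta>' :: "nat \<Rightarrow> nat" and x
  assume "\<forall>j\<le>m. \<theta> j = \<theta>' j"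
  then show "pull torus m n \<theta> x = pull torus m n \<theta>' x"
    using circle_pull_cong[of m \<theta> \<theta>'] by (simp add: torus_def)
qed (auto simp: torus_def circle_pull_simps circle_pull_id circle_pull_comp)

text \<open>
  The coordinate \<open>t\<^sub>i\<close> of the square, pulled back to the simplex \<open>x\<close> along the affine map
  \<open>\<Delta>\<^sup>n \<rightarrow> [0,1]\<^sup>2\<close> which is the representative of \<open>x\<close> on vertices.
\<close>

definition square_coord :: "nat \<Rightarrow> tsimplex \<Rightarrow> nat \<Rightarrow> 'k::field mpoly" where
  "square_coord n x i = (\<Sum>j\<in>(if i = 1 then fst x else snd x). bary n j)"

text \<open>The family of restrictions of a polynomial form on the whole square (with coordinates
  \<open>t\<^sub>1\<close>, \<open>t\<^sub>2\<close>) to the simplices of the torus. It need not be compatible with the structure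
  maps of a local system.\<close>

definition square_form :: "('k::field \<Rightarrow> 'l \<Rightarrow> 'l) \<Rightarrow> 'l::ab_group_add form
    \<Rightarrow> (nat \<Rightarrow> tsimplex \<Rightarrow> 'l form)" where
  "square_form s \<omega> = (\<lambda>n x. if x \<in> simps torus n then form_subst s (square_coord n x) \<omega> else 0)"

definition square_polys :: "'l::ab_group_add set \<Rightarrow> 'l mpoly set" where
  "square_polys L = {p. (\<forall>a\<in>Poly_Mapping.keys p. Poly_Mapping.keys a \<subseteq> {1, 2}) \<and> (\<forall>a. Poly_Mapping.lookup p a \<in> L)}"

definition square_point :: "'k \<Rightarrow> 'k \<Rightarrow> nat \<Rightarrow> 'k::field" where
  "square_point x y = (\<lambda>i. if i = 1 then x else if i = 2 then y else 0)"

section \<open>Representations and the dg-category of local systems\<close>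

text \<open>Representations of \<open>\<pi> = \<int> \<times> \<int>\<close>, written additively.\<close>

record ('k, 'v) rep =
  scal :: "'k \<Rightarrow> 'v \<Rightarrow> 'v"
  act :: "int \<times> int \<Rightarrow> 'v \<Rightarrow> 'v"

definition is_rep :: "('k::field, 'v::ab_group_add) rep \<Rightarrow> bool" where
  "is_rep V \<longleftrightarrow>
     (\<exists>B. finite_dimensional_vector_space (scal V) B) \<and>
     (\<forall>g. Vector_Spaces.linear (scal V) (scal V) (act V g)) \<and>
     act V 0 = id \<and> (\<forall>g h. act V (g + h) = act V g \<circ> act V h)"

definition gen :: "nat \<Rightarrow> int \<times> int" where
  "gen i = (if i = 1 then (1, 0) else (0, 1))"

text \<open>
  The local system of a representation on a space \<open>U\<close> has value \<open>U\<close> on every simplex. The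
  value on \<open>x\<close> is identified with \<open>U\<close> at the initial vertex, so the restriction along \<open>\<theta>\<close> is
  the action of the path from the vertex 0 to the vertex \<open>\<theta> 0\<close> of \<open>x\<close>: one factor \<open>g\<^sub>i\<close>
  if \<open>t\<^sub>i = 1\<close> at that vertex, no factor if \<open>t\<^sub>i = 0\<close>.
\<close>

definition path_elt :: "nat \<Rightarrow> tsimplex \<Rightarrow> int \<times> int" where
  "path_elt v x = (of_bool (v \<in> fst x), of_bool (v \<in> snd x))"

definition rep_ls :: "('k \<Rightarrow> 'l \<Rightarrow> 'l) \<Rightarrow> 'l set \<Rightarrow> (int \<times> int \<Rightarrow> 'l \<Rightarrow> 'l)
    \<Rightarrow> ('k, tsimplex, 'l) local_sys" where
  "rep_ls s U a = \<lparr>lscale = s, fib = \<lambda>n x. U, res = \<lambda>m n \<theta> x. a (path_elt (\<theta> 0) x)\<rparr>"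

text \<open>The face maps \<open>d\<^sub>0\<close> and \<open>d\<^sub>1\<close> on the edges \<open>\<sigma>\<^sub>1\<close> and \<open>\<sigma>\<^sub>2\<close>.\<close>

lemma rep_ls_edges:
  "res (rep_ls s U a) 0 1 (\<lambda>_. 1) ({1}, {}) = a (gen 1)"
  "res (rep_ls s U a) 0 1 (\<lambda>_. 1) ({}, {1}) = a (gen 2)"
  "res (rep_ls s U a) 0 1 (\<lambda>_. 0) ({1}, {}) = a 0"
  "res (rep_ls s U a) 0 1 (\<lambda>_. 0) ({}, {1}) = a 0"
  by (simp_all add: rep_ls_def path_elt_def gen_def zero_prod_def)

lemma path_elt_comp:
  assumes "simplicial_op l m \<phi>" "simplicial_op m n \<theta>" "x \<in> simps torus n"
  shows "path_elt (\<phi> 0) (pull torus m n \<theta> x) + path_elt (\<theta> 0) x = path_elt ((\<theta> \<circ> \<phi>) 0) x"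
proof -
  have *: "of_bool (\<phi> 0 \<in> circle_pull m \<theta> U) + of_bool (\<theta> 0 \<in> U) = (of_bool (\<theta> (\<phi> 0) \<in> U) :: int)"
    if "U \<in> circle_simps n" for U
  proof -
    have "\<phi> 0 \<le> m"
      using assms(1) unfolding simplicial_op_def by auto
    moreover have up: "\<theta> j \<in> U" if "\<theta> 0 \<in> U" "j \<le> m" for j
      using that assms(2) \<open>U \<in> circle_simps n\<close>
      unfolding simplicial_op_def circle_simps_def mono_on_def by auto
    have "{j. j \<le> m \<and> \<theta> j \<in> U} = {..m} \<longleftrightarrow> \<theta> 0 \<in> U"
      using up by auto
    ultimately show ?thesis
      using up by (auto simp: circle_pull_def)
  qed
  have "fst x \<in> circle_simps n" "snd x \<in> circle_simps n"
    using assms(3) by (auto simp: torus_def)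
  then show ?thesis
    using * by (simp add: path_elt_def torus_def)
qed

lemma local_system_rep_ls:
  assumes "vector_space s" "module.subspace s U"
    and maps: "\<And>g u. u \<in> U \<Longrightarrow> a g u \<in> U"
    and add: "\<And>g u v. u \<in> U \<Longrightarrow> v \<in> U \<Longrightarrow> a g (u + v) = a g u + a g v"
    and scale: "\<And>g c u. u \<in> U \<Longrightarrow> a g (s c u) = s c (a g u)"
    and zero: "\<And>u. u \<in> U \<Longrightarrow> a 0 u = u"
    and comp: "\<And>g h u. u \<in> U \<Longrightarrow> a (g + h) u = a g (a h u)"
  shows "local_system torus (rep_ls s U a)"
proof -
  have bij: "bij_betw (a g) U U" for g
  proof (rule bij_betw_byWitness[where f' = "a (- g)"])
    show "\<forall>u\<in>U. a (- g) (a g u) = u"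
      using comp[of _ "- g" g] zero by simp
    show "\<forall>u\<in>U. a g (a (- g) u) = u"
      using comp[of _ g "- g"] zero by simp
  qed (auto simp: maps)
  have id: "path_elt 0 x = 0" if "x \<in> simps torus n" for n x
    using that by (auto simp: path_elt_def torus_def zero_prod_def dest: circle_simps_0)
  have res: "a (path_elt (\<phi> 0) (pull torus m n \<theta> x)) (a (path_elt (\<theta> 0) x) u)
      = a (path_elt (\<theta> (\<phi> 0)) x) u"
    if "simplicial_op l m \<phi>" "simplicial_op m n \<theta>" "x \<in> simps torus n" "u \<in> U" for l m n \<phi> \<theta> x u
    using path_elt_comp[OF that(1-3)] comp[OF that(4), symmetric] by simp
  show ?thesis
    unfolding local_system_def rep_ls_def using assms(1,2) bij add scale
    by (auto simp: id zero res)
qed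

definition Lin :: "('k::field, 'v::ab_group_add) rep \<Rightarrow> ('k, 'w::ab_group_add) rep
    \<Rightarrow> ('v \<Rightarrow> 'w) set" where
  "Lin V V' = {f. Vector_Spaces.linear (scal V) (scal V') f}"

definition Lin_scale :: "('k::field, 'w::ab_group_add) rep \<Rightarrow> 'k \<Rightarrow> ('v \<Rightarrow> 'w) \<Rightarrow> ('v \<Rightarrow> 'w)" where
  "Lin_scale V' c f = (\<lambda>v. scal V' c (f v))"

text \<open>The linear maps from \<open>V\<close> to \<open>V'\<close>, acted on by conjugation.\<close>

definition Hom_ls :: "('k::field, 'v::ab_group_add) rep \<Rightarrow> ('k, 'w::ab_group_add) rep
    \<Rightarrow> ('k, tsimplex, 'v \<Rightarrow> 'w) local_sys" where
  "Hom_ls V V' = rep_ls (Lin_scale V') (Lin V V') (\<lambda>g f. act V' g \<circ> f \<circ> act V (- g))"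

lemma Lin_scale_vector_space:
  assumes "vector_space (scal V')"
  shows "vector_space (Lin_scale V')"
proof -
  interpret vector_space "scal V'" by fact
  show ?thesis
    by unfold_locales (auto simp: Lin_scale_def fun_eq_iff scale_right_distrib scale_left_distrib)
qed

lemma local_system_Hom_ls:
  assumes "is_rep V" "is_rep V'"
  shows "local_system torus (Hom_ls V V')"
proof -
  obtain B B' where B: "finite_dimensional_vector_space (scal V) B"
      "finite_dimensional_vector_space (scal V') B'"
    using assms unfolding is_rep_def by blast
  interpret V: vector_space "scal V"
    using B(1) by (rule finite_dimensional_vector_space.axioms)
  interpret V': vector_space "scal V'"
    using B(2) by (rule finite_dimensional_vector_space.axioms)
  interpret L: vector_space "Lin_scale V' :: _ \<Rightarrow> ('b \<Rightarrow> 'c) \<Rightarrow> _"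
    by (rule Lin_scale_vector_space) unfold_locales
  interpret VV: vector_space_pair "scal V" "scal V'" ..
  have lin: "Vector_Spaces.linear (scal V) (scal V) (act V g)"
    "Vector_Spaces.linear (scal V') (scal V') (act V' g)" for g
    using assms unfolding is_rep_def by blast+
  have act0: "act V 0 = id" "act V' 0 = id"
    using assms unfolding is_rep_def by blast+
  have act_add: "act V (g + h) = act V g \<circ> act V h" "act V' (g + h) = act V' g \<circ> act V' h" for g h
    using assms unfolding is_rep_def by blast+
  show ?thesis
    unfolding Hom_ls_def
  proof (rule local_system_rep_ls)
    show "vector_space (Lin_scale V' :: _ \<Rightarrow> ('b \<Rightarrow> 'c) \<Rightarrow> _)"
      by unfold_locales
    show "module.subspace (Lin_scale V') (Lin V V')"
      unfolding L.subspace_def Lin_def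
      by (auto simp: Lin_scale_def zero_fun_def plus_fun_def VV.module_hom_zero
          VV.linear_compose_add VV.linear_compose_scale_right)
    show "act V' g \<circ> u \<circ> act V (- g) \<in> Lin V V'" if "u \<in> Lin V V'" for g u
      using that lin unfolding Lin_def mem_Collect_eq by (blast intro: Vector_Spaces.linear_compose)
  next
    fix g u v
    show "act V' g \<circ> (u + v) \<circ> act V (- g)
        = (act V' g \<circ> u \<circ> act V (- g)) + (act V' g \<circ> v \<circ> act V (- g))"
      by (auto simp: fun_eq_iff module_hom.add[OF Vector_Spaces.linear.axioms(3)[OF lin(2)]])
  next
    fix g c u
    show "act V' g \<circ> Lin_scale V' c u \<circ> act V (- g)
        = Lin_scale V' c (act V' g \<circ> u \<circ> act V (- g))"
      by (auto simp: fun_eq_iff Lin_scale_def module_hom.scale[OF Vector_Spaces.linear.axioms(3)[OF lin(2)]])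
  next
    fix g h u
    show "act V' (g + h) \<circ> u \<circ> act V (- (g + h))
        = act V' g \<circ> (act V' h \<circ> u \<circ> act V (- h)) \<circ> act V (- g)"
      by (simp only: minus_add act_add comp_assoc)
  qed (simp add: act0)
qed

text \<open>Degree \<open>p\<close> morphisms, differential, composition and constant morphisms of \<open>T\<^sub>P\<^sub>L(T\<^sup>2)\<close>.\<close>

type_synonym ('v, 'w) cochain = "nat \<Rightarrow> tsimplex \<Rightarrow> ('v \<Rightarrow> 'w) form"

definition T_hom :: "('k::field, 'v::ab_group_add) rep \<Rightarrow> ('k, 'w::ab_group_add) rep \<Rightarrow> nat
    \<Rightarrow> ('v, 'w) cochain set" where
  "T_hom V V' p = C_PL torus (Hom_ls V V') p"

definition T_d :: "('k::field, 'v::ab_group_add) rep \<Rightarrow> ('k, 'w::ab_group_add) rep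
    \<Rightarrow> ('v, 'w) cochain \<Rightarrow> ('v, 'w) cochain" where
  "T_d V V' = d_PL (Hom_ls V V')"

definition T_comp :: "('v::ab_group_add, 'w::ab_group_add) cochain
    \<Rightarrow> ('u::ab_group_add, 'v) cochain \<Rightarrow> ('u, 'w) cochain" where
  "T_comp \<alpha> \<beta> = (\<lambda>n x. wedge (\<circ>) (\<alpha> n x) (\<beta> n x))"

definition T_const :: "('v::ab_group_add \<Rightarrow> 'w::ab_group_add) \<Rightarrow> ('v, 'w) cochain" where
  "T_const f = (\<lambda>n x. if x \<in> simps torus n then monoform (const_poly f) {} else 0)"

definition T_id :: "('v::ab_group_add, 'v) cochain" where
  "T_id = T_const id"

definition is_splitting :: "('k::field, 'w::ab_group_add) rep \<Rightarrow> ('k, 'u::ab_group_add) rep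
    \<Rightarrow> ('k, 'v::ab_group_add) rep \<Rightarrow> ('w, 'u) cochain \<Rightarrow> ('u, 'v) cochain
    \<Rightarrow> ('u, 'w) cochain \<Rightarrow> ('v, 'u) cochain \<Rightarrow> bool" where
  "is_splitting V' Vt V p q \<alpha> \<beta> \<longleftrightarrow>
     \<alpha> \<in> T_hom Vt V' 0 \<and> \<beta> \<in> T_hom V Vt 0 \<and>
     T_comp \<alpha> \<beta> = 0 \<and> T_comp \<alpha> p = T_id \<and> T_comp q \<beta> = T_id \<and>
     T_comp p \<alpha> + T_comp \<beta> q = T_id"

definition is_extension :: "('k::field, 'w::ab_group_add) rep \<Rightarrow> ('k, 'u::ab_group_add) rep
    \<Rightarrow> ('k, 'v::ab_group_add) rep \<Rightarrow> ('w, 'u) cochain \<Rightarrow> ('u, 'v) cochain \<Rightarrow> bool" where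
  "is_extension V' Vt V p q \<longleftrightarrow>
     p \<in> T_hom V' Vt 0 \<and> q \<in> T_hom Vt V 0 \<and>
     T_d V' Vt p = 0 \<and> T_d Vt V q = 0 \<and> T_comp q p = 0 \<and>
     (\<exists>\<alpha> \<beta>. is_splitting V' Vt V p q \<alpha> \<beta>)"

text \<open>The class \<open>[\<alpha> d\<beta>]\<close> is the same for all splittings, one of which exists by the
  definition of an extension.\<close>

definition has_extension_class :: "('k::field, 'w::ab_group_add) rep
    \<Rightarrow> ('k, 'u::ab_group_add) rep \<Rightarrow> ('k, 'v::ab_group_add) rep
    \<Rightarrow> ('w, 'u) cochain \<Rightarrow> ('u, 'v) cochain \<Rightarrow> ('v, 'w) cochain set \<Rightarrow> bool" where
  "has_extension_class V' Vt V p q c \<longleftrightarrow>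
     is_extension V' Vt V p q \<and>
     (\<forall>\<alpha> \<beta>. is_splitting V' Vt V p q \<alpha> \<beta> \<longrightarrow>
        T_comp \<alpha> (T_d V Vt \<beta>) \<in> cocycles torus (Hom_ls V V') 1 \<and>
        coh_class torus (Hom_ls V V') 1 (T_comp \<alpha> (T_d V Vt \<beta>)) = c)"

section \<open>Block matrices with respect to a direct sum \<open>V' \<oplus> V\<close>\<close>

definition row :: "('w::ab_group_add \<Rightarrow> 'u::ab_group_add) \<Rightarrow> ('v::ab_group_add \<Rightarrow> 'u)
    \<Rightarrow> ('w \<times> 'v \<Rightarrow> 'u)" where
  "row f g = (\<lambda>(w, v). f w + g v)"

definition col :: "('u::ab_group_add \<Rightarrow> 'w::ab_group_add) \<Rightarrow> ('u \<Rightarrow> 'v::ab_group_add)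
    \<Rightarrow> ('u \<Rightarrow> 'w \<times> 'v)" where
  "col f g = (\<lambda>u. (f u, g u))"

text \<open>Rows and columns of polynomials with coefficients in linear maps, coefficientwise.\<close>

definition row_poly :: "('w::ab_group_add \<Rightarrow> 'u::ab_group_add) mpoly
    \<Rightarrow> ('v::ab_group_add \<Rightarrow> 'u) mpoly \<Rightarrow> ('w \<times> 'v \<Rightarrow> 'u) mpoly" where
  "row_poly p q = (\<Sum>a\<in>Poly_Mapping.keys p \<union> Poly_Mapping.keys q. Poly_Mapping.single a (row (Poly_Mapping.lookup p a) (Poly_Mapping.lookup q a)))"

definition col_poly :: "('u::ab_group_add \<Rightarrow> 'w::ab_group_add) mpoly
    \<Rightarrow> ('u \<Rightarrow> 'v::ab_group_add) mpoly \<Rightarrow> ('u \<Rightarrow> 'w \<times> 'v) mpoly" where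
  "col_poly p q = (\<Sum>a\<in>Poly_Mapping.keys p \<union> Poly_Mapping.keys q. Poly_Mapping.single a (col (Poly_Mapping.lookup p a) (Poly_Mapping.lookup q a)))"

section \<open>Forms on the square as PL cocycles\<close>

definition form1 :: "'l::ab_group_add mpoly \<Rightarrow> 'l mpoly \<Rightarrow> 'l form" where
  "form1 P Q = monoform P {1} + monoform Q {2}"

text \<open>The restrictions of \<open>P dt\<^sub>1 + Q dt\<^sub>2\<close> to the simplices of the torus.\<close>

definition omega :: "('k::field, 'w::ab_group_add) rep \<Rightarrow> ('v \<Rightarrow> 'w) mpoly \<Rightarrow> ('v \<Rightarrow> 'w) mpoly
    \<Rightarrow> ('v, 'w) cochain" where
  "omega V' P Q = square_form (Lin_scale V') (form1 P Q)"

definition is_square_cocycle :: "('k::field, 'v::ab_group_add) rep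
    \<Rightarrow> ('k, 'w::ab_group_add) rep \<Rightarrow> ('v \<Rightarrow> 'w) mpoly \<Rightarrow> ('v \<Rightarrow> 'w) mpoly \<Rightarrow> bool" where
  "is_square_cocycle V V' P Q \<longleftrightarrow>
     P \<in> square_polys (Lin V V') \<and> Q \<in> square_polys (Lin V V') \<and>
     omega V' P Q \<in> cocycles torus (Hom_ls V V') 1"

definition is_potential :: "('k::field, 'v::ab_group_add) rep \<Rightarrow> ('k, 'w::ab_group_add) rep
    \<Rightarrow> ('v \<Rightarrow> 'w) mpoly \<Rightarrow> ('v \<Rightarrow> 'w) mpoly \<Rightarrow> ('v \<Rightarrow> 'w) mpoly \<Rightarrow> bool" where
  "is_potential V V' P Q \<mu> \<longleftrightarrow>
     \<mu> \<in> square_polys (Lin V V') \<and>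
     poly_deriv (Lin_scale V') 1 \<mu> = P \<and> poly_deriv (Lin_scale V') 2 \<mu> = Q \<and>
     poly_eval (Lin_scale V') \<mu> (square_point 0 0) = 0"

end

theory Submission
  imports Defs
begin

text \<open>
  A torus simplex \<open>x\<close> is represented by a simplex of the square, and this representative always has
  the corner \<open>(0,0)\<close> as its initial vertex. A closed 1-form on a simplex has exactly one primitive
  that vanishes at the initial vertex (Poincare lemma in characteristic 0: \<open>primitive_exists\<close>,
  \<open>primitive_unique\<close>). So a 1-cocycle \<open>\<omega>\<close> has a canonical family of primitives \<open>F\<^sub>x\<close>. It is not a
  cochain: \<open>\<theta>\<close> may move the initial vertex of \<open>x\<close> to another corner \<open>g\<close> of the square, and
  uniqueness of primitives then gives, with \<open>g\<close> read as an element of \<open>\<int> \<times> \<int>\<close>,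

    \<open>F\<^bsub>\<theta>*x\<^esub> = g \<cdot> (\<theta>\<^sup>*F\<^sub>x - E g)\<close>,

  where \<open>E g\<close> is the value of \<open>F\<close> at the corner \<open>g\<close>; it does not depend on \<open>x\<close>, because it is read
  off from the edge that joins \<open>(0,0)\<close> to \<open>g\<close>. Families with this law are called quasi-periodic with
  periods \<open>E\<close>. Two of them with the same periods differ by a cochain of degree 0, so their
  differentials are cohomologous (\<open>coh_class_quasi_periodic\<close>): the class of \<open>\<omega>\<close> depends only on the
  values of \<open>F\<close> at the corners. Everything else follows from this.

  Existence of a polynomial representative. The two triangles of the square give
  \<open>E(0,1) = g\<^sub>1 \<cdot> (E(1,1) - E(1,0))\<close> and \<open>E(1,0) = g\<^sub>2 \<cdot> (E(1,1) - E(0,1))\<close>. These relations are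
  all that the bilinear interpolation \<open>\<mu>\<close> of the four values \<open>E g\<close> needs to be quasi-periodic with
  periods \<open>E\<close> (\<open>quasi_periodic_bilinear\<close>), so \<open>d\<mu>\<close> represents the class of \<open>\<omega>\<close>.

  Existence and uniqueness of the potential. A form on the square is determined by its restriction
  to one triangle, because the coordinates of the triangle and of the square differ by an invertible
  linear substitution. The primitive on the triangle, rewritten in the coordinates of the square, is
  the potential \<open>\<mu>\<close>.

  Extension and splitting. The family of restrictions of \<open>\<mu>\<close> is quasi-periodic with periods
  \<open>E g = \<mu>(g)\<close>. The law of quasi-periodicity says precisely that the column with entries \<open>\<mu>\<close> and
  \<open>id\<close> and the row with entries \<open>id\<close> and \<open>-\<mu>\<close> are compatible with the block triangular action whose
  upper right entry at a corner \<open>g\<close> is \<open>-r'\<^sub>g \<mu>(g)\<close> (\<open>row_cochain_in_C_PL\<close>,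
  \<open>col_cochain_in_C_PL\<close>), and the two relations between the periods say that the blocks of the two
  generators commute (\<open>block_extension_exists\<close>). Conversely every splitting of such an extension
  consists of a row and a column of this kind for some quasi-periodic \<open>\<nu>\<close> with the same periods
  (\<open>splitting_is_row_col\<close>), and its class is that of \<open>d\<nu>\<close>, hence that of \<open>d\<mu>\<close>.

  The algebra of forms that is needed consists of the chain rule, the functoriality of substitution
  and the Poincare lemma, in degrees 0 and 1. These are proved on monomials and extended linearly,
  first for scalar coefficients and then for vector coefficients by tensoring.
\<close>

abbreviation "lookup \<equiv> Poly_Mapping.lookup"
abbreviation "keys \<equiv> Poly_Mapping.keys"
abbreviation "single \<equiv> Poly_Mapping.single"

section \<open>Linear extension of maps on coefficients\<close>

text \<open>
  All operations on polynomials and forms are sums over the support of their argument. The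
  support does not behave additively, so the common shape of these sums is isolated here and
  their additivity is proved once.
\<close>

definition lin_ext :: "('i \<Rightarrow> 'c \<Rightarrow> 'd) \<Rightarrow> ('i \<Rightarrow>\<^sub>0 'c::zero) \<Rightarrow> 'd::comm_monoid_add" where
  "lin_ext F p = (\<Sum>k\<in>keys p. F k (lookup p k))"

lemma lin_ext_superset:
  assumes "finite A" "keys p \<subseteq> A" "\<And>k. F k 0 = 0"
  shows "lin_ext F p = (\<Sum>k\<in>A. F k (lookup p k))"
  unfolding lin_ext_def using assms
  by (intro sum.mono_neutral_left) (auto simp: not_in_keys_iff_lookup_eq_zero)

lemma additive_lin_ext:
  fixes F :: "'i \<Rightarrow> 'c::ab_group_add \<Rightarrow> 'd::ab_group_add"
  assumes "\<And>k. additive (F k)"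
  shows "additive (lin_ext F)"
proof
  fix p q :: "'i \<Rightarrow>\<^sub>0 'c"
  note z = additive.zero[OF assms]
  let ?A = "keys p \<union> keys q"
  have "lin_ext F (p + q) = (\<Sum>k\<in>?A. F k (lookup (p + q) k))"
    by (rule lin_ext_superset) (auto simp: z dest: subsetD[OF keys_add])
  also have "\<dots> = (\<Sum>k\<in>?A. F k (lookup p k)) + (\<Sum>k\<in>?A. F k (lookup q k))"
    by (simp add: lookup_add additive.add[OF assms] sum.distrib)
  also have "\<dots> = lin_ext F p + lin_ext F q"
    by (simp add: z lin_ext_superset[of ?A])
  finally show "lin_ext F (p + q) = lin_ext F p + lin_ext F q" .
qed

lemma lin_ext_single: "F k 0 = 0 \<Longrightarrow> lin_ext F (single k c) = F k c"
  by (cases "c = 0") (simp_all add: lin_ext_def)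

lemma lin_ext_cong:
  "(\<And>k. k \<in> keys p \<Longrightarrow> F k (lookup p k) = G k (lookup p k)) \<Longrightarrow> lin_ext F p = lin_ext G p"
  by (simp add: lin_ext_def)

lemma sum_singles: "(\<Sum>k\<in>keys p. single k (lookup p k)) = p"
  by (rule poly_mapping_eqI)
     (auto simp: lookup_sum lookup_single when_def if_distrib sum.If_cases not_in_keys_iff_lookup_eq_zero)

text \<open>
  This is how identities between operations on forms are reduced to identities between monomials.
\<close>

lemma additive_eqI:
  assumes "additive f" "additive g"
    and "\<And>k. k \<in> keys p \<Longrightarrow> f (single k (lookup p k)) = g (single k (lookup p k))"
  shows "f p = g p"
proof -
  have "f (\<Sum>k\<in>keys p. single k (lookup p k)) = g (\<Sum>k\<in>keys p. single k (lookup p k))"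
    using assms by (simp add: additive.sum)
  then show ?thesis
    by (simp add: sum_singles)
qed

lemma additive_compose: "additive f \<Longrightarrow> additive g \<Longrightarrow> additive (\<lambda>x. f (g x))"
  by (simp add: additive_def)

lemma additive_lookup: "additive (\<lambda>p. lookup p k)"
  by unfold_locales (simp add: lookup_add)

lemma additive_single: "additive (single k)"
  by unfold_locales (simp add: single_add)

lemma additive_zero: "additive (\<lambda>_. 0 :: 'a::ab_group_add)"
  by unfold_locales simp

lemma additive_sum: "(\<And>i. i \<in> A \<Longrightarrow> additive (f i)) \<Longrightarrow> additive (\<lambda>x. \<Sum>i\<in>A. f i x)"
  by (simp add: additive_def sum.distrib)

lemma lookup_map [simp]: "f 0 = 0 \<Longrightarrow> lookup (Poly_Mapping.map f p) k = f (lookup p k)"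
  by (simp add: Poly_Mapping.map.rep_eq when_def)

lemma additive_map:
  assumes "additive f" shows "additive (Poly_Mapping.map f)"
  by unfold_locales (rule poly_mapping_eqI, simp add: additive.zero[OF assms] lookup_add additive.add[OF assms])

lemma map_zero [simp]: "Poly_Mapping.map f 0 = 0"
  by (simp add: Poly_Mapping.map_eq_zero_iff)

section \<open>Polynomials and forms as linear extensions\<close>

definition mono_val :: "(nat \<Rightarrow> 'r::comm_monoid_mult) \<Rightarrow> mono \<Rightarrow> 'r" where
  "mono_val T a = (\<Prod>i\<in>keys a. T i ^ lookup a i)"

lemma mono_val_superset:
  assumes "finite A" "keys a \<subseteq> A"
  shows "mono_val T a = (\<Prod>i\<in>A. T i ^ lookup a i)"
  unfolding mono_val_def using assms
  by (intro prod.mono_neutral_left) (auto simp: not_in_keys_iff_lookup_eq_zero)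

lemma mono_val_add: "mono_val T (a + b) = mono_val T a * mono_val T b"
proof -
  let ?A = "keys a \<union> keys b"
  have "mono_val T (a + b) = (\<Prod>i\<in>?A. T i ^ lookup (a + b) i)"
    by (rule mono_val_superset) (auto dest: subsetD[OF keys_add])
  also have "\<dots> = (\<Prod>i\<in>?A. T i ^ lookup a i) * (\<Prod>i\<in>?A. T i ^ lookup b i)"
    by (simp add: lookup_add power_add prod.distrib)
  also have "\<dots> = mono_val T a * mono_val T b"
    by (simp add: mono_val_superset[of ?A])
  finally show ?thesis .
qed

lemma mono_val_0 [simp]: "mono_val T 0 = 1"
  by (simp add: mono_val_def)

lemma mono_val_unit [simp]: "mono_val T (single i (Suc 0)) = T i"
  by (simp add: mono_val_def)

lemma mono_val_cong: "(\<And>i. i \<in> keys a \<Longrightarrow> T i = T' i) \<Longrightarrow> mono_val T a = mono_val T' a"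
  by (simp add: mono_val_def)

lemma mono_val_hom:
  assumes "h 1 = 1" "\<And>x y. h (x * y) = h x * h y"
  shows "h (mono_val T a) = mono_val (\<lambda>i. h (T i)) a"
proof -
  have pow: "h (x ^ n) = h x ^ n" for x n
    by (induction n) (simp_all add: assms)
  have "h (\<Prod>i\<in>A. T i ^ lookup a i) = (\<Prod>i\<in>A. h (T i) ^ lookup a i)" for A
    by (induction A rule: infinite_finite_induct) (simp_all add: assms pow)
  then show ?thesis
    by (simp add: mono_val_def)
qed

lemma minus_unit_plus: "i \<in> keys c \<Longrightarrow> c - single i 1 + single i 1 = (c :: mono)"
  by (rule poly_mapping_eqI) (auto simp: lookup_add lookup_minus lookup_single when_def in_keys_iff)

lemma keys_unit_add: "keys (single i (Suc 0) + a) = insert i (keys a)"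
  by (auto simp: in_keys_iff lookup_add lookup_single when_def split: if_splits)

lemma mono_induct [case_names zero add]:
  assumes "P 0" "\<And>i a. P a \<Longrightarrow> P (single i 1 + a)"
  shows "P (a :: mono)"
proof (induction "\<Sum>i\<in>keys a. lookup a i" arbitrary: a)
  case 0
  then have "a = 0"
    by (auto intro!: poly_mapping_eqI simp: not_in_keys_iff_lookup_eq_zero)
  then show ?case using assms by simp
next
  case (Suc n)
  then obtain i where i: "i \<in> keys a"
    by (metis Zero_not_Suc sum.empty ex_in_conv)
  define b where "b = a - single i 1"
  have a: "a = single i 1 + b"
    using minus_unit_plus[OF i] by (simp only: b_def add.commute)
  have "(\<Sum>j\<in>keys b. lookup b j) = (\<Sum>j\<in>keys a. lookup b j)"
    by (intro sum.mono_neutral_left) (auto simp: b_def in_keys_iff lookup_minus)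
  also have "\<dots> = n"
  proof -
    have "(\<Sum>j\<in>keys a. lookup a j) = (\<Sum>j\<in>keys a. (1 when i = j)) + (\<Sum>j\<in>keys a. lookup b j)"
      by (subst a) (simp add: lookup_add lookup_single sum.distrib)
    also have "(\<Sum>j\<in>keys a. (1 when i = j)) = (1::nat)"
      using i by (simp add: when_def)
    finally show ?thesis using Suc by simp
  qed
  finally show ?case
    using Suc.hyps(1)[of b] assms(2) a by metis
qed

lemma poly_eval_lin_ext: "poly_eval s p x = lin_ext (\<lambda>a. s (mono_val x a)) p"
  by (simp add: poly_eval_def lin_ext_def mono_val_def)

lemma poly_deriv_lin_ext:
  "poly_deriv s i = lin_ext (\<lambda>a c. single (a - single i 1) (s (of_nat (lookup a i)) c))"
  by (simp add: poly_deriv_def lin_ext_def fun_eq_iff)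

lemma monoform_lin_ext: "monoform p I = lin_ext (\<lambda>a. single (a, I)) p"
  by (simp add: monoform_def lin_ext_def)

lemma wedge_lin_ext:
  "wedge B \<omega> \<eta> = lin_ext (\<lambda>(a, I) u. lin_ext (\<lambda>(b, J) v.
      if I \<inter> J = {} then single (a + b, I \<union> J)
          (if even (card {(i, j). i \<in> I \<and> j \<in> J \<and> j < i}) then B u v else - B u v) else 0) \<eta>) \<omega>"
  by (simp add: wedge_def lin_ext_def case_prod_beta cong: if_cong)

lemma ext_deriv_lin_ext:
  "ext_deriv s = lin_ext (\<lambda>(a, I) c. \<Sum>i\<in>keys a - I. single (a - single i 1, insert i I)
      (s ((-1) ^ card {j\<in>I. j < i} * of_nat (lookup a i)) c))"
  by (simp add: ext_deriv_def lin_ext_def case_prod_beta fun_eq_iff)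

lemma form_subst_lin_ext:
  "form_subst s T = lin_ext (\<lambda>(a, I) c. wedge s (subst_basis T a I) (monoform (const_poly c) {}))"
  by (simp add: form_subst_def lin_ext_def case_prod_beta fun_eq_iff)

lemma lookup_monoform: "lookup (monoform p I) (a, J) = (lookup p a when J = I)"
proof -
  have "lookup (monoform p I) (a, J) = (\<Sum>b\<in>keys p. lookup p b when (b, I) = (a, J))"
    by (simp add: monoform_def lookup_sum lookup_single)
  also have "\<dots> = (\<Sum>b\<in>keys p. if b = a then lookup p a when J = I else 0)"
    by (intro sum.cong) (auto simp: when_def)
  also have "\<dots> = (lookup p a when J = I)"
    by (auto simp: when_def not_in_keys_iff_lookup_eq_zero)
  finally show ?thesis .
qed

lemma additive_monoform: "additive (\<lambda>p. monoform p I)"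
  unfolding monoform_lin_ext by (intro additive_lin_ext additive_single)

lemma monoform_map: "h 0 = 0 \<Longrightarrow> monoform (Poly_Mapping.map h p) I = Poly_Mapping.map h (monoform p I)"
  by (rule poly_mapping_eqI) (auto simp: lookup_monoform when_def)

lemma monoform_single [simp]: "monoform (single a c) I = single (a, I) c"
  by (simp add: monoform_lin_ext lin_ext_single)

lemma monoform_const [simp]: "monoform (const_poly c) I = single (0, I) c"
  by (simp add: const_poly_def)

lemma monoform_0 [simp]: "monoform 0 I = 0"
  by (simp add: monoform_def)

text \<open>
  The coefficient of \<open>dt\<^sub>I\<close>. For scalar forms it takes values in a commutative ring, where the
  calculations below are done.
\<close>

definition dt_coeff :: "'l form \<Rightarrow> nat set \<Rightarrow> 'l::ab_group_add mpoly" where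
  "dt_coeff \<omega> I = Poly_Mapping.map_key (\<lambda>a. (a, I)) \<omega>"

lemma lookup_dt_coeff [simp]: "lookup (dt_coeff \<omega> I) a = lookup \<omega> (a, I)"
proof -
  have "inj (\<lambda>a::mono. (a, I))"
    by (simp add: inj_on_def)
  then show ?thesis
    by (simp add: dt_coeff_def Poly_Mapping.map_key.rep_eq)
qed

lemma form_eqI: "(\<And>I. dt_coeff \<omega> I = dt_coeff \<eta> I) \<Longrightarrow> \<omega> = \<eta>"
  by (metis lookup_dt_coeff poly_mapping_eqI surj_pair)

lemma additive_dt_coeff: "additive (\<lambda>\<omega>. dt_coeff \<omega> I)"
  by unfold_locales (auto intro: poly_mapping_eqI simp: lookup_add)

lemma dt_coeff_monoform: "dt_coeff (monoform p I) J = (if J = I then p else 0)"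
  by (rule poly_mapping_eqI) (simp add: lookup_monoform)

lemma additive_wedge_left:
  assumes "\<And>v. additive (\<lambda>u. B u v)"
  shows "additive (\<lambda>\<omega>. wedge B \<omega> \<eta>)"
proof -
  have "additive (\<lambda>u. lin_ext (\<lambda>(b, J) v.
      if I \<inter> J = {} then single (a + b, I \<union> J)
          (if even (card {(i, j). i \<in> I \<and> j \<in> J \<and> j < i}) then B u v else - B u v) else 0) \<eta>)" for a I
    unfolding lin_ext_def using assms
    by (intro additive_sum) (auto simp: additive_def single_add single_diff single_uminus)
  then show ?thesis
    unfolding wedge_lin_ext by (intro additive_lin_ext) auto
qed

lemma additive_wedge_right:
  assumes "\<And>k. additive (B (lookup \<omega> k))"
  shows "additive (wedge B \<omega>)"
proof -
  have "additive (\<lambda>\<eta>. lin_ext (\<lambda>(b, J) v.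
      if I \<inter> J = {} then single (a + b, I \<union> J)
          (if even (card {(i, j). i \<in> I \<and> j \<in> J \<and> j < i}) then B (lookup \<omega> (a, I)) v else - B (lookup \<omega> (a, I)) v) else 0) \<eta>)" for a I
    using assms
    by (intro additive_lin_ext) (auto simp: additive_def single_add single_diff single_uminus)
  then show ?thesis
    unfolding wedge_lin_ext[abs_def] lin_ext_def[of _ \<omega>]
    by (intro additive_sum) (auto cong: if_cong)
qed

lemma wedge_zero_right [simp]: "wedge B \<omega> 0 = 0"
  by (simp add: wedge_lin_ext lin_ext_def)

lemma wedge_zero_left [simp]: "wedge B 0 \<omega> = 0"
  by (simp add: wedge_lin_ext lin_ext_def)

text \<open>
  The support of the left factor is empty for \<open>u = 0\<close>, hence the condition on \<open>B 0\<close>.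
\<close>

lemma wedge_const_left:
  assumes "\<And>v. B 0 v = 0"
  shows "wedge B (single (0, {}) u) \<eta> = Poly_Mapping.map (B u) \<eta>"
proof (cases "u = 0")
  case True
  then show ?thesis
    by (auto intro!: poly_mapping_eqI simp: assms)
next
  case False
  have "wedge B (single (0, {}) u) \<eta> = (\<Sum>k\<in>keys \<eta>. single k (B u (lookup \<eta> k)))"
    using False by (simp add: wedge_lin_ext lin_ext_def case_prod_beta)
  also have "\<dots> = Poly_Mapping.map (B u) \<eta>"
    by (rule poly_mapping_eqI)
      (auto simp: lookup_sum lookup_single when_def Poly_Mapping.map.rep_eq if_distrib sum.If_cases in_keys_iff)
  finally show ?thesis .
qed

lemma wedge_const_right:
  assumes "\<And>k. B (lookup \<omega> k) 0 = 0" "B 0 v = 0"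
  shows "wedge B \<omega> (single (0, {}) v) = Poly_Mapping.map (\<lambda>u. B u v) \<omega>"
proof (cases "v = 0")
  case True
  have "Poly_Mapping.map (\<lambda>u. B u 0) \<omega> = 0"
    by (rule poly_mapping_eqI) (simp add: Poly_Mapping.map.rep_eq assms)
  with True show ?thesis by simp
next
  case False
  have "wedge B \<omega> (single (0, {}) v) = (\<Sum>k\<in>keys \<omega>. single k (B (lookup \<omega> k) v))"
    using False by (simp add: wedge_lin_ext lin_ext_def case_prod_beta)
  also have "\<dots> = Poly_Mapping.map (\<lambda>u. B u v) \<omega>"
    by (rule poly_mapping_eqI)
      (auto simp: lookup_sum lookup_single when_def Poly_Mapping.map.rep_eq if_distrib sum.If_cases in_keys_iff)
  finally show ?thesis .
qed

section \<open>The exterior derivative and scalar substitution\<close>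

lemma vector_space_field: "vector_space ((*) :: 'k::field \<Rightarrow> 'k \<Rightarrow> 'k)"
  by unfold_locales (simp_all add: algebra_simps)

lemma dt_coeff_single: "dt_coeff (single (a, I) c) J = (if I = J then single a c else 0)"
  by (rule poly_mapping_eqI) (simp add: lookup_single when_def)

context vector_space
begin

lemma additive_scale_left: "additive (\<lambda>r. scale r c)"
  by unfold_locales (rule scale_left_distrib)

lemma additive_scale_right: "additive (scale r)"
  by unfold_locales (rule scale_right_distrib)

lemma additive_ext_deriv: "additive (ext_deriv scale)"
  unfolding ext_deriv_lin_ext
  by (intro additive_lin_ext) (auto simp: additive_def single_add scale_right_distrib sum.distrib)

lemma ext_deriv_single:
  "ext_deriv scale (single (a, I) c) = (\<Sum>i\<in>keys a - I. single (a - single i 1, insert i I)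
      (scale ((-1) ^ card {j\<in>I. j < i} * of_nat (lookup a i)) c))"
  by (simp add: ext_deriv_lin_ext lin_ext_single)

text \<open>
  The term \<open>t\<^sup>b dt\<^sub>J\<close> arises only from the terms \<open>t\<^sup>b t\<^sub>i dt\<^bsub>J-{i}\<^esub>\<close> with \<open>i \<in> J\<close>.
\<close>

lemma lookup_ext_deriv:
  assumes "finite J"
  shows "lookup (ext_deriv scale \<omega>) (b, J) =
    (\<Sum>i\<in>J. scale ((-1) ^ card {j\<in>J. j < i} * of_nat (lookup b i + 1))
              (lookup \<omega> (b + single i 1, J - {i})))"
proof (rule additive_eqI[where p = \<omega>])
  show "additive (\<lambda>\<omega>. lookup (ext_deriv scale \<omega>) (b, J))"
    by (rule additive_compose[OF additive_lookup additive_ext_deriv])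
  show "additive (\<lambda>\<omega>. \<Sum>i\<in>J. scale ((-1) ^ card {j\<in>J. j < i} * of_nat (lookup b i + 1))
              (lookup \<omega> (b + single i 1, J - {i})))"
    by (intro additive_sum additive_compose[OF additive_scale_right] additive_lookup)
next
  fix k assume "k \<in> keys \<omega>"
  obtain a I where k: "k = (a, I)" by (cases k)
  define c where "c = lookup \<omega> k"
  \<comment> \<open>the indices \<open>i\<close> for which the \<open>i\<close>-th derivative of \<open>t\<^sup>a dt\<^sub>I\<close> is a multiple of \<open>t\<^sup>b dt\<^sub>J\<close>\<close>
  let ?K = "{i\<in>J. a = b + single i 1 \<and> I = J - {i}}"
  let ?t = "\<lambda>i. scale ((-1) ^ card {j\<in>J. j < i} * of_nat (lookup b i + 1)) c"
  have key: "a - single i 1 = b \<and> insert i I = J \<longleftrightarrow> i \<in> ?K" if "i \<in> keys a - I" for i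
  proof -
    have "a - single i 1 + single i 1 = a"
      using that by (intro minus_unit_plus) simp
    then show ?thesis using that by auto
  qed
  have "lookup (ext_deriv scale (single (a, I) c)) (b, J) =
     (\<Sum>i\<in>keys a - I. if i \<in> ?K then ?t i else 0)"
    unfolding ext_deriv_single lookup_sum
  proof (rule sum.cong[OF refl])
    fix i assume i: "i \<in> keys a - I"
    show "lookup (single (a - single i 1, insert i I)
         (scale ((- 1) ^ card {j \<in> I. j < i} * of_nat (lookup a i)) c)) (b, J) =
         (if i \<in> ?K then ?t i else 0)"
    proof (cases "i \<in> ?K")
      case True
      then have "{j \<in> I. j < i} = {j\<in>J. j < i}" "lookup a i = lookup b i + 1"
        by (auto simp: lookup_add)
      with True key[OF i] show ?thesis
        by (auto simp: lookup_single)
    next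
      case False
      with key[OF i] show ?thesis
        by (auto simp: lookup_single when_def)
    qed
  qed
  also have "\<dots> = (\<Sum>i\<in>?K. ?t i)"
  proof -
    have "?K \<subseteq> keys a - I"
      by (auto simp: in_keys_iff lookup_add)
    then show ?thesis
      by (subst sum.mono_neutral_right[of _ ?K]) (auto intro!: sum.cong)
  qed
  also have "\<dots> = (\<Sum>i\<in>J. scale ((-1) ^ card {j\<in>J. j < i} * of_nat (lookup b i + 1))
              (lookup (single (a, I) c) (b + single i 1, J - {i})))"
    by (rule sum.mono_neutral_cong_left) (auto simp: assms lookup_single when_def)
  finally show "lookup (ext_deriv scale (single k (lookup \<omega> k))) (b, J) =
    (\<Sum>i\<in>J. scale ((-1) ^ card {j\<in>J. j < i} * of_nat (lookup b i + 1))
              (lookup (single k (lookup \<omega> k)) (b + single i 1, J - {i})))"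
    unfolding k c_def .
qed

lemma keys_ext_deriv:
  assumes "(b, J) \<in> keys (ext_deriv scale \<omega>)"
  obtains i I where "i \<notin> I" "J = insert i I" "(b + single i 1, I) \<in> keys \<omega>"
proof -
  have "(b, J) \<in> (\<Union>(a, I)\<in>keys \<omega>. \<Union>i\<in>keys a - I. {(a - single i 1, insert i I)})"
    using assms unfolding ext_deriv_def
    by (fastforce dest!: subsetD[OF keys_sum] split: if_splits)
  then obtain a I i where i: "(a, I) \<in> keys \<omega>" "i \<in> keys a - I" "b = a - single i 1" "J = insert i I"
    by auto
  have "a = b + single i 1"
    using i(2,3) by (simp only: minus_unit_plus Diff_iff)
  with i(1) have "(b + single i 1, I) \<in> keys \<omega>"
    by simp
  with i(2,4) show ?thesis
    by (intro that[of i I]) simp_all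
qed

lemma dt_coeff_ext_deriv_monoform:
  "dt_coeff (ext_deriv scale (monoform p {})) J = (if \<exists>j. J = {j} then poly_deriv scale (the_elem J) p else 0)"
proof (rule additive_eqI[where p = p])
  show "additive (\<lambda>p. dt_coeff (ext_deriv scale (monoform p {})) J)"
    by (intro additive_compose[OF additive_dt_coeff] additive_compose[OF additive_ext_deriv] additive_monoform)
  show "additive (\<lambda>p. if \<exists>j. J = {j} then poly_deriv scale (the_elem J) p else 0)"
    unfolding poly_deriv_lin_ext
    by (cases "\<exists>j. J = {j}")
       (auto intro!: additive_lin_ext additive_zero additive_compose[OF additive_single] additive_scale_right)
next
  fix a assume "a \<in> keys p"
  define c where "c = lookup p a"
  have "dt_coeff (ext_deriv scale (single (a, {}) c)) J =
      (\<Sum>i\<in>keys a. dt_coeff (single (a - single i 1, {i}) (scale (of_nat (lookup a i)) c)) J)"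
    by (simp add: ext_deriv_single additive.sum[OF additive_dt_coeff])
  also have "\<dots> = (\<Sum>i\<in>keys a. if {i} = J then single (a - single i 1) (scale (of_nat (lookup a i)) c) else 0)"
    by (simp add: dt_coeff_single cong: if_cong)
  also have "\<dots> = (if \<exists>j. J = {j} then poly_deriv scale (the_elem J) (single a c) else 0)"
    by (auto simp: poly_deriv_lin_ext lin_ext_single in_keys_iff intro!: sum.neutral)
  finally show "dt_coeff (ext_deriv scale (monoform (single a (lookup p a)) {})) J =
    (if \<exists>j. J = {j} then poly_deriv scale (the_elem J) (single a (lookup p a)) else 0)"
    by (simp add: c_def)
qed

end

lemma wedge_single_0:
  "B 0 v = 0 \<Longrightarrow> B u 0 = 0 \<Longrightarrow> wedge B (single (a, {}) u) (single (b, J) v) = single (a + b, J) (B u v)"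
  by (cases "u = 0"; cases "v = 0") (simp_all add: wedge_def)

lemma additive_mult_left: "additive (\<lambda>x::'r::ring. x * c)"
  by unfold_locales (simp add: distrib_right)

lemma additive_mult_right: "additive (\<lambda>x::'r::ring. c * x)"
  by unfold_locales (simp add: distrib_left)

lemma dt_coeff_wedge_0:
  fixes p :: "'k::field mpoly"
  shows "dt_coeff (wedge (*) (monoform p {}) \<eta>) I = p * dt_coeff \<eta> I"
proof (rule additive_eqI[where p = p])
  show "additive (\<lambda>p. dt_coeff (wedge (*) (monoform p {}) \<eta>) I)"
    by (intro additive_compose[OF additive_dt_coeff] additive_monoform
       additive_compose[OF additive_wedge_left] additive_mult_left)
  show "additive (\<lambda>p. p * dt_coeff \<eta> I)"
    by (rule additive_mult_left)
next
  fix a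
  show "dt_coeff (wedge (*) (monoform (single a (lookup p a)) {}) \<eta>) I = single a (lookup p a) * dt_coeff \<eta> I"
  proof (rule additive_eqI[where p = \<eta>])
    show "additive (\<lambda>\<eta>. dt_coeff (wedge (*) (monoform (single a (lookup p a)) {}) \<eta>) I)"
      by (intro additive_compose[OF additive_dt_coeff] additive_wedge_right additive_mult_right)
    show "additive (\<lambda>\<eta>. single a (lookup p a) * dt_coeff \<eta> I)"
      by (intro additive_compose[OF additive_mult_right] additive_dt_coeff)
  next
    fix k assume "k \<in> keys \<eta>"
    obtain b J where k: "k = (b, J)" by (cases k)
    show "dt_coeff (wedge (*) (monoform (single a (lookup p a)) {}) (single k (lookup \<eta> k))) I =
         single a (lookup p a) * dt_coeff (single k (lookup \<eta> k)) I"
      by (simp add: k wedge_single_0 dt_coeff_single mult_single)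
  qed
qed

lemma wedge_one_right [simp]: "wedge (*) \<eta> (monoform 1 {}) = (\<eta> :: 'k::field form)"
proof -
  have "wedge (*) \<eta> (single (0, {}) 1) = Poly_Mapping.map (\<lambda>u. u * 1) \<eta>"
    by (rule wedge_const_right) simp_all
  also have "\<dots> = \<eta>"
    by (rule poly_mapping_eqI) simp
  finally show ?thesis
    by (metis monoform_single single_one)
qed

lemma wedge_monoform_assoc:
  "wedge (*) (monoform p {}) (wedge (*) (monoform q {}) \<eta>) = wedge (*) (monoform (p * q) {}) (\<eta> :: 'k::field form)"
  by (rule form_eqI) (simp add: dt_coeff_wedge_0 mult.assoc)

lemma subst_basis_mono_val:
  "subst_basis T a I = wedge (*) (monoform (mono_val T a) {})
       (foldr (\<lambda>i. wedge (*) (ext_deriv (*) (monoform (T i) {})))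
          (sorted_list_of_set I) (monoform 1 {}))"
  by (simp add: subst_basis_def mono_val_def)

lemma subst_basis_empty: "subst_basis T a {} = monoform (mono_val T a) {}"
  by (simp add: subst_basis_mono_val)

lemma subst_basis_singleton:
  "subst_basis T a {i} = wedge (*) (monoform (mono_val T a) {}) (ext_deriv (*) (monoform (T i) {}))"
  by (simp add: subst_basis_mono_val)

lemma subst_basis_add:
  "subst_basis T (a + b) I = wedge (*) (monoform (mono_val T a) {}) (subst_basis T b I)"
  by (simp add: subst_basis_mono_val mono_val_add wedge_monoform_assoc)

text \<open>
  This is \<open>form_subst\<close> on scalar functions, in a form that makes it a ring homomorphism.
\<close>

definition poly_subst :: "(nat \<Rightarrow> 'k::field mpoly) \<Rightarrow> 'k mpoly \<Rightarrow> 'k mpoly" where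
  "poly_subst T = lin_ext (\<lambda>a c. single 0 c * mono_val T a)"

lemma additive_poly_subst: "additive (poly_subst T)"
  unfolding poly_subst_def
  by (intro additive_lin_ext additive_compose[OF additive_mult_left] additive_single)

lemma poly_subst_single: "poly_subst T (single a c) = single 0 c * mono_val T a"
  by (simp add: poly_subst_def lin_ext_single)

lemma poly_subst_one [simp]: "poly_subst T 1 = 1"
  by (metis mono_val_0 mult.right_neutral poly_subst_single single_one)

lemma poly_subst_var: "poly_subst T (var i) = T i"
  by (simp add: var_def poly_subst_single)

lemma poly_subst_mult: "poly_subst T (p * q) = poly_subst T p * poly_subst T q"
proof (rule additive_eqI[where p = p])
  show "additive (\<lambda>p. poly_subst T (p * q))"
    by (rule additive_compose[OF additive_poly_subst additive_mult_left])
  show "additive (\<lambda>p. poly_subst T p * poly_subst T q)"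
    by (rule additive_compose[OF additive_mult_left additive_poly_subst])
next
  fix a
  show "poly_subst T (single a (lookup p a) * q) = poly_subst T (single a (lookup p a)) * poly_subst T q"
  proof (rule additive_eqI[where p = q])
    show "additive (\<lambda>q. poly_subst T (single a (lookup p a) * q))"
      by (rule additive_compose[OF additive_poly_subst additive_mult_right])
    show "additive (\<lambda>q. poly_subst T (single a (lookup p a)) * poly_subst T q)"
      by (rule additive_compose[OF additive_mult_right additive_poly_subst])
  qed (simp add: mult_single poly_subst_single mono_val_add mult.assoc mult.left_commute
      flip: mult_single[of 0 _ 0, simplified])
qed

lemma poly_subst_mono_val: "poly_subst T (mono_val S a) = mono_val (\<lambda>i. poly_subst T (S i)) a"
  by (rule mono_val_hom) (simp_all add: poly_subst_mult)

lemma mono_val_var: "mono_val var a = (single a 1 :: 'k::comm_ring_1 mpoly)"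
  by (induction a rule: mono_induct) (simp_all add: mono_val_add var_def mult_single)

text \<open>
  The form \<open>\<eta> \<otimes> c\<close> for a scalar form \<open>\<eta>\<close> and a vector \<open>c\<close>. Since a form is a sum of such tensors,
  statements about vector valued forms reduce to scalar ones.
\<close>

definition tensor :: "('k \<Rightarrow> 'l \<Rightarrow> 'l) \<Rightarrow> 'k::zero form \<Rightarrow> 'l::zero \<Rightarrow> 'l form" where
  "tensor s \<eta> c = Poly_Mapping.map (\<lambda>r. s r c) \<eta>"

context vector_space
begin

lemma lookup_tensor [simp]: "lookup (tensor scale \<eta> c) k = scale (lookup \<eta> k) c"
  by (simp add: tensor_def)

lemma additive_tensor_left: "additive (\<lambda>\<eta>. tensor scale \<eta> c)"
  unfolding tensor_def by (rule additive_map[OF additive_scale_left])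

lemma tensor_single [simp]: "tensor scale (single k r) c = single k (scale r c)"
  by (rule poly_mapping_eqI) (simp add: lookup_single when_def)

lemma additive_tensor_right: "additive (tensor scale \<eta>)"
  by unfold_locales (rule poly_mapping_eqI, simp add: lookup_add scale_right_distrib)

lemma form_subst_tensor:
  "form_subst scale T = lin_ext (\<lambda>(a, I). tensor scale (subst_basis T a I))"
proof -
  have "wedge scale \<eta> (monoform (const_poly c) {}) = tensor scale \<eta> c" for \<eta> :: "'a form" and c
    unfolding tensor_def monoform_const by (rule wedge_const_right) simp_all
  then show ?thesis
    by (simp add: form_subst_lin_ext case_prod_beta')
qed

lemma additive_form_subst: "additive (form_subst scale T)"
  unfolding form_subst_tensor
  by (intro additive_lin_ext) (auto intro: additive_tensor_right)

lemma form_subst_single: "form_subst scale T (single (a, I) c) = tensor scale (subst_basis T a I) c"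
  by (simp add: form_subst_tensor lin_ext_single additive.zero[OF additive_tensor_right])

lemma form_subst_const [simp]: "form_subst scale T (single (0, {}) c) = single (0, {}) c"
  by (simp add: form_subst_single subst_basis_empty flip: single_one)

end

lemma (in vector_space) form_subst_of_tensor:
  "form_subst scale T (tensor scale \<eta> c) = tensor scale (form_subst (*) T \<eta>) c"
proof (rule additive_eqI[where p = \<eta>])
  note F = vector_space_field[where 'k = 'a]
  show "additive (\<lambda>\<eta>. form_subst scale T (tensor scale \<eta> c))"
    by (rule additive_compose[OF additive_form_subst additive_tensor_left])
  show "additive (\<lambda>\<eta>. tensor scale (form_subst (*) T \<eta>) c)"
    by (rule additive_compose[OF additive_tensor_left vector_space.additive_form_subst[OF F]])
next
  fix k :: "mono \<times> nat set"
  obtain a I where k: "k = (a, I)" by (cases k)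
  show "form_subst scale T (tensor scale (single k (lookup \<eta> k)) c) =
      tensor scale (form_subst (*) T (single k (lookup \<eta> k))) c"
    unfolding k tensor_single form_subst_single vector_space.form_subst_single[OF vector_space_field]
    by (rule poly_mapping_eqI) (simp add: vector_space.lookup_tensor[OF vector_space_field])
qed

lemma form_subst_monoform:
  "form_subst (*) T (monoform p {}) = monoform (poly_subst T p :: 'k::field mpoly) {}"
proof (rule additive_eqI[where p = p])
  show "additive (\<lambda>p. form_subst (*) T (monoform p {}))"
    by (rule additive_compose[OF vector_space.additive_form_subst[OF vector_space_field] additive_monoform])
  show "additive (\<lambda>p. monoform (poly_subst T p) {})"
    by (rule additive_compose[OF additive_monoform additive_poly_subst])
next
  fix a
  define c where "c = lookup p a"
  have "tensor (*) (monoform (mono_val T a) {}) c = monoform (single 0 c * mono_val T a) {}"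
    by (rule poly_mapping_eqI)
      (auto simp: vector_space.lookup_tensor[OF vector_space_field] lookup_monoform when_def mult.commute[of _ c] simp flip: mult_map_scale_conv_mult)
  then show "form_subst (*) T (monoform (single a (lookup p a)) {}) = monoform (poly_subst T (single a (lookup p a))) {}"
    by (simp add: vector_space.form_subst_single[OF vector_space_field] subst_basis_empty poly_subst_single c_def)
qed

text \<open>
  On tensors this is the multiplicativity of \<open>poly_subst\<close>.
\<close>

lemma (in vector_space) form_subst_form_subst_0:
  "form_subst scale T (form_subst scale S (monoform p {})) = form_subst scale (\<lambda>i. poly_subst T (S i)) (monoform p {})"
proof (rule additive_eqI[where p = p])
  show "additive (\<lambda>p. form_subst scale T (form_subst scale S (monoform p {})))"
    by (intro additive_compose[OF additive_form_subst] additive_monoform)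
  show "additive (\<lambda>p. form_subst scale (\<lambda>i. poly_subst T (S i)) (monoform p {}))"
    by (rule additive_compose[OF additive_form_subst additive_monoform])
qed (simp add: form_subst_single subst_basis_empty form_subst_of_tensor form_subst_monoform poly_subst_mono_val)

section \<open>The chain rule\<close>

lemma poly_deriv_single: "poly_deriv (*) j (single a c) = (single (a - single j 1) (of_nat (lookup a j) * c) :: 'k::field mpoly)"
  by (simp add: poly_deriv_lin_ext lin_ext_single)

lemma additive_poly_deriv: "additive (poly_deriv (*) j :: 'k::field mpoly \<Rightarrow> _)"
  unfolding poly_deriv_lin_ext
  by (intro additive_lin_ext additive_compose[OF additive_single] additive_mult_right)

lemma poly_deriv_mult:
  "poly_deriv (*) j (p * q) = p * poly_deriv (*) j q + poly_deriv (*) j p * (q :: 'k::field mpoly)"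
proof (rule additive_eqI[where p = p])
  show "additive (\<lambda>p. poly_deriv (*) j (p * q))"
    by (rule additive_compose[OF additive_poly_deriv additive_mult_left])
  show "additive (\<lambda>p. p * poly_deriv (*) j q + poly_deriv (*) j p * q)"
    by (simp add: additive_def additive.add[OF additive_poly_deriv] algebra_simps)
next
  fix a
  show "poly_deriv (*) j (single a (lookup p a) * q) =
    single a (lookup p a) * poly_deriv (*) j q + poly_deriv (*) j (single a (lookup p a)) * q"
  proof (rule additive_eqI[where p = q])
    show "additive (\<lambda>q. poly_deriv (*) j (single a (lookup p a) * q))"
      by (rule additive_compose[OF additive_poly_deriv additive_mult_right])
    show "additive (\<lambda>q. single a (lookup p a) * poly_deriv (*) j q + poly_deriv (*) j (single a (lookup p a)) * q)"
      by (simp add: additive_def additive.add[OF additive_poly_deriv] algebra_simps)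
  next
    fix b
    have "a + (b - single j 1) = a + b - single j 1" if "lookup b j \<noteq> 0"
      using that by (intro poly_mapping_eqI) (auto simp: lookup_add lookup_minus lookup_single when_def)
    moreover have "a - single j 1 + b = a + b - single j 1" if "lookup a j \<noteq> 0"
      using that by (intro poly_mapping_eqI) (auto simp: lookup_add lookup_minus lookup_single when_def)
    ultimately show "poly_deriv (*) j (single a (lookup p a) * single b (lookup q b)) =
      single a (lookup p a) * poly_deriv (*) j (single b (lookup q b)) +
      poly_deriv (*) j (single a (lookup p a)) * single b (lookup q b)"
      by (cases "lookup a j = 0"; cases "lookup b j = 0")
         (simp_all add: poly_deriv_single mult_single lookup_add algebra_simps flip: single_add)
  qed
qed

lemma poly_deriv_one [simp]: "poly_deriv (*) j 1 = (0 :: 'k::field mpoly)"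
  by (simp flip: single_one add: poly_deriv_single)

text \<open>
  Induction on the monomial, adding one variable at a time by the Leibniz rule. The finite set \<open>A\<close>
  frees the sum from the support of \<open>a\<close>, which changes in the induction.
\<close>

lemma poly_deriv_mono_val:
  assumes "finite A" "keys a \<subseteq> A"
  shows "poly_deriv (*) j (mono_val T a) =
    (\<Sum>i\<in>A. of_nat (lookup a i) * (mono_val T (a - single i 1) * poly_deriv (*) j (T i :: 'k::field mpoly)))"
  using assms(2)
proof (induction a rule: mono_induct)
  case zero
  then show ?case by simp
next
  case (add k b)
  let ?D = "poly_deriv (*) j"
  have k: "k \<in> A" and b: "keys b \<subseteq> A"
    using add.prems by (auto simp: in_keys_iff lookup_add subset_iff)
  have "?D (mono_val T (single k 1 + b)) = T k * ?D (mono_val T b) + ?D (T k) * mono_val T b"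
    by (simp add: mono_val_add poly_deriv_mult)
  also have "\<dots> = (\<Sum>i\<in>A. T k * (of_nat (lookup b i) * (mono_val T (b - single i 1) * ?D (T i)))) +
      (\<Sum>i\<in>A. if i = k then mono_val T b * ?D (T i) else 0)"
    using add.IH[OF b] k assms(1) by (simp add: sum_distrib_left mult.commute)
  also have "\<dots> = (\<Sum>i\<in>A. of_nat (lookup (single k 1 + b) i) * (mono_val T (single k 1 + b - single i 1) * ?D (T i)))"
    unfolding sum.distrib[symmetric]
  proof (rule sum.cong[OF refl])
    fix i
    have "single k 1 + b - single i 1 = single k 1 + (b - single i 1)" if "lookup b i \<noteq> 0"
      using that by (intro poly_mapping_eqI) (auto simp: lookup_add lookup_minus lookup_single when_def)
    then have "of_nat (lookup b i) * mono_val T (single k 1 + b - single i 1) =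
        of_nat (lookup b i) * (T k * mono_val T (b - single i 1))"
      by (cases "lookup b i = 0") (simp_all add: mono_val_add)
    then show "T k * (of_nat (lookup b i) * (mono_val T (b - single i 1) * ?D (T i))) +
        (if i = k then mono_val T b * ?D (T i) else 0) =
       of_nat (lookup (single k 1 + b) i) * (mono_val T (single k 1 + b - single i 1) * ?D (T i))"
      by (auto simp: lookup_add lookup_single when_def algebra_simps)
  qed
  finally show ?case .
qed

lemma dt_coeff_map: "h 0 = 0 \<Longrightarrow> dt_coeff (Poly_Mapping.map h \<eta>) J = Poly_Mapping.map h (dt_coeff \<eta> J)"
  by (rule poly_mapping_eqI) simp

lemma linear_additive: "Vector_Spaces.linear s1 s2 h \<Longrightarrow> additive h"
  by (simp add: additive_def Vector_Spaces.linear_iff)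

lemma linear_map_scale: "Vector_Spaces.linear s1 s2 h \<Longrightarrow> h (s1 c x) = s2 c (h x)"
  by (simp add: Vector_Spaces.linear_iff)

lemma linear_vector_space: "Vector_Spaces.linear s1 s2 h \<Longrightarrow> vector_space s1 \<and> vector_space s2"
  by (simp add: Vector_Spaces.linear_def)

lemma (in vector_space) linear_scalar_multiples: "Vector_Spaces.linear (*) scale (\<lambda>r. scale r c)"
  by (simp add: Vector_Spaces.linear_iff vector_space_field scale_left_distrib) unfold_locales

text \<open>
  The derivative and substitution act on the scalar part of a form only, so they commute with linear
  maps of the coefficients. This is used for the action of the group, for the blocks of a matrix,
  and for the maps \<open>r \<mapsto> r c\<close>, by which scalar results are transferred to vector valued forms.
\<close>

lemma ext_deriv_map:
  assumes "Vector_Spaces.linear s1 s2 h"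
  shows "ext_deriv s2 (Poly_Mapping.map h \<omega>) = Poly_Mapping.map h (ext_deriv s1 \<omega>)" (is "?f \<omega> = ?g \<omega>")
proof -
  note add = linear_additive[OF assms]
  note vs = linear_vector_space[OF assms]
  note h = additive.zero[OF add]
  show ?thesis
  proof (rule additive_eqI[where p = \<omega>])
    show "additive ?f"
      using vs by (intro additive_compose[OF vector_space.additive_ext_deriv] additive_map add) auto
    show "additive ?g"
      using vs by (intro additive_compose[OF additive_map[OF add]] vector_space.additive_ext_deriv) auto
  next
    fix k :: "mono \<times> nat set"
    obtain a I where k: "k = (a, I)" by (cases k)
    show "?f (single k (lookup \<omega> k)) = ?g (single k (lookup \<omega> k))"
      using vs by (simp add: k h vector_space.ext_deriv_single additive.sum[OF additive_map[OF add]] linear_map_scale[OF assms])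
  qed
qed

lemma form_subst_map:
  assumes "Vector_Spaces.linear s1 s2 h"
  shows "form_subst s2 T (Poly_Mapping.map h \<omega>) = Poly_Mapping.map h (form_subst s1 T \<omega>)" (is "?f \<omega> = ?g \<omega>")
proof -
  note add = linear_additive[OF assms]
  note vs = linear_vector_space[OF assms]
  note h = additive.zero[OF add]
  show ?thesis
  proof (rule additive_eqI[where p = \<omega>])
    show "additive ?f"
      using vs by (intro additive_compose[OF vector_space.additive_form_subst] additive_map add) auto
    show "additive ?g"
      using vs by (intro additive_compose[OF additive_map[OF add]] vector_space.additive_form_subst) auto
  next
    fix k :: "mono \<times> nat set"
    obtain a I where k: "k = (a, I)" by (cases k)
    have "tensor s2 \<eta> (h c) = Poly_Mapping.map h (tensor s1 \<eta> c)" for \<eta> c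
      using vs by (intro poly_mapping_eqI) (simp add: vector_space.lookup_tensor h linear_map_scale[OF assms])
    then show "?f (single k (lookup \<omega> k)) = ?g (single k (lookup \<omega> k))"
      using vs by (simp add: k h vector_space.form_subst_single)
  qed
qed

lemma ext_deriv_mono_val:
  "ext_deriv (*) (monoform (mono_val T a) {}) =
     (\<Sum>i\<in>keys a. tensor (*) (subst_basis T (a - single i 1) {i}) (of_nat (lookup a i) :: 'k::field))"
proof (rule form_eqI)
  fix J
  interpret F: vector_space "(*) :: 'k \<Rightarrow> _" by (rule vector_space_field)
  have tens: "dt_coeff (tensor (*) \<eta> (of_nat n)) J = of_nat n * dt_coeff \<eta> J" for \<eta> :: "'k form" and n
  proof -
    have "of_nat n * dt_coeff \<eta> J = Poly_Mapping.map ((*) (of_nat n)) (dt_coeff \<eta> J)"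
      by (simp add: mult_map_scale_conv_mult)
    then show ?thesis
      by (intro poly_mapping_eqI) (simp add: mult.commute)
  qed
  have "dt_coeff (\<Sum>i\<in>keys a. tensor (*) (subst_basis T (a - single i 1) {i}) (of_nat (lookup a i) :: 'k)) J =
     (\<Sum>i\<in>keys a. of_nat (lookup a i) * (mono_val T (a - single i 1) * dt_coeff (ext_deriv (*) (monoform (T i) {})) J))"
    by (simp add: additive.sum[OF additive_dt_coeff] tens subst_basis_singleton dt_coeff_wedge_0)
  also have "\<dots> = dt_coeff (ext_deriv (*) (monoform (mono_val T a) {})) J"
  proof (cases "\<exists>j. J = {j}")
    case True
    then show ?thesis
      by (auto simp: F.dt_coeff_ext_deriv_monoform poly_deriv_mono_val[of "keys a" a])
  next
    case False
    then show ?thesis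
      by (simp add: F.dt_coeff_ext_deriv_monoform)
  qed
  finally show "dt_coeff (ext_deriv (*) (monoform (mono_val T a) {})) J =
    dt_coeff (\<Sum>i\<in>keys a. tensor (*) (subst_basis T (a - single i 1) {i}) (of_nat (lookup a i) :: 'k)) J" ..
qed

text \<open>
  After reduction to scalars this is the chain rule for monomials.
\<close>

lemma (in vector_space) ext_deriv_form_subst_0:
  "ext_deriv scale (form_subst scale T (monoform p {})) = form_subst scale T (ext_deriv scale (monoform p {}))"
  (is "?f p = ?g p")
proof (rule additive_eqI[where p = p])
  show "additive ?f"
    by (intro additive_compose[OF additive_ext_deriv] additive_compose[OF additive_form_subst] additive_monoform)
  show "additive ?g"
    by (intro additive_compose[OF additive_form_subst] additive_compose[OF additive_ext_deriv] additive_monoform)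
next
  fix a
  define c where "c = lookup p a"
  have "ext_deriv scale (form_subst scale T (single (a, {}) c)) =
     tensor scale (ext_deriv (*) (monoform (mono_val T a) {})) c"
    unfolding form_subst_single subst_basis_empty tensor_def
    by (rule ext_deriv_map[OF linear_scalar_multiples])
  also have "\<dots> = (\<Sum>i\<in>keys a. tensor scale (tensor (*) (subst_basis T (a - single i 1) {i}) (of_nat (lookup a i))) c)"
    by (simp add: ext_deriv_mono_val additive.sum[OF additive_tensor_left])
  also have "\<dots> = (\<Sum>i\<in>keys a. tensor scale (subst_basis T (a - single i 1) {i}) (scale (of_nat (lookup a i)) c))"
    by (intro sum.cong refl poly_mapping_eqI) (simp add: vector_space.lookup_tensor[OF vector_space_field])
  also have "\<dots> = form_subst scale T (ext_deriv scale (single (a, {}) c))"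
    by (simp add: ext_deriv_single additive.sum[OF additive_form_subst] form_subst_single)
  finally show "?f (single a (lookup p a)) = ?g (single a (lookup p a))"
    by (simp add: c_def)
qed

lemma form_subst_wedge_0:
  "form_subst (*) T (wedge (*) (monoform p {}) \<eta>) = wedge (*) (monoform (poly_subst T p) {}) (form_subst (*) T \<eta> :: 'k::field form)"
  (is "?f p = ?g p")
proof (rule additive_eqI[where p = p])
  interpret F: vector_space "(*) :: 'k \<Rightarrow> _" by (rule vector_space_field)
  show "additive ?f"
    by (intro additive_compose[OF F.additive_form_subst] additive_compose[OF additive_wedge_left] additive_monoform additive_mult_left)
  show "additive ?g"
    by (intro additive_compose[OF additive_wedge_left] additive_compose[OF additive_monoform] additive_poly_subst additive_mult_left)
  fix a
  define c where "c = lookup p a"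
  show "?f (single a (lookup p a)) = ?g (single a (lookup p a))" (is "?h \<eta> = ?k \<eta>")
  proof (rule additive_eqI[where p = \<eta>])
    show "additive ?h"
      by (intro additive_compose[OF F.additive_form_subst] additive_wedge_right additive_mult_right)
    show "additive ?k"
      by (intro additive_compose[OF additive_wedge_right] F.additive_form_subst additive_mult_right)
    fix k :: "mono \<times> nat set"
    obtain b J where k: "k = (b, J)" by (cases k)
    define d where "d = lookup \<eta> k"
    have tens: "dt_coeff (tensor (*) \<eta> x) I = single 0 x * dt_coeff \<eta> I" for \<eta> :: "'k form" and x I
      by (rule poly_mapping_eqI) (simp flip: mult_map_scale_conv_mult add: mult.commute[of _ x])
    have "form_subst (*) T (wedge (*) (single (a, {}) c) (single (b, J) d)) = tensor (*) (subst_basis T (a + b) J) (c * d)"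
      by (simp add: wedge_single_0 F.form_subst_single)
    also have "\<dots> = wedge (*) (monoform (single 0 c * mono_val T a) {}) (tensor (*) (subst_basis T b J) d)"
      by (rule form_eqI) (simp add: tens subst_basis_add dt_coeff_wedge_0 ac_simps flip: mult_single[of 0 _ 0, simplified])
    finally show "?h (single k (lookup \<eta> k)) = ?k (single k (lookup \<eta> k))"
      by (simp add: k c_def d_def F.form_subst_single poly_subst_single)
  qed
qed

text \<open>
  A 1-form is a sum of terms \<open>f dt\<^sub>i\<close>. Substitution is multiplicative on such terms, and by the chain
  rule it maps \<open>dt\<^sub>i\<close> to the differential of the polynomial substituted for \<open>t\<^sub>i\<close>.
\<close>

lemma (in vector_space) form_subst_left_inverse:
  assumes "\<And>a I. (a, I) \<in> keys \<omega> \<Longrightarrow> keys a \<subseteq> X \<and> (\<exists>i\<in>X. I = {i})"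
    and inv: "\<And>i. i \<in> X \<Longrightarrow> poly_subst T (S i) = var i"
  shows "form_subst scale T (form_subst scale S \<omega>) = \<omega>"
proof (rule additive_eqI[where p = \<omega>])
  show "additive (\<lambda>\<omega>. form_subst scale T (form_subst scale S \<omega>))"
    by (intro additive_compose[OF additive_form_subst] additive_form_subst)
  show "additive (\<lambda>\<omega>. \<omega>)" by unfold_locales simp
  fix k :: "mono \<times> nat set"
  assume "k \<in> keys \<omega>"
  with assms(1) obtain a i where k: "k = (a, {i})" "keys a \<subseteq> X" "i \<in> X"
    by (cases k) auto
  interpret F: vector_space "(*) :: 'a \<Rightarrow> _" by (rule vector_space_field)
  have "form_subst (*) T (subst_basis S a {i}) = wedge (*) (monoform (mono_val var a) {}) (ext_deriv (*) (monoform (var i :: 'a mpoly) {}))"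
  proof -
    have "mono_val (\<lambda>i. poly_subst T (S i)) a = mono_val var a"
      using k inv by (intro mono_val_cong) auto
    then show ?thesis
      using k by (simp add: subst_basis_singleton form_subst_wedge_0 poly_subst_mono_val inv form_subst_monoform
          flip: F.ext_deriv_form_subst_0)
  qed
  also have "\<dots> = single (a, {i}) 1"
    by (simp add: mono_val_var var_def F.ext_deriv_single wedge_single_0)
  finally show "form_subst scale T (form_subst scale S (single k (lookup \<omega> k))) = single k (lookup \<omega> k)"
    by (simp add: k form_subst_single form_subst_of_tensor)
qed

section \<open>Values of polynomials\<close>

context vector_space
begin

lemma additive_poly_eval: "additive (\<lambda>p. poly_eval scale p x)"
  unfolding poly_eval_lin_ext by (intro additive_lin_ext additive_scale_right)

lemma poly_eval_single: "poly_eval scale (single a c) x = scale (mono_val x a) c"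
  by (simp add: poly_eval_lin_ext lin_ext_single)

lemma mono_val_zero_point: "mono_val (\<lambda>_. 0) a = (if a = 0 then 1 else 0 :: 'a)"
proof (cases "a = 0")
  case False
  then obtain i where "i \<in> keys a"
    by (metis keys_eq_empty ex_in_conv)
  then show ?thesis
    using False by (auto simp: mono_val_def in_keys_iff)
qed simp

lemma poly_eval_origin: "poly_eval scale p (\<lambda>_. 0) = lookup p 0"
  by (rule additive_eqI[OF additive_poly_eval additive_lookup])
     (auto simp: poly_eval_single mono_val_zero_point lookup_single when_def)

lemma poly_eval_cong:
  assumes "\<And>a i. a \<in> keys p \<Longrightarrow> i \<in> keys a \<Longrightarrow> x i = y i"
  shows "poly_eval scale p x = poly_eval scale p y"
  unfolding poly_eval_lin_ext using assms by (auto intro!: lin_ext_cong arg_cong2[where f = scale] mono_val_cong)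

end

lemma poly_eval_map:
  assumes "Vector_Spaces.linear s1 s2 h"
  shows "poly_eval s2 (Poly_Mapping.map h p) x = h (poly_eval s1 p x)"
proof -
  note add = linear_additive[OF assms]
  note vs = linear_vector_space[OF assms]
  show ?thesis
  proof (rule additive_eqI[where p = p])
    show "additive (\<lambda>p. poly_eval s2 (Poly_Mapping.map h p) x)"
      using vs by (intro additive_compose[OF vector_space.additive_poly_eval] additive_map add) auto
    show "additive (\<lambda>p. h (poly_eval s1 p x))"
      using vs by (intro additive_compose[OF add] vector_space.additive_poly_eval) auto
  qed (use vs in \<open>simp add: additive.zero[OF add] vector_space.poly_eval_single linear_map_scale[OF assms]\<close>)
qed

lemma poly_eval_one: "poly_eval (*) (1 :: 'k::field mpoly) x = 1"
  by (simp flip: single_one add: vector_space.poly_eval_single[OF vector_space_field])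

lemma poly_eval_var: "poly_eval (*) (var i :: 'k::field mpoly) x = x i"
  by (simp add: var_def vector_space.poly_eval_single[OF vector_space_field])

lemma poly_eval_mult: "poly_eval (*) (p * q :: 'k::field mpoly) x = poly_eval (*) p x * poly_eval (*) q x"
proof (rule additive_eqI[where p = p])
  interpret F: vector_space "(*) :: 'k \<Rightarrow> _" by (rule vector_space_field)
  show "additive (\<lambda>p. poly_eval (*) (p * q) x)"
    by (rule additive_compose[OF F.additive_poly_eval additive_mult_left])
  show "additive (\<lambda>p. poly_eval (*) p x * poly_eval (*) q x)"
    by (rule additive_compose[OF additive_mult_left F.additive_poly_eval])
  fix a
  show "poly_eval (*) (single a (lookup p a) * q) x = poly_eval (*) (single a (lookup p a)) x * poly_eval (*) q x"
  proof (rule additive_eqI[where p = q])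
    show "additive (\<lambda>q. poly_eval (*) (single a (lookup p a) * q) x)"
      by (rule additive_compose[OF F.additive_poly_eval additive_mult_right])
    show "additive (\<lambda>q. poly_eval (*) (single a (lookup p a)) x * poly_eval (*) q x)"
      by (rule additive_compose[OF additive_mult_right F.additive_poly_eval])
  qed (simp add: mult_single F.poly_eval_single mono_val_add)
qed

lemma poly_eval_mono_val: "poly_eval (*) (mono_val T a :: 'k::field mpoly) x = mono_val (\<lambda>i. poly_eval (*) (T i) x) a"
  by (rule mono_val_hom) (simp_all add: poly_eval_one poly_eval_mult)

lemma (in vector_space) poly_eval_form_subst:
  "poly_eval scale (dt_coeff (form_subst scale T (monoform p {})) {}) x = poly_eval scale p (\<lambda>i. poly_eval (*) (T i) x)"
proof (rule additive_eqI[where p = p])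
  show "additive (\<lambda>p. poly_eval scale (dt_coeff (form_subst scale T (monoform p {})) {}) x)"
    by (intro additive_compose[OF additive_poly_eval] additive_compose[OF additive_dt_coeff] additive_compose[OF additive_form_subst] additive_monoform)
  show "additive (\<lambda>p. poly_eval scale p (\<lambda>i. poly_eval (*) (T i) x))"
    by (rule additive_poly_eval)
qed (simp add: form_subst_single subst_basis_empty tensor_def dt_coeff_map dt_coeff_monoform
     poly_eval_map[OF linear_scalar_multiples] poly_eval_mono_val poly_eval_single)

section \<open>The Poincare lemma in degree one\<close>

lemma lookup_ext_deriv_0:
  assumes "vector_space s"
  shows "lookup (ext_deriv s (monoform f {})) (b, {i}) = s (of_nat (lookup b i + 1)) (lookup f (b + single i 1))"
proof -
  interpret vector_space s by fact
  have "{j. j = i \<and> j < i} = {}"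
    by auto
  note this [simp]
  show ?thesis
    by (simp add: lookup_ext_deriv lookup_monoform)
qed

text \<open>
  The coefficient of a monomial other than 1 can be recovered from the derivative with respect to any
  of its variables, since its exponent is invertible in characteristic 0.
\<close>

lemma primitive_unique:
  fixes s :: "'k::field_char_0 \<Rightarrow> 'l::ab_group_add \<Rightarrow> 'l"
  assumes "vector_space s" "ext_deriv s (monoform f {}) = ext_deriv s (monoform g {})" "lookup f 0 = lookup g 0"
  shows "f = g"
proof (rule poly_mapping_eqI)
  fix c
  interpret vector_space s by fact
  show "lookup f c = lookup g c"
  proof (cases "c = 0")
    case False
    then obtain i where i: "i \<in> keys c"
      by (metis keys_eq_empty ex_in_conv)
    then have c: "c - single i 1 + single i 1 = c"
      by (rule minus_unit_plus)
    define n where "n = lookup (c - single i 1) i + 1"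
    have "s (of_nat n) (lookup f c) = s (of_nat n) (lookup g c)"
      using arg_cong[OF assms(2), of "\<lambda>\<omega>. lookup \<omega> (c - single i 1, {i})"]
      unfolding lookup_ext_deriv_0[OF assms(1)] c n_def .
    moreover have "(of_nat n :: 'k) \<noteq> 0"
      unfolding n_def of_nat_eq_0_iff by simp
    ultimately show ?thesis by simp
  qed (use assms in simp)
qed

text \<open>
  Comparing coefficients in \<open>\<partial>\<^sub>i f = \<omega>\<^sub>i\<close> leaves only one choice for \<open>f\<close>: the coefficient of \<open>t\<^sup>c\<close> is
  that of \<open>t\<^sup>c / t\<^sub>i\<close> in \<open>\<omega>\<^sub>i\<close>, divided by the exponent of \<open>t\<^sub>i\<close>, for any variable \<open>t\<^sub>i\<close> of \<open>t\<^sup>c\<close>;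
  closedness says that all variables give the same value. The last clause of the conclusion shows
  that \<open>f\<close> has its variables and the span of its coefficients from \<open>\<omega>\<close>.
\<close>

lemma primitive_exists:
  fixes s :: "'k::field_char_0 \<Rightarrow> 'l::ab_group_add \<Rightarrow> 'l"
  assumes "vector_space s" and closed: "ext_deriv s \<omega> = 0"
    and one: "\<And>a I. (a, I) \<in> keys \<omega> \<Longrightarrow> card I = 1"
  shows "\<exists>f. ext_deriv s (monoform f {}) = \<omega> \<and> lookup f 0 = 0 \<and>
    (\<forall>c. c \<noteq> 0 \<longrightarrow> (\<exists>i r. i \<in> keys c \<and> lookup f c = s r (lookup \<omega> (c - single i 1, {i}))))"
proof -
  interpret vector_space s by fact
  define i where "i c = Min (keys c)" for c :: mono
  define F where "F c = (if c = 0 then 0 else s (1 / of_nat (lookup c (i c))) (lookup \<omega> (c - single (i c) 1, {i c})))" for c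
  have i: "i c \<in> keys c" if "c \<noteq> 0" for c
    unfolding i_def using that by (intro Min_in) auto
  have "finite {c. F c \<noteq> 0}"
  proof (rule finite_subset)
    show "{c. F c \<noteq> 0} \<subseteq> (\<lambda>(b, I). b + single (the_elem I) 1) ` keys \<omega>"
    proof
      fix c assume "c \<in> {c. F c \<noteq> 0}"
      then have "c \<noteq> 0" "(c - single (i c) 1, {i c}) \<in> keys \<omega>"
        by (auto simp: F_def in_keys_iff split: if_splits)
      then show "c \<in> (\<lambda>(b, I). b + single (the_elem I) 1) ` keys \<omega>"
        using minus_unit_plus[OF i] by (intro image_eqI[where x = "(c - single (i c) 1, {i c})"]) auto
    qed
  qed simp
  then have F: "lookup (Abs_poly_mapping F) = F" by simp
  \<comment> \<open>the coefficient of \<open>t\<^sup>b dt\<^sub>j dt\<^sub>k\<close> in the vanishing derivative\<close>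
  have sym: "s (of_nat (lookup b k + 1)) (lookup \<omega> (b + single k 1, {j})) =
             s (of_nat (lookup b j + 1)) (lookup \<omega> (b + single j 1, {k}))" if "j < k" for b j k
  proof -
    have [simp]: "{l. (l = j \<or> l = k) \<and> l < j} = {}" "{l. (l = j \<or> l = k) \<and> l < k} = {j}" "{j, k} - {j} = {k}" "{j, k} - {k} = {j}"
      using that by auto
    have neg: "s (- 1 - x) v = - s (1 + x) v" for x v
      by (simp flip: scale_minus_left)
    show ?thesis
      using arg_cong[OF closed, of "\<lambda>\<omega>. lookup \<omega> (b, {j, k})"] that
      by (simp add: lookup_ext_deriv neg)
  qed
  have indep: "lookup \<omega> (b, {j}) = s (of_nat (lookup b j + 1)) (F (b + single j 1))" for b j
  proof -
    define c where "c = b + single j 1"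
    define k where "k = i c"
    have j: "j \<in> keys c" by (simp add: c_def in_keys_iff lookup_add)
    then have c0: "c \<noteq> 0"
      by auto
    then have k: "k \<in> keys c"
      using i[of c] by (simp add: k_def)
    then have "k \<le> j" using j by (simp add: k_def i_def)
    have cj: "lookup c j = lookup b j + 1" by (simp add: c_def lookup_add)
    have nz: "(of_nat (lookup c k) :: 'k) \<noteq> 0" using k by (simp add: in_keys_iff)
    show ?thesis
    proof (cases "k = j")
      case True
      then show ?thesis
      proof -
        have "F c = s (1 / of_nat (lookup c k)) (lookup \<omega> (c - single k 1, {k}))"
          using c0 by (simp add: F_def k_def)
        moreover have "c - single k 1 = b"
          using True by (simp add: c_def)
        moreover have "(of_nat (lookup b j + 1) :: 'k) = of_nat (lookup c k)"
          using True cj by simp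
        ultimately show ?thesis
          using nz True unfolding c_def[symmetric] by simp
      qed
    next
      case False
      with \<open>k \<le> j\<close> have "k < j" by simp
      define d where "d = b - single k 1"
      have b: "b = d + single k 1"
        using False k by (intro poly_mapping_eqI) (auto simp: d_def c_def lookup_add lookup_minus lookup_single when_def in_keys_iff)
      have c: "c - single k 1 = d + single j 1"
        unfolding c_def b by (rule poly_mapping_eqI) (auto simp: lookup_add lookup_minus lookup_single when_def)
      have "lookup c k = lookup d k + 1" "lookup d j = lookup b j"
        using False by (auto simp: c_def b lookup_add lookup_single when_def)
      then have "s (of_nat (lookup c k)) (lookup \<omega> (b, {j})) = s (of_nat (lookup b j + 1)) (lookup \<omega> (c - single k 1, {k}))"
        using sym[OF \<open>k < j\<close>, of d] unfolding c b by simp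
      then have "s (1 / of_nat (lookup c k)) (s (of_nat (lookup c k)) (lookup \<omega> (b, {j}))) =
          s (of_nat (lookup b j + 1)) (F c)"
        using c0 by (simp add: F_def k_def mult.commute)
      then show ?thesis
        using nz by (simp add: c_def)
    qed
  qed
  have "ext_deriv s (monoform (Abs_poly_mapping F) {}) = \<omega>"
  proof (rule poly_mapping_eqI)
    fix k :: "mono \<times> nat set"
    obtain b J where k: "k = (b, J)" by (cases k)
    show "lookup (ext_deriv s (monoform (Abs_poly_mapping F) {})) k = lookup \<omega> k"
    proof (cases "\<exists>j. J = {j}")
      case True
      then show ?thesis
        using indep by (auto simp: k lookup_ext_deriv_0[OF assms(1)] F)
    next
      case False
      have "lookup \<omega> k = 0"
        using False one[of b J] by (auto simp: k in_keys_iff card_1_singleton_iff)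
      moreover have "lookup (ext_deriv s (monoform (Abs_poly_mapping F) {})) k = 0"
        using False unfolding k lookup_dt_coeff[symmetric] by (simp only: dt_coeff_ext_deriv_monoform) simp
      ultimately show ?thesis by simp
    qed
  qed
  moreover have "\<exists>i r. i \<in> keys c \<and> F c = s r (lookup \<omega> (c - single i 1, {i}))" if "c \<noteq> 0" for c
    using that i by (auto simp: F_def)
  ultimately show ?thesis
    by (intro exI[of _ "Abs_poly_mapping F"]) (auto simp: F F_def)
qed

section \<open>Forms of degree zero\<close>

text \<open>
  Forms of degree 0 are kept as forms, not turned into polynomials, because cochains consist of forms.
\<close>

definition degree0 :: "'l::ab_group_add form \<Rightarrow> bool" where
  "degree0 \<omega> \<longleftrightarrow> (\<forall>J. J \<noteq> {} \<longrightarrow> dt_coeff \<omega> J = 0)"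

lemma degree0_iff_keys: "degree0 \<omega> \<longleftrightarrow> (\<forall>(a, I)\<in>keys \<omega>. I = {})"
proof -
  have "degree0 \<omega> \<longleftrightarrow> (\<forall>J a. J \<noteq> {} \<longrightarrow> lookup \<omega> (a, J) = 0)"
    unfolding degree0_def poly_mapping_eq_iff fun_eq_iff by auto
  also have "\<dots> \<longleftrightarrow> (\<forall>(a, I)\<in>keys \<omega>. I = {})"
    unfolding Ball_def split_paired_All by (auto simp: in_keys_iff)
  finally show ?thesis .
qed

lemma degree0_monoform [simp]: "degree0 (monoform p {})"
  by (simp add: degree0_def dt_coeff_monoform)

lemma degree0D: "degree0 \<omega> \<Longrightarrow> \<omega> = monoform (dt_coeff \<omega> {}) {}"
  by (rule form_eqI) (auto simp: degree0_def dt_coeff_monoform)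

lemma degree0_zero [simp]: "degree0 0"
  by (simp add: degree0_iff_keys)

lemma degree0_single [simp]: "degree0 (single (a, {}) c)"
  by (simp add: degree0_iff_keys)

lemma degree0_diff: "degree0 \<omega> \<Longrightarrow> degree0 \<eta> \<Longrightarrow> degree0 (\<omega> - \<eta>)"
  by (simp add: degree0_def additive.diff[OF additive_dt_coeff])

lemma degree0_add: "degree0 \<omega> \<Longrightarrow> degree0 \<eta> \<Longrightarrow> degree0 (\<omega> + \<eta>)"
  by (simp add: degree0_def additive.add[OF additive_dt_coeff])

lemma degree0_map: "h 0 = 0 \<Longrightarrow> degree0 \<omega> \<Longrightarrow> degree0 (Poly_Mapping.map h \<omega>)"
  by (simp add: degree0_def dt_coeff_map poly_mapping_eq_iff fun_eq_iff)

lemma (in vector_space) degree0_form_subst: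
  assumes "degree0 \<omega>"
  shows "degree0 (form_subst scale T \<omega>)"
proof -
  have "dt_coeff (form_subst scale T (monoform p {})) J = 0" if "J \<noteq> {}" for p J
  proof (rule additive_eqI[where p = p and g = "\<lambda>_. 0"])
    show "additive (\<lambda>p. dt_coeff (form_subst scale T (monoform p {})) J)"
      by (intro additive_compose[OF additive_dt_coeff] additive_compose[OF additive_form_subst] additive_monoform)
    show "additive (\<lambda>_ :: 'b mpoly. 0 :: 'b mpoly)"
      by (rule additive_zero)
    show "dt_coeff (form_subst scale T (monoform (single a (lookup p a)) {})) J = 0" for a
      using that by (intro poly_mapping_eqI) (simp add: form_subst_single subst_basis_empty lookup_monoform)
  qed
  then show ?thesis
    using degree0D[OF assms] unfolding degree0_def by metis
qed

definition form_val :: "('k::field \<Rightarrow> 'l \<Rightarrow> 'l) \<Rightarrow> 'l::ab_group_add form \<Rightarrow> (nat \<Rightarrow> 'k) \<Rightarrow> 'l" where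
  "form_val s \<omega> x = poly_eval s (dt_coeff \<omega> {}) x"

lemma form_val_map:
  assumes "Vector_Spaces.linear s1 s2 h"
  shows "form_val s2 (Poly_Mapping.map h \<omega>) x = h (form_val s1 \<omega> x)"
  by (simp add: form_val_def dt_coeff_map additive.zero[OF linear_additive[OF assms]] poly_eval_map[OF assms])

context vector_space
begin

lemma form_val_diff: "form_val scale (\<omega> - \<eta>) x = form_val scale \<omega> x - form_val scale \<eta> x"
  by (simp add: form_val_def additive.diff[OF additive_dt_coeff] additive.diff[OF additive_poly_eval])

lemma form_val_const [simp]: "form_val scale (single (0, {}) c) x = c"
  by (simp add: form_val_def dt_coeff_single poly_eval_single)

lemma form_val_origin: "form_val scale \<omega> (\<lambda>_. 0) = lookup \<omega> (0, {})"
  by (simp add: form_val_def poly_eval_origin)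

lemma form_val_monoform [simp]: "form_val scale (monoform p {}) x = poly_eval scale p x"
  by (simp add: form_val_def dt_coeff_monoform)

lemma form_val_subst:
  assumes "degree0 \<omega>"
  shows "form_val scale (form_subst scale T \<omega>) x = form_val scale \<omega> (\<lambda>i. poly_eval (*) (T i) x)"
  by (subst (1 2) degree0D[OF assms]) (simp add: form_val_def poly_eval_form_subst dt_coeff_monoform)

lemma ext_deriv_form_subst:
  assumes "degree0 \<omega>"
  shows "ext_deriv scale (form_subst scale T \<omega>) = form_subst scale T (ext_deriv scale \<omega>)"
  using ext_deriv_form_subst_0[of T "dt_coeff \<omega> {}"] by (simp add: degree0D[OF assms, symmetric])

lemma ext_deriv_const [simp]: "ext_deriv scale (single (0, {}) c) = 0"
  by (simp add: ext_deriv_single)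

text \<open>
  Mixed partial derivatives agree, and they enter with opposite signs.
\<close>

lemma ext_deriv_ext_deriv:
  assumes "degree0 \<omega>"
  shows "ext_deriv scale (ext_deriv scale \<omega>) = 0"
proof (rule poly_mapping_eqI, rule ccontr)
  fix k :: "mono \<times> nat set"
  assume k: "lookup (ext_deriv scale (ext_deriv scale \<omega>)) k \<noteq> lookup 0 k"
  obtain b J where kJ: "k = (b, J)" by (cases k)
  have "(b, J) \<in> keys (ext_deriv scale (ext_deriv scale \<omega>))"
    using k by (simp add: kJ in_keys_iff)
  then obtain i I where i: "i \<notin> I" "J = insert i I" "(b + single i 1, I) \<in> keys (ext_deriv scale \<omega>)"
    by (rule keys_ext_deriv)
  from i(3) obtain j where "I = {j}"
    using assms by (elim keys_ext_deriv) (auto simp: degree0_iff_keys)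
  then obtain l m where J: "J = {l, m}" "l < m"
    using i by (metis insert_commute linorder_neqE_nat singletonI)
  have sets [simp]: "{j. (j = l \<or> j = m) \<and> j < l} = {}" "{j. (j = l \<or> j = m) \<and> j < m} = {l}"
     "{l, m} - {l} = {m}" "{l, m} - {m} = {l}"
    using J by auto
  have comm: "b + single m (Suc 0) + single l (Suc 0) = b + single l (Suc 0) + single m (Suc 0)"
    by (simp add: ac_simps)
  have d: "lookup (ext_deriv scale \<omega>) (c, {i}) = scale (of_nat (lookup c i + 1)) (lookup \<omega> (c + single i 1, {}))" for c i
    using lookup_ext_deriv_0[of scale "dt_coeff \<omega> {}" c i] vector_space_axioms
    by (simp add: degree0D[OF assms, symmetric])
  have "lookup (ext_deriv scale (ext_deriv scale \<omega>)) (b, {l, m}) = 0"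
    using J(2) lookup_ext_deriv[of "{l, m}" "ext_deriv scale \<omega>" b]
    by (simp add: d comm lookup_add lookup_single when_def mult.commute flip: scale_left_distrib distrib_left)
  then show False
    using k by (simp add: kJ J)
qed

end

lemma degree0_primitive_unique:
  fixes s :: "'k::field_char_0 \<Rightarrow> 'l::ab_group_add \<Rightarrow> 'l"
  assumes "vector_space s" "degree0 \<omega>" "degree0 \<eta>"
    and "ext_deriv s \<omega> = ext_deriv s \<eta>" "lookup \<omega> (0, {}) = lookup \<eta> (0, {})"
  shows "\<omega> = \<eta>"
proof -
  have "dt_coeff \<omega> {} = dt_coeff \<eta> {}"
    using assms degree0D[OF assms(2)] degree0D[OF assms(3)] by (intro primitive_unique[OF assms(1)]) auto
  then show ?thesis
    using degree0D[OF assms(2)] degree0D[OF assms(3)] by simp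
qed

section \<open>Variables and coefficients under substitution\<close>

definition vars_in :: "nat set \<Rightarrow> 'l::zero mpoly \<Rightarrow> bool" where
  "vars_in X p \<longleftrightarrow> (\<forall>a\<in>keys p. keys a \<subseteq> X)"

lemma vars_in_zero [simp]: "vars_in X 0"
  by (simp add: vars_in_def)

lemma vars_in_single: "keys a \<subseteq> X \<Longrightarrow> vars_in X (single a c)"
  by (simp add: vars_in_def)

lemma vars_in_add: "vars_in X p \<Longrightarrow> vars_in X q \<Longrightarrow> vars_in X (p + q)"
  unfolding vars_in_def using keys_add[of p q] by blast

lemma vars_in_minus: "vars_in X p \<Longrightarrow> vars_in X (- p :: 'l::ab_group_add mpoly)"
  by (auto simp: vars_in_def in_keys_iff)

lemma vars_in_diff: "vars_in X p \<Longrightarrow> vars_in X q \<Longrightarrow> vars_in X (p - q :: 'l::ab_group_add mpoly)"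
  unfolding diff_conv_add_uminus by (intro vars_in_add vars_in_minus)

lemma vars_in_sum: "(\<And>i. i \<in> A \<Longrightarrow> vars_in X (f i)) \<Longrightarrow> vars_in X (\<Sum>i\<in>A. f i)"
  by (induction A rule: infinite_finite_induct) (auto intro: vars_in_add)

lemma vars_in_one [simp]: "vars_in X (1 :: 'k::comm_ring_1 mpoly)"
  by (simp add: vars_in_def)

lemma vars_in_mult: "vars_in X p \<Longrightarrow> vars_in X q \<Longrightarrow> vars_in X (p * q :: 'k::comm_ring_1 mpoly)"
proof (unfold vars_in_def, intro ballI)
  assume pq: "\<forall>a\<in>keys p. keys a \<subseteq> X" "\<forall>a\<in>keys q. keys a \<subseteq> X"
  fix c assume "c \<in> keys (p * q)"
  then obtain a b where "a \<in> keys p" "b \<in> keys q" "c = a + b"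
    using keys_mult[of p q] by blast
  with pq keys_add[of a b] show "keys c \<subseteq> X"
    by blast
qed

lemma vars_in_mono_val:
  "(\<And>i. i \<in> keys a \<Longrightarrow> vars_in X (T i)) \<Longrightarrow> vars_in X (mono_val T a :: 'k::comm_ring_1 mpoly)"
proof (induction a rule: mono_induct)
  case (add i a)
  then show ?case
    by (auto simp: mono_val_add keys_unit_add intro!: vars_in_mult)
qed simp

lemma vars_in_var: "i \<in> X \<Longrightarrow> vars_in X (var i :: 'k::comm_ring_1 mpoly)"
  by (simp add: var_def vars_in_single)

lemma A_PL_degree0:
  assumes "degree0 \<omega>"
  shows "\<omega> \<in> A_PL n U \<longleftrightarrow> vars_in {1..n} (dt_coeff \<omega> {}) \<and> (\<forall>b. lookup \<omega> b \<in> U)"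
proof -
  have "(\<forall>(a, I)\<in>keys \<omega>. keys a \<subseteq> {1..n} \<and> I \<subseteq> {1..n}) \<longleftrightarrow> (\<forall>a. (a, {}) \<in> keys \<omega> \<longrightarrow> keys a \<subseteq> {1..n})"
  proof -
    have I: "I = {}" if "(a, I) \<in> keys \<omega>" for a I
      using assms that by (auto simp: degree0_iff_keys)
    then show ?thesis
      unfolding Ball_def split_paired_All prod.case by (metis empty_subsetI)
  qed
  then show ?thesis
    unfolding A_PL_def vars_in_def by (simp add: Ball_def in_keys_iff)
qed

lemma map_A_PL:
  assumes "\<omega> \<in> A_PL n U" "h 0 = 0" "\<And>u. u \<in> U \<Longrightarrow> h u \<in> U'"
  shows "Poly_Mapping.map h \<omega> \<in> A_PL n U'"
proof -
  have "keys (Poly_Mapping.map h \<omega>) \<subseteq> keys \<omega>"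
    using assms(2) by (auto simp: in_keys_iff)
  then have "\<forall>(a, I)\<in>keys (Poly_Mapping.map h \<omega>). keys a \<subseteq> {1..n} \<and> I \<subseteq> {1..n}"
    using assms(1) unfolding A_PL_def by blast
  moreover have "\<forall>b. lookup (Poly_Mapping.map h \<omega>) b \<in> U'"
    using assms unfolding A_PL_def by (simp del: split_paired_All)
  ultimately show ?thesis
    unfolding A_PL_def by blast
qed

lemma const_A_PL: "c \<in> U \<Longrightarrow> 0 \<in> U \<Longrightarrow> single (0, {}) c \<in> A_PL n U"
  by (auto simp: A_PL_def lookup_single when_def)

lemma (in vector_space) vars_in_form_subst:
  assumes "degree0 \<omega>" "vars_in X (dt_coeff \<omega> {})" "\<And>i. i \<in> X \<Longrightarrow> vars_in Y (T i)"
  shows "vars_in Y (dt_coeff (form_subst scale T \<omega>) {})"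
proof -
  have "form_subst scale T \<omega> = (\<Sum>(a, I)\<in>keys \<omega>. tensor scale (subst_basis T a I) (lookup \<omega> (a, I)))"
    by (simp add: form_subst_tensor lin_ext_def case_prod_beta)
  then have "dt_coeff (form_subst scale T \<omega>) {} =
      (\<Sum>(a, I)\<in>keys \<omega>. dt_coeff (tensor scale (subst_basis T a I) (lookup \<omega> (a, I))) {})"
    by (simp add: additive.sum[OF additive_dt_coeff] case_prod_beta)
  also have "vars_in Y \<dots>"
  proof (rule vars_in_sum)
    fix k assume k: "k \<in> keys \<omega>"
    then obtain a where a: "k = (a, {})"
      using assms(1) by (cases k) (auto simp: degree0_iff_keys)
    have "keys a \<subseteq> X"
      using assms(2) k unfolding a vars_in_def by (auto simp: in_keys_iff)
    then have "vars_in Y (mono_val T a)"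
      using assms(3) by (intro vars_in_mono_val) auto
    then show "vars_in Y (case k of (a, I) \<Rightarrow> dt_coeff (tensor scale (subst_basis T a I) (lookup \<omega> (a, I))) {})"
      by (auto simp: a vars_in_def in_keys_iff subst_basis_empty lookup_monoform)
  qed
  finally show ?thesis .
qed

lemma (in vector_space) form_subst_in_subspace:
  assumes "subspace U" "\<And>k. lookup \<omega> k \<in> U"
  shows "lookup (form_subst scale T \<omega>) b \<in> U"
proof -
  have "lookup (form_subst scale T \<omega>) b = (\<Sum>(a, I)\<in>keys \<omega>. scale (lookup (subst_basis T a I) b) (lookup \<omega> (a, I)))"
    by (simp add: form_subst_tensor lin_ext_def case_prod_beta lookup_sum)
  then show ?thesis
    using assms by (auto intro!: subspace_sum subspace_scale)
qed

lemma (in vector_space) ext_deriv_in_subspace: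
  assumes "subspace U" "\<And>k. lookup \<omega> k \<in> U"
  shows "lookup (ext_deriv scale \<omega>) b \<in> U"
  unfolding ext_deriv_def lookup_sum case_prod_beta using assms
  by (intro subspace_sum) (auto simp: lookup_single when_def intro!: subspace_scale subspace_0)

lemma (in vector_space) ext_deriv_in_A_PL:
  assumes "subspace U" "\<omega> \<in> A_PL n U"
  shows "ext_deriv scale \<omega> \<in> A_PL n U"
proof -
  have "keys a \<subseteq> {1..n} \<and> I \<subseteq> {1..n}" if aI: "(a, I) \<in> keys (ext_deriv scale \<omega>)" for a I
  proof -
    obtain i I' where i: "i \<notin> I'" "I = insert i I'" "(a + single i 1, I') \<in> keys \<omega>"
      using aI by (rule keys_ext_deriv)
    then have *: "keys (a + single i 1) \<subseteq> {1..n}" "I' \<subseteq> {1..n}"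
      using assms(2) by (auto simp: A_PL_def)
    have "keys (a + single i 1) = insert i (keys a)"
      by (simp add: keys_unit_add add.commute[of a])
    with * i show ?thesis by auto
  qed
  then show ?thesis
    using assms ext_deriv_in_subspace[OF assms(1)] by (auto simp: A_PL_def)
qed

section \<open>Barycentric coordinates and the coordinates of the square\<close>

lemma bary_vars: "j \<le> n \<Longrightarrow> vars_in {1..n} (bary n j :: 'k::field mpoly)"
  unfolding bary_def by (auto intro!: vars_in_diff vars_in_sum vars_in_var)

lemma sum_bary: "(\<Sum>j\<le>n. bary n j) = (1 :: 'k::field mpoly)"
proof -
  have "{..n} = insert 0 {1..n}" by auto
  then have "(\<Sum>j\<le>n. bary n j) = bary n 0 + (\<Sum>j=1..n. bary n j :: 'k mpoly)"
    by simp
  also have "(\<Sum>j=1..n. bary n j) = (\<Sum>j=1..n. var j :: 'k mpoly)"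
    by (intro sum.cong) (auto simp: bary_def)
  finally show ?thesis by (simp add: bary_def)
qed

text \<open>
  The vertex \<open>v\<close> is given by all its barycentric coordinates, the eliminated \<open>t\<^sub>0\<close> included; then \<open>\<theta>\<close>
  maps the vertex \<open>v\<close> to the vertex \<open>\<theta> v\<close> also if one of them is 0.
\<close>

definition vertex :: "nat \<Rightarrow> nat \<Rightarrow> 'k::zero_neq_one" where
  "vertex v i = of_bool (i = v)"

lemma poly_eval_bary_vertex:
  assumes "j \<le> n" "v \<le> n"
  shows "poly_eval (*) (bary n j) (vertex v) = (of_bool (j = v) :: 'k::field)"
proof -
  interpret F: vector_space "(*) :: 'k \<Rightarrow> _" by (rule vector_space_field)
  have "poly_eval (*) (bary n 0) (vertex v) = (1 - (\<Sum>i=1..n. of_bool (i = v)) :: 'k)"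
    by (simp add: bary_def additive.diff[OF F.additive_poly_eval] additive.sum[OF F.additive_poly_eval]
       poly_eval_one poly_eval_var vertex_def)
  also have "(\<Sum>i=1..n. of_bool (i = v)) = (of_bool (v \<noteq> 0) :: 'k)"
    using assms by (auto simp: of_bool_def)
  finally have 0: "poly_eval (*) (bary n 0) (vertex v) = (1 - of_bool (v \<noteq> 0) :: 'k)" .
  show ?thesis
  proof (cases "j = 0")
    case True
    then show ?thesis using 0 by simp
  qed (simp add: bary_def poly_eval_var vertex_def)
qed

lemma poly_eval_bary_origin: "poly_eval (*) (bary n j) (\<lambda>_. 0) = (of_bool (j = 0) :: 'k::field)"
proof -
  interpret F: vector_space "(*) :: 'k \<Rightarrow> _" by (rule vector_space_field)
  show ?thesis
    by (simp add: bary_def additive.diff[OF F.additive_poly_eval] additive.sum[OF F.additive_poly_eval]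
       poly_eval_one poly_eval_var)
qed

lemma poly_eval_bary_pull_vertex:
  assumes "v \<le> m"
  shows "poly_eval (*) (bary_pull m \<theta> i) (vertex v) = (vertex (\<theta> v) i :: 'k::field)"
proof -
  interpret F: vector_space "(*) :: 'k \<Rightarrow> _" by (rule vector_space_field)
  have "poly_eval (*) (bary_pull m \<theta> i) (vertex v) = (\<Sum>j\<in>{j. j \<le> m \<and> \<theta> j = i}. of_bool (j = v) :: 'k)"
    using assms by (simp add: bary_pull_def additive.sum[OF F.additive_poly_eval] poly_eval_bary_vertex)
  also have "\<dots> = vertex (\<theta> v) i"
    using assms by (auto simp: vertex_def of_bool_def)
  finally show ?thesis .
qed

lemma poly_eval_bary_pull_origin:
  "poly_eval (*) (bary_pull m \<theta> i) (\<lambda>_. 0) = (vertex (\<theta> 0) i :: 'k::field)"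
proof -
  interpret F: vector_space "(*) :: 'k \<Rightarrow> _" by (rule vector_space_field)
  have "poly_eval (*) (bary_pull m \<theta> i) (\<lambda>_. 0) = (\<Sum>j\<in>{j. j \<le> m \<and> \<theta> j = i}. of_bool (j = 0) :: 'k)"
    by (simp add: bary_pull_def additive.sum[OF F.additive_poly_eval] poly_eval_bary_origin)
  also have "\<dots> = vertex (\<theta> 0) i"
    by (auto simp: vertex_def of_bool_def)
  finally show ?thesis .
qed

lemma sum_bary_pull:
  assumes "finite W"
  shows "(\<Sum>j\<in>W. bary_pull m \<theta> j) = (\<Sum>l\<in>{l. l \<le> m \<and> \<theta> l \<in> W}. bary m l :: 'k::field mpoly)"
proof -
  have "{j. j \<le> m \<and> \<theta> j = i} = {l \<in> {l. l \<le> m \<and> \<theta> l \<in> W}. \<theta> l = i}" if "i \<in> W" for i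
    using that by auto
  then have "(\<Sum>j\<in>W. bary_pull m \<theta> j :: 'k mpoly) =
      (\<Sum>j\<in>W. sum (bary m) {l \<in> {l. l \<le> m \<and> \<theta> l \<in> W}. \<theta> l = j})"
    by (intro sum.cong refl) (simp add: bary_pull_def)
  also have "\<dots> = (\<Sum>l\<in>{l. l \<le> m \<and> \<theta> l \<in> W}. bary m l)"
    using assms by (intro sum.group) auto
  finally show ?thesis .
qed

lemma poly_subst_bary:
  assumes "simplicial_op m n \<theta>" "j \<le> n"
  shows "poly_subst (bary_pull m \<theta>) (bary n j) = (bary_pull m \<theta> j :: 'k::field mpoly)"
proof (cases "j = 0")
  case True
  have "(\<Sum>j\<le>n. bary_pull m \<theta> j) = (1 :: 'k mpoly)"
  proof -
    have "{l. l \<le> m \<and> \<theta> l \<in> {..n}} = {..m}"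
      using assms by (auto simp: simplicial_op_def)
    then show ?thesis
      by (simp add: sum_bary_pull sum_bary)
  qed
  moreover have "{..n} = insert 0 {1..n}" by auto
  ultimately have "1 - (\<Sum>i=1..n. bary_pull m \<theta> i) = (bary_pull m \<theta> 0 :: 'k mpoly)"
    by (simp add: algebra_simps)
  then show ?thesis
    using True by (simp add: bary_def additive.diff[OF additive_poly_subst] additive.sum[OF additive_poly_subst] poly_subst_var)
next
  case False
  then show ?thesis by (simp add: bary_def poly_subst_var)
qed

abbreviation torus_coord :: "nat \<Rightarrow> tsimplex \<Rightarrow> nat set" where
  "torus_coord i x \<equiv> (if i = 1 then fst x else snd x)"

lemma torus_coord_simps: "x \<in> simps torus n \<Longrightarrow> torus_coord i x \<in> circle_simps n"
  by (auto simp: torus_def)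

lemma circle_simps_finite: "W \<in> circle_simps n \<Longrightarrow> finite W \<and> W \<subseteq> {..n}"
  unfolding circle_simps_def by (auto intro: finite_subset)

lemma pull_torus: "simplicial_op m n \<theta> \<Longrightarrow> x \<in> simps torus n \<Longrightarrow> pull torus m n \<theta> x \<in> simps torus m"
  using simplicial_set_torus unfolding simplicial_set_def by blast

lemma torus_coord_pull: "torus_coord i (pull torus m n \<theta> x) = circle_pull m \<theta> (torus_coord i x)"
  by (simp add: torus_def)

lemma circle_pull_preimage:
  assumes "simplicial_op m n \<theta>" "W \<in> circle_simps n"
  shows "\<theta> 0 \<in> W \<Longrightarrow> {l. l \<le> m \<and> \<theta> l \<in> W} = {..m} \<and> circle_pull m \<theta> W = {}"
    and "\<theta> 0 \<notin> W \<Longrightarrow> {l. l \<le> m \<and> \<theta> l \<in> W} = circle_pull m \<theta> W"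
proof -
  assume 0: "\<theta> 0 \<in> W"
  have "\<theta> l \<in> W" if "l \<le> m" for l
  proof -
    have "\<theta> 0 \<le> \<theta> l" "\<theta> l \<le> n"
      using assms(1) that by (auto simp: simplicial_op_def mono_on_def)
    then show ?thesis
      using assms(2) 0 by (auto simp: circle_simps_def)
  qed
  then show "{l. l \<le> m \<and> \<theta> l \<in> W} = {..m} \<and> circle_pull m \<theta> W = {}"
    by (auto simp: circle_pull_def)
next
  assume "\<theta> 0 \<notin> W"
  then have "{l. l \<le> m \<and> \<theta> l \<in> W} \<noteq> {..m}" by auto
  then show "{l. l \<le> m \<and> \<theta> l \<in> W} = circle_pull m \<theta> W"
    by (simp add: circle_pull_def)
qed

lemma square_coord_vars:
  assumes "x \<in> simps torus n"
  shows "vars_in {1..n} (square_coord n x i :: 'k::field mpoly)"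
  unfolding square_coord_def
  using circle_simps_finite[OF torus_coord_simps[OF assms, of i]]
  by (intro vars_in_sum bary_vars) blast

text \<open>
  If \<open>\<theta>\<close> moves the initial vertex to the edge \<open>t\<^sub>i = 1\<close>, then all of \<open>\<theta>\<^sup>*x\<close> lies on that edge. In the
  torus the edge is identified with \<open>t\<^sub>i = 0\<close>, and the representative chosen for \<open>\<theta>\<^sup>*x\<close> lies there: the
  coordinate jumps from 1 to 0. This jump is the origin of the periods.
\<close>

lemma poly_subst_square_coord:
  assumes "simplicial_op m n \<theta>" "x \<in> simps torus n"
  shows "poly_subst (bary_pull m \<theta>) (square_coord n x i) =
     (if \<theta> 0 \<in> torus_coord i x then 1 else square_coord m (pull torus m n \<theta> x) i :: 'k::field mpoly)"
proof -
  let ?W = "torus_coord i x"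
  have W: "?W \<in> circle_simps n" "finite ?W" "\<And>j. j \<in> ?W \<Longrightarrow> j \<le> n"
    using torus_coord_simps[OF assms(2)] circle_simps_finite by blast+
  have "poly_subst (bary_pull m \<theta>) (square_coord n x i) = (\<Sum>j\<in>?W. bary_pull m \<theta> j :: 'k mpoly)"
    unfolding square_coord_def additive.sum[OF additive_poly_subst]
    using W by (intro sum.cong refl poly_subst_bary[OF assms(1)])
  also have "\<dots> = (\<Sum>l\<in>{l. l \<le> m \<and> \<theta> l \<in> ?W}. bary m l)"
    using W by (intro sum_bary_pull)
  also have "\<dots> = (if \<theta> 0 \<in> ?W then 1 else square_coord m (pull torus m n \<theta> x) i)"
    using circle_pull_preimage[OF assms(1) W(1)]
    unfolding square_coord_def torus_coord_pull by (simp add: sum_bary)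
  finally show ?thesis .
qed

lemma square_coord_pull_zero:
  assumes "simplicial_op m n \<theta>" "x \<in> simps torus n" "\<theta> 0 \<in> torus_coord i x"
  shows "square_coord m (pull torus m n \<theta> x) i = 0"
  using circle_pull_preimage(1)[OF assms(1) torus_coord_simps[OF assms(2)] assms(3)]
  unfolding square_coord_def torus_coord_pull by simp

lemma poly_eval_square_coord_vertex:
  assumes "x \<in> simps torus n" "v \<le> n"
  shows "poly_eval (*) (square_coord n x i) (vertex v) = (of_bool (v \<in> torus_coord i x) :: 'k::field)"
proof -
  interpret F: vector_space "(*) :: 'k \<Rightarrow> _" by (rule vector_space_field)
  let ?W = "torus_coord i x"
  have W: "finite ?W" "\<And>j. j \<in> ?W \<Longrightarrow> j \<le> n"
    using torus_coord_simps[OF assms(1)] circle_simps_finite by blast+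
  have "poly_eval (*) (square_coord n x i) (vertex v) = (\<Sum>j\<in>?W. of_bool (j = v) :: 'k)"
    unfolding square_coord_def additive.sum[OF F.additive_poly_eval]
    using W assms by (intro sum.cong refl poly_eval_bary_vertex) auto
  also have "\<dots> = of_bool (v \<in> ?W)"
    using W(1) by (simp add: of_bool_def)
  finally show ?thesis .
qed

lemma poly_eval_square_coord_origin:
  assumes "x \<in> simps torus n"
  shows "poly_eval (*) (square_coord n x i) (\<lambda>_. 0) = (0 :: 'k::field)"
proof -
  interpret F: vector_space "(*) :: 'k \<Rightarrow> _" by (rule vector_space_field)
  have "0 \<notin> torus_coord i x"
    by (rule circle_simps_0[OF torus_coord_simps[OF assms]])
  then show ?thesis
    unfolding square_coord_def additive.sum[OF F.additive_poly_eval] poly_eval_bary_origin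
    by (intro sum.neutral) (metis of_bool_eq(1))
qed

section \<open>Quasi-periodic functions on the torus\<close>

text \<open>
  The local system of an action of \<open>\<int> \<times> \<int>\<close> by linear maps of the ambient space. It covers the
  systems of homomorphisms between any two of the three representations of an extension.
\<close>

locale torus_action = vector_space s
  for s :: "'k::field_char_0 \<Rightarrow> 'l::ab_group_add \<Rightarrow> 'l" +
  fixes U :: "'l set" and a :: "int \<times> int \<Rightarrow> 'l \<Rightarrow> 'l"
  assumes subspace: "subspace U"
    and act_linear: "Vector_Spaces.linear s s (a g)"
    and act_maps: "u \<in> U \<Longrightarrow> a g u \<in> U"
    and act_zero: "a 0 u = u"
    and act_add: "a (g + h) u = a g (a h u)"
begin

abbreviation L :: "('k, tsimplex, 'l) local_sys" where
  "L \<equiv> rep_ls s U a"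

lemma act_0 [simp]: "a g 0 = 0"
  by (rule additive.zero[OF linear_additive[OF act_linear]])

lemma map_act_diff: "Poly_Mapping.map (a g) (\<omega> - \<eta>) = Poly_Mapping.map (a g) \<omega> - Poly_Mapping.map (a g) \<eta>"
  by (rule additive.diff[OF additive_map[OF linear_additive[OF act_linear]]])

definition zero_cochain :: "(nat \<Rightarrow> tsimplex \<Rightarrow> 'l form) \<Rightarrow> bool" where
  "zero_cochain F \<longleftrightarrow> (\<forall>n x. x \<notin> simps torus n \<longrightarrow> F n x = 0) \<and>
     (\<forall>n. \<forall>x\<in>simps torus n. F n x \<in> A_PL n U \<and> degree0 (F n x))"

lemma zero_cochainD:
  assumes "zero_cochain F"
  shows "x \<notin> simps torus n \<Longrightarrow> F n x = 0"
    and "x \<in> simps torus n \<Longrightarrow> F n x \<in> A_PL n U"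
    and "x \<in> simps torus n \<Longrightarrow> degree0 (F n x)"
  using assms unfolding zero_cochain_def by blast+

text \<open>
  A family of functions that becomes compatible with restriction to \<open>\<theta>\<^sup>*x\<close> once its value at the new
  initial vertex is subtracted; \<open>E g\<close> is this value if the new initial vertex is the corner \<open>g\<close> of
  the square. For \<open>E = 0\<close> these are the cochains of degree 0.
\<close>

definition quasi_periodic :: "(nat \<Rightarrow> tsimplex \<Rightarrow> 'l form) \<Rightarrow> (int \<times> int \<Rightarrow> 'l) \<Rightarrow> bool" where
  "quasi_periodic F E \<longleftrightarrow> zero_cochain F \<and>
     (\<forall>m n \<theta>. simplicial_op m n \<theta> \<longrightarrow> (\<forall>x\<in>simps torus n.
        F m (pull torus m n \<theta> x) = Poly_Mapping.map (a (path_elt (\<theta> 0) x))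
          (form_subst s (bary_pull m \<theta>) (F n x) - single (0, {}) (E (path_elt (\<theta> 0) x)))))"

lemma quasi_periodicD:
  assumes "quasi_periodic F E"
  shows "zero_cochain F"
    and "simplicial_op m n \<theta> \<Longrightarrow> x \<in> simps torus n \<Longrightarrow>
      F m (pull torus m n \<theta> x) = Poly_Mapping.map (a (path_elt (\<theta> 0) x))
        (form_subst s (bary_pull m \<theta>) (F n x) - single (0, {}) (E (path_elt (\<theta> 0) x)))"
  using assms unfolding quasi_periodic_def by blast+

lemma quasi_periodic_zero_iff: "quasi_periodic F (\<lambda>_. 0) \<longleftrightarrow> F \<in> C_PL torus L 0"
proof -
  have "(\<omega> \<in> A_PL n U \<and> degree0 \<omega>) \<longleftrightarrow> (\<omega> \<in> A_PL n U \<and> (\<forall>(b, I)\<in>keys \<omega>. card I = 0))" for \<omega> n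
    unfolding A_PL_def degree0_iff_keys by (fastforce dest: finite_subset[OF _ finite_atLeastAtMost])
  then have "zero_cochain F \<longleftrightarrow> (\<forall>n x. x \<notin> simps torus n \<longrightarrow> F n x = 0) \<and>
     (\<forall>n. \<forall>x\<in>simps torus n. F n x \<in> A_PL n (fib L n x) \<and> (\<forall>(b, I)\<in>keys (F n x). card I = 0))"
    by (simp add: zero_cochain_def rep_ls_def)
  moreover have "(F m (pull torus m n \<theta> x) = Poly_Mapping.map (a (path_elt (\<theta> 0) x))
          (form_subst s (bary_pull m \<theta>) (F n x) - single (0, {}) 0)) \<longleftrightarrow>
       (Poly_Mapping.map (res L m n \<theta> x) (form_subst (lscale L) (bary_pull m \<theta>) (F n x)) = F m (pull torus m n \<theta> x))"
    for m n \<theta> x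
    by (auto simp: rep_ls_def)
  ultimately show ?thesis
    unfolding quasi_periodic_def C_PL_def by blast
qed

lemma A_PL_add: "\<omega> \<in> A_PL n U \<Longrightarrow> \<eta> \<in> A_PL n U \<Longrightarrow> \<omega> + \<eta> \<in> A_PL n U"
  using keys_add[of \<omega> \<eta>] by (fastforce simp: A_PL_def lookup_add intro: subspace_add[OF subspace])

lemma A_PL_diff: "\<omega> \<in> A_PL n U \<Longrightarrow> \<eta> \<in> A_PL n U \<Longrightarrow> \<omega> - \<eta> \<in> A_PL n U"
  using keys_diff[of \<omega> \<eta>] by (fastforce simp: A_PL_def lookup_minus intro: subspace_diff[OF subspace])

lemma quasi_periodic_diff:
  assumes "quasi_periodic F E" "quasi_periodic G E'"
  shows "quasi_periodic (F - G) (\<lambda>g. E g - E' g)"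
proof -
  note Z = quasi_periodicD(1)[OF assms(1)] quasi_periodicD(1)[OF assms(2)]
  have "zero_cochain (F - G)"
    using Z unfolding zero_cochain_def[of "F - G"] by (simp add: zero_cochainD A_PL_diff degree0_diff)
  moreover have "(F - G) m (pull torus m n \<theta> x) = Poly_Mapping.map (a (path_elt (\<theta> 0) x))
          (form_subst s (bary_pull m \<theta>) ((F - G) n x) -
             single (0, {}) (E (path_elt (\<theta> 0) x) - E' (path_elt (\<theta> 0) x)))"
    if "simplicial_op m n \<theta>" "x \<in> simps torus n" for m n \<theta> x
    by (simp add: quasi_periodicD(2)[OF assms(1) that] quasi_periodicD(2)[OF assms(2) that]
        additive.diff[OF additive_form_subst] single_diff map_act_diff)
  ultimately show ?thesis
    by (simp add: quasi_periodic_def)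
qed

text \<open>
  The periods are constants, so they disappear under the derivative.
\<close>

lemma d_quasi_periodic:
  assumes "quasi_periodic F E"
  shows "d_PL L F \<in> cocycles torus L 1"
proof -
  note Z = zero_cochainD[OF quasi_periodicD(1)[OF assms]]
  note F = Z(1) and F' = Z(2,3)
  have dF: "d_PL L F = (\<lambda>n x. ext_deriv s (F n x))"
    by (simp add: d_PL_def rep_ls_def)
  have zero: "ext_deriv s 0 = 0"
    by (rule additive.zero[OF additive_ext_deriv])
  have card: "card I = 1" if bI: "(b, I) \<in> keys (ext_deriv s (F n x))" and x: "x \<in> simps torus n" for b I n x
  proof -
    obtain i I' where i: "i \<notin> I'" "I = insert i I'" "(b + single i 1, I') \<in> keys (F n x)"
      using bI by (rule keys_ext_deriv)
    then have "I' = {}"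
      using F'(2)[OF x] by (auto simp: degree0_iff_keys)
    with i show ?thesis by simp
  qed
  have res: "Poly_Mapping.map (a (path_elt (\<theta> 0) x)) (form_subst s (bary_pull m \<theta>) (ext_deriv s (F n x))) =
      ext_deriv s (F m (pull torus m n \<theta> x))" if "simplicial_op m n \<theta>" "x \<in> simps torus n" for m n \<theta> x
    using F'(2)[OF that(2)]
    by (simp add: quasi_periodicD(2)[OF assms that] ext_deriv_map[OF act_linear]
        additive.diff[OF additive_ext_deriv] ext_deriv_form_subst)
  have "d_PL L F \<in> C_PL torus L 1"
    unfolding C_PL_def dF using F F' card res zero
    by (auto simp: rep_ls_def ext_deriv_in_A_PL[OF subspace])
  moreover have "d_PL L (d_PL L F) = 0"
  proof -
    have "ext_deriv s (ext_deriv s (F n x)) = 0" for n x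
      using F[of x n] F'(2)[of x n] by (cases "x \<in> simps torus n") (auto simp: ext_deriv_ext_deriv zero)
    then show ?thesis
      unfolding dF by (simp add: d_PL_def rep_ls_def fun_eq_iff)
  qed
  ultimately show ?thesis
    by (simp add: cocycles_def)
qed

lemma coboundaries_1: "coboundaries torus L 1 = d_PL L ` {F. quasi_periodic F (\<lambda>_. 0)}"
  by (simp add: coboundaries_def quasi_periodic_zero_iff)

lemma d_PL_diff: "d_PL L (F - G) = d_PL L F - d_PL L G"
  by (simp add: d_PL_def rep_ls_def fun_eq_iff additive.diff[OF additive_ext_deriv])

lemma coboundaries_diff:
  "\<omega> \<in> coboundaries torus L 1 \<Longrightarrow> \<eta> \<in> coboundaries torus L 1 \<Longrightarrow> \<omega> - \<eta> \<in> coboundaries torus L 1"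
  unfolding coboundaries_1 by (auto simp flip: d_PL_diff dest: quasi_periodic_diff)

lemma coh_class_eqI:
  assumes "\<omega> \<in> cocycles torus L 1" "\<eta> \<in> cocycles torus L 1" "\<eta> - \<omega> \<in> coboundaries torus L 1"
  shows "coh_class torus L 1 \<omega> = coh_class torus L 1 \<eta>"
proof -
  have sub: "coh_class torus L 1 \<beta> \<subseteq> coh_class torus L 1 \<alpha>"
    if "\<alpha> \<in> cocycles torus L 1" "\<alpha> - \<beta> \<in> coboundaries torus L 1" for \<alpha> \<beta>
  proof
    fix \<gamma> assume "\<gamma> \<in> coh_class torus L 1 \<beta>"
    then have \<gamma>: "\<gamma> \<in> cocycles torus L 1" "\<gamma> - \<beta> \<in> coboundaries torus L 1"
      by (auto simp: coh_class_def cohomologous_def)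
    have "(\<gamma> - \<beta>) - (\<alpha> - \<beta>) \<in> coboundaries torus L 1"
      by (rule coboundaries_diff[OF \<gamma>(2) that(2)])
    then show "\<gamma> \<in> coh_class torus L 1 \<alpha>"
      using \<gamma> that by (simp add: coh_class_def cohomologous_def)
  qed
  have "((\<eta> - \<omega>) - (\<eta> - \<omega>)) - (\<eta> - \<omega>) \<in> coboundaries torus L 1"
    by (intro coboundaries_diff[OF coboundaries_diff[OF assms(3,3)] assms(3)])
  then have "\<omega> - \<eta> \<in> coboundaries torus L 1"
    by simp
  then show ?thesis
    using sub[OF assms(1), of \<eta>] sub[OF assms(2), of \<omega>] assms(3) by auto
qed

text \<open>
  The difference of the two families has period 0, so it is a cochain.
\<close>

lemma coh_class_quasi_periodic:
  assumes "quasi_periodic F E" "quasi_periodic G E"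
  shows "coh_class torus L 1 (d_PL L F) = coh_class torus L 1 (d_PL L G)"
proof (rule coh_class_eqI)
  have "quasi_periodic (G - F) (\<lambda>_. 0)"
    using quasi_periodic_diff[OF assms(2,1)] by simp
  then show "d_PL L G - d_PL L F \<in> coboundaries torus L 1"
    unfolding coboundaries_1 by (auto simp flip: d_PL_diff)
qed (use assms d_quasi_periodic in auto)

section \<open>Primitives are quasi-periodic\<close>

abbreviation vertex_val :: "(nat \<Rightarrow> tsimplex \<Rightarrow> 'l form) \<Rightarrow> nat \<Rightarrow> tsimplex \<Rightarrow> nat \<Rightarrow> 'l" where
  "vertex_val F n x v \<equiv> form_val s (F n x) (vertex v)"

definition based_primitive :: "(nat \<Rightarrow> tsimplex \<Rightarrow> 'l form) \<Rightarrow> bool" where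
  "based_primitive F \<longleftrightarrow> zero_cochain F \<and> (\<forall>n x. lookup (F n x) (0, {}) = 0) \<and> d_PL L F \<in> C_PL torus L 1"

lemma based_primitiveD:
  assumes "based_primitive F"
  shows "zero_cochain F" "lookup (F n x) (0, {}) = 0" "d_PL L F \<in> C_PL torus L 1"
  using assms unfolding based_primitive_def by blast+

text \<open>
  Both sides are primitives of the same form, since the derivative of \<open>F\<close> is a cochain, and both vanish
  at the initial vertex.
\<close>

lemma based_primitive_pull:
  assumes "based_primitive F" "simplicial_op m n \<theta>" "x \<in> simps torus n"
  shows "F m (pull torus m n \<theta> x) = Poly_Mapping.map (a (path_elt (\<theta> 0) x))
          (form_subst s (bary_pull m \<theta>) (F n x) - single (0, {}) (vertex_val F n x (\<theta> 0)))" (is "_ = ?R")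
proof (rule degree0_primitive_unique[OF vector_space_axioms])
  have y: "pull torus m n \<theta> x \<in> simps torus m"
    by (rule pull_torus[OF assms(2,3)])
  have F: "degree0 (F n x)" if "x \<in> simps torus n" for n x
    using assms(1) that by (simp add: based_primitiveD zero_cochainD)
  show "degree0 (F m (pull torus m n \<theta> x))"
    by (rule F[OF y])
  show "degree0 ?R"
    by (intro degree0_map degree0_diff degree0_form_subst F assms) simp_all
  have "Poly_Mapping.map (a (path_elt (\<theta> 0) x)) (form_subst s (bary_pull m \<theta>) (ext_deriv s (F n x))) =
      ext_deriv s (F m (pull torus m n \<theta> x))"
    using assms unfolding based_primitive_def C_PL_def d_PL_def rep_ls_def by auto
  then show "ext_deriv s (F m (pull torus m n \<theta> x)) = ext_deriv s ?R"
    using F[OF assms(3)] by (simp add: ext_deriv_map[OF act_linear] additive.diff[OF additive_ext_deriv] ext_deriv_form_subst)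
  have "(\<lambda>i. poly_eval (*) (bary_pull m \<theta> i) (\<lambda>_. 0)) = (vertex (\<theta> 0) :: nat \<Rightarrow> 'k)"
    by (rule ext) (rule poly_eval_bary_pull_origin)
  then have "form_val s (form_subst s (bary_pull m \<theta>) (F n x)) (\<lambda>_. 0) = vertex_val F n x (\<theta> 0)"
    by (simp add: form_val_subst[OF F[OF assms(3)]])
  then have "lookup (form_subst s (bary_pull m \<theta>) (F n x)) (0, {}) = vertex_val F n x (\<theta> 0)"
    by (simp add: form_val_origin)
  then show "lookup (F m (pull torus m n \<theta> x)) (0, {}) = lookup ?R (0, {})"
    by (simp add: based_primitiveD(2)[OF assms(1)] lookup_minus)
qed

lemma vertex_val_pull:
  assumes "based_primitive F" "simplicial_op m n \<theta>" "x \<in> simps torus n" "v \<le> m"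
  shows "vertex_val F m (pull torus m n \<theta> x) v = a (path_elt (\<theta> 0) x) (vertex_val F n x (\<theta> v) - vertex_val F n x (\<theta> 0))"
proof -
  have F: "degree0 (F n x)"
    using assms by (simp_all add: based_primitiveD zero_cochainD)
  have "(\<lambda>i. poly_eval (*) (bary_pull m \<theta> i) (vertex v)) = (vertex (\<theta> v) :: nat \<Rightarrow> 'k)"
    by (rule ext) (rule poly_eval_bary_pull_vertex[OF assms(4)])
  then show ?thesis
    by (simp add: based_primitive_pull[OF assms(1-3)] form_val_map[OF act_linear] form_val_diff form_val_subst[OF F])
qed

lemma vertex_val_0:
  assumes "based_primitive F" "x \<in> simps torus n"
  shows "vertex_val F n x 0 = 0"
proof -
  have "F n x \<in> A_PL n U" "degree0 (F n x)"
    using assms by (simp_all add: based_primitiveD zero_cochainD)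
  then have vars: "vars_in {1..n} (dt_coeff (F n x) {})"
    by (simp add: A_PL_degree0)
  have "vertex_val F n x 0 = form_val s (F n x) (\<lambda>_. 0)"
    unfolding form_val_def using vars by (intro poly_eval_cong) (fastforce simp: vars_in_def vertex_def)
  also have "\<dots> = 0"
    by (simp add: form_val_origin based_primitiveD(2)[OF assms(1)])
  finally show ?thesis .
qed

text \<open>
  The edge from \<open>(0,0)\<close> to the corner \<open>g\<close> of the square; for \<open>g = (0,0)\<close> it is degenerate.
\<close>

definition corner :: "int \<times> int \<Rightarrow> tsimplex" where
  "corner g = (if fst g = 1 then {1} else {}, if snd g = 1 then {1} else {})"

text \<open>
  The edge from the initial vertex of \<open>x\<close> to its vertex \<open>v\<close> is, as a simplex of the torus,
  \<open>corner (path_elt v x)\<close>, and restriction to an edge that starts at the initial vertex is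
  compatible with \<open>F\<close> without any correction.
\<close>

lemma vertex_val_corner:
  assumes "based_primitive F" "x \<in> simps torus n" "v \<le> n"
  shows "vertex_val F n x v = vertex_val F 1 (corner (path_elt v x)) 1"
proof -
  \<comment> \<open>the edge from the vertex 0 to the vertex \<open>v\<close>\<close>
  define \<theta> where "\<theta> j = (if j = 0 then 0 else v)" for j :: nat
  have op: "simplicial_op 1 n \<theta>"
    using assms(3) by (auto simp: simplicial_op_def \<theta>_def mono_on_def)
  have 0: "0 \<notin> fst x" "0 \<notin> snd x"
    using torus_coord_simps[OF assms(2), of 1] torus_coord_simps[OF assms(2), of 2] circle_simps_0 by auto
  have path: "path_elt (\<theta> 0) x = 0"
    using 0 by (simp add: path_elt_def \<theta>_def zero_prod_def)
  have "{j. j \<le> Suc 0 \<and> \<theta> j \<in> W} = (if v \<in> W then {1} else {})" if "0 \<notin> W" for W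
  proof -
    have "j \<le> Suc 0 \<longleftrightarrow> j = 0 \<or> j = 1" for j by auto
    then show ?thesis using that by (auto simp: \<theta>_def)
  qed
  moreover have "{..Suc 0} \<noteq> {1}" by force
  ultimately have pull: "circle_pull 1 \<theta> W = (if v \<in> W then {1} else {})" if "0 \<notin> W" for W
    using that by (simp add: circle_pull_def)
  have "pull torus 1 n \<theta> x = corner (path_elt v x)"
    using 0 by (simp add: torus_def pull corner_def path_elt_def del: One_nat_def)
  then show ?thesis
    using vertex_val_pull[OF assms(1) op assms(2), where v = 1] vertex_val_0[OF assms(1,2)]
    unfolding path by (simp add: act_zero \<theta>_def)
qed

definition has_periods :: "(nat \<Rightarrow> tsimplex \<Rightarrow> 'l form) \<Rightarrow> (int \<times> int \<Rightarrow> 'l) \<Rightarrow> bool" where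
  "has_periods F E \<longleftrightarrow> based_primitive F \<and>
     (\<forall>n. \<forall>x\<in>simps torus n. \<forall>v\<le>n. vertex_val F n x v = E (path_elt v x))"

lemma based_primitive_has_periods:
  assumes "based_primitive F"
  obtains E where "has_periods F E"
  using vertex_val_corner[OF assms] assms that[of "\<lambda>g. vertex_val F 1 (corner g) 1"]
  by (simp add: has_periods_def)

lemma has_periods_quasi_periodic:
  assumes "has_periods F E"
  shows "quasi_periodic F E"
proof -
  have "vertex_val F n x (\<theta> 0) = E (path_elt (\<theta> 0) x)" if "simplicial_op m n \<theta>" "x \<in> simps torus n" for m n \<theta> x
    using assms that by (auto simp: has_periods_def simplicial_op_def)
  then show ?thesis
    using assms based_primitive_pull[of F] based_primitiveD(1)[of F]
    by (simp add: has_periods_def quasi_periodic_def)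
qed

text \<open>
  The two relations come from the two triangles of the square, in each by restriction to the edge
  opposite to the initial vertex.
\<close>

lemma period_relations:
  assumes "has_periods F E"
  shows "E (0, 0) = 0" "E (0, 1) = a (1, 0) (E (1, 1) - E (1, 0))" "E (1, 0) = a (0, 1) (E (1, 1) - E (0, 1))"
    "g \<in> {0, 1} \<times> {0, 1} \<Longrightarrow> E g \<in> U"
proof -
  have F: "based_primitive F"
    using assms by (simp add: has_periods_def)
  have E: "vertex_val F n x v = E (path_elt v x)" if "x \<in> simps torus n" "v \<le> n" for n x v
    using assms that by (auto simp: has_periods_def)
  have op: "simplicial_op 1 2 Suc"
    by (auto simp: simplicial_op_def mono_on_def)
  have 1: "{1, 2} \<in> circle_simps 2" "{2} \<in> circle_simps 2" "{} \<in> circle_simps n" "{1} \<in> circle_simps 1" for n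
  proof -
    have "{1, 2} \<noteq> {..2::nat}" "{2} \<noteq> {..2::nat}" "{1} \<noteq> {..1::nat}"
      by force+
    then show "{1, 2} \<in> circle_simps 2" "{2} \<in> circle_simps 2" "{} \<in> circle_simps n" "{1} \<in> circle_simps 1"
      by (auto simp: circle_simps_def)
  qed
  have pull: "circle_pull 1 Suc {1, 2} = {}" "circle_pull 1 Suc {2} = {1}"
  proof -
    have le: "j \<le> Suc 0 \<longleftrightarrow> j = 0 \<or> j = 1" for j by auto
    have "{..Suc 0} \<noteq> {1}" by force
    then show "circle_pull 1 Suc {1, 2} = {}" "circle_pull 1 Suc {2} = {1}"
      unfolding circle_pull_def by (auto simp: le)
  qed
  show E0: "E (0, 0) = 0"
    using vertex_val_0[OF F, of "({}, {})" 0] E[of "({}, {})" 0 0] 1 by (simp add: torus_def path_elt_def)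
  have t: "({1, 2}, {2}) \<in> simps torus 2" "({2}, {1, 2}) \<in> simps torus 2"
    "({}, {1}) \<in> simps torus 1" "({1}, {}) \<in> simps torus 1" "({1}, {1}) \<in> simps torus 1" "({}, {}) \<in> simps torus 1"
    using 1 by (auto simp: torus_def)
  \<comment> \<open>the edge \<open>t\<^sub>1 = 1\<close> of the lower triangle is \<open>\<sigma>\<^sub>2\<close>, the edge \<open>t\<^sub>2 = 1\<close> of the upper one is \<open>\<sigma>\<^sub>1\<close>\<close>
  have p: "pull torus 1 2 Suc ({1, 2}, {2}) = ({}, {1})" "pull torus 1 2 Suc ({2}, {1, 2}) = ({1}, {})"
    using pull by (simp_all add: torus_def)
  show "E (0, 1) = a (1, 0) (E (1, 1) - E (1, 0))"
    using vertex_val_pull[OF F op t(1), where v = 1] E[OF t(1), of 1] E[OF t(1), of 2] E[OF t(3), of 1]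
    unfolding p by (simp add: path_elt_def numeral_2_eq_2)
  show "E (1, 0) = a (0, 1) (E (1, 1) - E (0, 1))"
    using vertex_val_pull[OF F op t(2), where v = 1] E[OF t(2), of 1] E[OF t(2), of 2] E[OF t(4), of 1]
    unfolding p by (simp add: path_elt_def numeral_2_eq_2)
  have "vertex_val F n x v \<in> U" if "x \<in> simps torus n" for n x v
  proof -
    have "F n x \<in> A_PL n U"
      using F that by (simp add: based_primitiveD zero_cochainD)
    then show ?thesis
      unfolding form_val_def poly_eval_def
      by (intro subspace_sum subspace subspace_scale) (simp add: A_PL_def)
  qed
  moreover assume "g \<in> {0, 1} \<times> {0, 1}"
  moreover from calculation(2) have "path_elt 1 (corner g) = g" "corner g \<in> simps torus 1"
    using t by (auto simp: path_elt_def corner_def)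
  ultimately show "E g \<in> U"
    using E[of "corner g" 1 1] by (metis order_refl)
qed

lemma cocycle_has_based_primitive:
  assumes "\<omega> \<in> cocycles torus L 1"
  obtains F where "based_primitive F" "d_PL L F = \<omega>"
proof -
  have \<omega>: "\<omega> \<in> C_PL torus L 1" "d_PL L \<omega> = 0"
    using assms by (auto simp: cocycles_def)
  have zero: "\<omega> n x = 0" if "x \<notin> simps torus n" for n x
    using \<omega>(1) that unfolding C_PL_def by blast
  have "\<exists>\<phi>. \<phi> \<in> A_PL n U \<and> degree0 \<phi> \<and> ext_deriv s \<phi> = \<omega> n x \<and> lookup \<phi> (0, {}) = 0"
    if x: "x \<in> simps torus n" for n x
  proof -
    have A: "\<omega> n x \<in> A_PL n U"
      using \<omega>(1) x by (simp add: C_PL_def rep_ls_def)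
    have "ext_deriv s (\<omega> n x) = 0"
      using fun_cong[OF fun_cong[OF \<omega>(2)]] by (simp add: d_PL_def rep_ls_def)
    moreover have "\<And>b I. (b, I) \<in> keys (\<omega> n x) \<Longrightarrow> card I = 1"
      using \<omega>(1) x by (fastforce simp: C_PL_def)
    ultimately obtain f where f: "ext_deriv s (monoform f {}) = \<omega> n x" "lookup f 0 = 0"
      "\<And>c. c \<noteq> 0 \<Longrightarrow> \<exists>i r. i \<in> keys c \<and> lookup f c = s r (lookup (\<omega> n x) (c - single i 1, {i}))"
      using primitive_exists[OF vector_space_axioms, of "\<omega> n x"] by blast
    have "lookup f c \<in> U" for c
    proof (cases "c = 0")
      case False
      then obtain i r where "lookup f c = s r (lookup (\<omega> n x) (c - single i 1, {i}))"
        using f(3) by blast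
      moreover have "lookup (\<omega> n x) (c - single i 1, {i}) \<in> U"
        using A unfolding A_PL_def by blast
      ultimately show ?thesis
        by (simp only: subspace_scale[OF subspace])
    qed (use f(2) subspace_0[OF subspace] in simp)
    moreover have "vars_in {1..n} f"
      unfolding vars_in_def
    proof
      fix c assume c: "c \<in> keys f"
      then have "c \<noteq> 0"
        using f(2) by (auto simp: in_keys_iff)
      then obtain i r where i: "i \<in> keys c" "lookup f c = s r (lookup (\<omega> n x) (c - single i 1, {i}))"
        using f(3) by blast
      then have "(c - single i 1, {i}) \<in> keys (\<omega> n x)"
        using c by (auto simp: in_keys_iff)
      then have *: "keys (c - single i 1) \<subseteq> {1..n}" "i \<in> {1..n}"
        using A by (auto simp: A_PL_def)
      have "keys c \<subseteq> insert i (keys (c - single i 1))"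
        by (auto simp: in_keys_iff lookup_minus lookup_single when_def split: if_splits)
      with * show "keys c \<subseteq> {1..n}" by auto
    qed
    ultimately have "monoform f {} \<in> A_PL n U"
      using subspace_0[OF subspace] by (simp add: A_PL_degree0 dt_coeff_monoform lookup_monoform when_def)
    with f show ?thesis
      by (intro exI[of _ "monoform f {}"]) (simp add: lookup_monoform)
  qed
  note ex = this
  define F where "F n x = (if x \<in> simps torus n then SOME \<phi>. \<phi> \<in> A_PL n U \<and> degree0 \<phi> \<and>
      ext_deriv s \<phi> = \<omega> n x \<and> lookup \<phi> (0, {}) = 0 else 0)" for n x
  have \<phi>: "F n x \<in> A_PL n U \<and> degree0 (F n x) \<and> ext_deriv s (F n x) = \<omega> n x \<and> lookup (F n x) (0, {}) = 0"
    if "x \<in> simps torus n" for n x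
    using someI_ex[OF ex[OF that]] that by (simp add: F_def)
  have off: "F n x = 0" if "x \<notin> simps torus n" for n x
    using that by (simp add: F_def)
  have dF: "d_PL L F = \<omega>"
  proof (intro ext)
    show "d_PL L F n x = \<omega> n x" for n x
      using \<phi>[of x n] zero[of x n] off[of x n]
      by (cases "x \<in> simps torus n") (simp_all add: d_PL_def rep_ls_def additive.zero[OF additive_ext_deriv])
  qed
  then have "based_primitive F"
    using \<phi> off \<omega>(1) unfolding based_primitive_def zero_cochain_def by (metis lookup_zero)
  with dF show ?thesis by (rule that[rotated])
qed

section \<open>Polynomials on the square\<close>

lemma square_polys_iff: "\<mu> \<in> square_polys U \<longleftrightarrow> vars_in {1, 2} \<mu> \<and> (\<forall>c. lookup \<mu> c \<in> U)"
  by (simp add: square_polys_def vars_in_def)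

lemma zero_cochain_square_form:
  assumes "\<mu> \<in> square_polys U"
  shows "zero_cochain (square_form s (monoform \<mu> {}))"
proof -
  have "form_subst s (square_coord n x) (monoform \<mu> {}) \<in> A_PL n U" if x: "x \<in> simps torus n" for n x
  proof -
    have "vars_in {1..n} (dt_coeff (form_subst s (square_coord n x) (monoform \<mu> {})) {})"
      using assms by (intro vars_in_form_subst[where X = "{1, 2}"] square_coord_vars[OF x])
        (simp_all add: square_polys_iff dt_coeff_monoform)
    moreover have "lookup (monoform \<mu> {}) k \<in> U" for k
      using assms subspace_0[OF subspace] by (cases k) (auto simp: square_polys_iff lookup_monoform when_def)
    ultimately show ?thesis
      by (simp add: A_PL_degree0 degree0_form_subst form_subst_in_subspace[OF subspace])
  qed
  then show ?thesis
    unfolding zero_cochain_def by (simp add: square_form_def degree0_form_subst del: split_paired_All)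
qed

lemma d_PL_square_form:
  "d_PL L (square_form s (monoform \<mu> {})) = square_form s (ext_deriv s (monoform \<mu> {}))"
  by (simp add: fun_eq_iff d_PL_def rep_ls_def square_form_def ext_deriv_form_subst additive.zero[OF additive_ext_deriv])

text \<open>
  All simplices of the torus see the same polynomial, so the value at a vertex is the value of \<open>\<mu>\<close> at
  the corresponding corner of the square.
\<close>

lemma square_form_periods:
  assumes "\<mu> \<in> square_polys U" "lookup \<mu> 0 = 0"
    "square_form s (ext_deriv s (monoform \<mu> {})) \<in> C_PL torus L 1"
  shows "has_periods (square_form s (monoform \<mu> {}))
    (\<lambda>g. poly_eval s \<mu> (square_point (of_int (fst g)) (of_int (snd g))))"
proof -
  have vars: "vars_in {1, 2} \<mu>"
    using assms(1) by (simp add: square_polys_iff)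
  have origin: "lookup (square_form s (monoform \<mu> {}) n x) (0, {}) = 0" for n x
  proof (cases "x \<in> simps torus n")
    case True
    have "form_val s (form_subst s (square_coord n x) (monoform \<mu> {})) (\<lambda>_. 0) = 0"
      by (simp add: form_val_subst poly_eval_square_coord_origin[OF True] poly_eval_origin assms)
    then show ?thesis
      by (simp add: square_form_def form_val_origin)
  qed (simp add: square_form_def)
  have "vertex_val (square_form s (monoform \<mu> {})) n x v =
     poly_eval s \<mu> (square_point (of_int (fst (path_elt v x))) (of_int (snd (path_elt v x))))"
    if "x \<in> simps torus n" "v \<le> n" for n x v
  proof -
    have "vertex_val (square_form s (monoform \<mu> {})) n x v = poly_eval s \<mu> (\<lambda>i. of_bool (v \<in> torus_coord i x))"
      using that by (simp add: square_form_def form_val_subst poly_eval_square_coord_vertex del: of_bool_eq_iff)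
    also have "\<dots> = poly_eval s \<mu> (square_point (of_int (fst (path_elt v x))) (of_int (snd (path_elt v x))))"
      using vars by (intro poly_eval_cong) (fastforce simp: vars_in_def square_point_def path_elt_def)
    finally show ?thesis .
  qed
  then show ?thesis
    using zero_cochain_square_form[OF assms(1)] origin assms(3)
    unfolding has_periods_def based_primitive_def d_PL_square_form by auto
qed

text \<open>
  The polynomial of degree at most 1 in each of \<open>t\<^sub>1\<close> and \<open>t\<^sub>2\<close> that takes the value \<open>E g\<close> at each
  corner \<open>g\<close>, where \<open>E (0, 0) = 0\<close>.
\<close>

definition bilinear :: "(int \<times> int \<Rightarrow> 'l) \<Rightarrow> 'l mpoly" where
  "bilinear E = single (single 1 1) (E (1, 0)) + single (single 2 1) (E (0, 1)) +
     single (single 1 1 + single 2 1) (E (1, 1) - E (1, 0) - E (0, 1))"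

lemma form_subst_bilinear:
  "form_subst s T (monoform (bilinear E) {}) = tensor s (monoform (T 1) {}) (E (1, 0)) + tensor s (monoform (T 2) {}) (E (0, 1))
    + tensor s (monoform (T 1 * T 2) {}) (E (1, 1) - E (1, 0) - E (0, 1))"
  unfolding bilinear_def
  by (simp add: additive.add[OF additive_monoform] additive.add[OF additive_form_subst] form_subst_single subst_basis_empty mono_val_add)

text \<open>
  On each edge of the square \<open>bilinear E\<close> interpolates linearly between two corners, so the conditions
  on opposite edges reduce to conditions at the corners.
\<close>

lemma quasi_periodic_bilinear:
  assumes "E (0, 0) = 0" "E (0, 1) = a (1, 0) (E (1, 1) - E (1, 0))" "E (1, 0) = a (0, 1) (E (1, 1) - E (0, 1))"
    and U: "\<And>g. g \<in> {0, 1} \<times> {0, 1} \<Longrightarrow> E g \<in> U"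
  shows "bilinear E \<in> square_polys U" "quasi_periodic (square_form s (monoform (bilinear E) {})) E"
proof -
  have EU: "E (1, 0) \<in> U" "E (0, 1) \<in> U" "E (1, 1) - E (1, 0) - E (0, 1) \<in> U"
    using U by (auto intro!: subspace_diff[OF subspace])
  have "vars_in {1, 2} (bilinear E)"
    unfolding bilinear_def by (intro vars_in_add vars_in_single) (auto simp: keys_unit_add)
  moreover have "lookup (bilinear E) c \<in> U" for c
    unfolding bilinear_def lookup_add lookup_single when_def using EU subspace_0[OF subspace]
    by (intro subspace_add[OF subspace]) auto
  ultimately show \<mu>: "bilinear E \<in> square_polys U"
    by (simp add: square_polys_iff)
  have "form_subst s (square_coord m (pull torus m n \<theta> x)) (monoform (bilinear E) {}) =
     Poly_Mapping.map (a (path_elt (\<theta> 0) x))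
        (form_subst s (bary_pull m \<theta>) (form_subst s (square_coord n x) (monoform (bilinear E) {})) -
         single (0, {}) (E (path_elt (\<theta> 0) x)))" if \<theta>: "simplicial_op m n \<theta>" and x: "x \<in> simps torus n" for m n \<theta> x
  proof -
    let ?T = "square_coord m (pull torus m n \<theta> x) :: nat \<Rightarrow> 'k mpoly"
    let ?S = "\<lambda>i. poly_subst (bary_pull m \<theta>) (square_coord n x i) :: 'k mpoly"
    have S: "?S i = (if \<theta> 0 \<in> torus_coord i x then 1 else ?T i)" for i
      by (rule poly_subst_square_coord[OF \<theta> x])
    have T: "?T i = 0" if "\<theta> 0 \<in> torus_coord i x" for i
      by (rule square_coord_pull_zero[OF \<theta> x that])
    have g: "path_elt (\<theta> 0) x = (of_bool (\<theta> 0 \<in> fst x), of_bool (\<theta> 0 \<in> snd x))"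
      by (simp add: path_elt_def)
    have one: "monoform (1 :: 'k mpoly) {} = single (0, {}) 1"
      using monoform_single[of 0 "1 :: 'k" "{}"] by simp
    have zero: "tensor s 0 c = 0" for c
      by (rule additive.zero[OF additive_tensor_left])
    have map_tensor: "Poly_Mapping.map (a g) (tensor s \<eta> c) = tensor s \<eta> (a g c)" for g \<eta> c
      by (rule poly_mapping_eqI) (simp add: linear_map_scale[OF act_linear])
    have map_add: "Poly_Mapping.map (a g) (\<omega> + \<eta>) = Poly_Mapping.map (a g) \<omega> + Poly_Mapping.map (a g) \<eta>" for g \<omega> \<eta>
      by (rule additive.add[OF additive_map[OF linear_additive[OF act_linear]]])
    note tensor_add = additive.add[OF additive_tensor_right, symmetric]
    have comp: "form_subst s (bary_pull m \<theta>) (form_subst s (square_coord n x) (monoform (bilinear E) {})) =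
       form_subst s ?S (monoform (bilinear E) {})"
      by (rule form_subst_form_subst_0)
    have id: "Poly_Mapping.map (a 0) \<omega> = \<omega>" for \<omega>
      by (rule poly_mapping_eqI) (simp add: act_zero)
    \<comment> \<open>the corner of the square to which \<open>\<theta>\<close> moves the initial vertex\<close>
    consider "\<theta> 0 \<notin> fst x" "\<theta> 0 \<notin> snd x" | "\<theta> 0 \<in> fst x" "\<theta> 0 \<notin> snd x" |
        "\<theta> 0 \<notin> fst x" "\<theta> 0 \<in> snd x" | "\<theta> 0 \<in> fst x" "\<theta> 0 \<in> snd x" by blast
    then show ?thesis
    proof cases
      case 1
      then have "?S 1 = ?T 1" "?S 2 = ?T 2" by (simp_all only: S) auto
      then show ?thesis
        using 1 unfolding comp unfolding form_subst_bilinear by (simp add: g assms(1) id[unfolded zero_prod_def])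
    next
      case 2
      then have "?S 1 = 1" "?S 2 = ?T 2" "?T 1 = 0" using T[of 1] by (simp_all only: S) auto
      then have "form_subst s ?S (monoform (bilinear E) {}) - single (0, {}) (E (1, 0)) =
          tensor s (monoform (?T 2) {}) (E (1, 1) - E (1, 0))"
        unfolding form_subst_bilinear by (simp add: one tensor_add)
      then show ?thesis
        using 2 \<open>?T 1 = 0\<close> unfolding comp by (simp add: g map_tensor form_subst_bilinear zero assms(2)[symmetric])
    next
      case 3
      then have "?S 1 = ?T 1" "?S 2 = 1" "?T 2 = 0" using T[of 2] by (simp_all only: S) auto
      then have "form_subst s ?S (monoform (bilinear E) {}) - single (0, {}) (E (0, 1)) =
          tensor s (monoform (?T 1) {}) (E (1, 1) - E (0, 1))"
        unfolding form_subst_bilinear by (simp add: one tensor_add algebra_simps)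
      then show ?thesis
        using 3 \<open>?T 2 = 0\<close> unfolding comp by (simp add: g map_tensor form_subst_bilinear zero assms(3)[symmetric])
    next
      case 4
      then have "?S 1 = 1" "?S 2 = 1" "?T 2 = 0" "?T 1 = 0" using T[of 2] T[of 1] by (simp_all only: S) auto
      then have "form_subst s ?S (monoform (bilinear E) {}) - single (0, {}) (E (1, 1)) = 0"
        unfolding form_subst_bilinear by (simp add: one flip: single_add)
      then show ?thesis
        using 4 \<open>?T 2 = 0\<close> \<open>?T 1 = 0\<close> unfolding comp
          by (simp add: g form_subst_bilinear zero additive.zero[OF additive_map[OF linear_additive[OF act_linear]]])
    qed
  qed
  then show "quasi_periodic (square_form s (monoform (bilinear E) {})) E"
    unfolding quasi_periodic_def using zero_cochain_square_form[OF \<mu>] by (simp add: square_form_def pull_torus)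
qed

lemma poly_deriv_in_square_polys:
  assumes "\<mu> \<in> square_polys U"
  shows "poly_deriv s j \<mu> \<in> square_polys U"
proof -
  have "dt_coeff (ext_deriv s (monoform \<mu> {})) {j} = poly_deriv s j \<mu>"
    by (simp add: dt_coeff_ext_deriv_monoform)
  moreover have "vars_in {1, 2} (poly_deriv s j \<mu>)"
    unfolding poly_deriv_def
  proof (intro vars_in_sum vars_in_single)
    fix c assume "c \<in> keys \<mu>"
    then have "keys c \<subseteq> {1, 2}"
      using assms by (simp add: square_polys_iff vars_in_def)
    moreover have "keys (c - single j 1) \<subseteq> keys c"
      by (auto simp: in_keys_iff lookup_minus)
    ultimately show "keys (c - single j 1) \<subseteq> {1, 2}"
      by blast
  qed
  moreover have "lookup (ext_deriv s (monoform \<mu> {})) b \<in> U" for b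
  proof (rule ext_deriv_in_subspace[OF subspace])
    fix k :: "mono \<times> nat set"
    show "lookup (monoform \<mu> {}) k \<in> U"
      using assms subspace_0[OF subspace] by (cases k) (auto simp: square_polys_iff lookup_monoform when_def)
  qed
  ultimately show ?thesis
    unfolding square_polys_iff by (metis lookup_dt_coeff)
qed

lemma ext_deriv_square_poly:
  assumes "\<mu> \<in> square_polys U"
  shows "ext_deriv s (monoform \<mu> {}) = form1 (poly_deriv s 1 \<mu>) (poly_deriv s 2 \<mu>)"
proof (rule form_eqI)
  fix J
  have "poly_deriv s j \<mu> = 0" if "j \<notin> {1, 2}" for j
  proof -
    have "lookup c j = 0" if c: "c \<in> keys \<mu>" for c
    proof -
      have "keys c \<subseteq> {1, 2}"
        using assms c by (simp add: square_polys_iff vars_in_def)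
      then show ?thesis
        using \<open>j \<notin> {1, 2}\<close> by (metis in_keys_iff subsetD)
    qed
    then show ?thesis
      unfolding poly_deriv_def by (intro sum.neutral) simp
  qed
  then have "\<forall>j. j \<noteq> 1 \<longrightarrow> j \<noteq> 2 \<longrightarrow> poly_deriv s j \<mu> = 0"
    by simp
  then show "dt_coeff (ext_deriv s (monoform \<mu> {})) J = dt_coeff (form1 (poly_deriv s 1 \<mu>) (poly_deriv s 2 \<mu>)) J"
    by (auto simp: dt_coeff_ext_deriv_monoform form1_def additive.add[OF additive_dt_coeff] dt_coeff_monoform)
qed

text \<open>
  The potential is the bilinear interpolation of the values of the canonical primitive of \<open>\<omega>\<close> at the
  corners.
\<close>

theorem class_has_square_representative:
  assumes "\<omega> \<in> cocycles torus L 1"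
  obtains P Q where "P \<in> square_polys U" "Q \<in> square_polys U" "square_form s (form1 P Q) \<in> cocycles torus L 1"
    "coh_class torus L 1 (square_form s (form1 P Q)) = coh_class torus L 1 \<omega>"
proof -
  obtain F where F: "based_primitive F" "d_PL L F = \<omega>"
    using assms by (rule cocycle_has_based_primitive)
  obtain E where E: "has_periods F E"
    using based_primitive_has_periods[OF F(1)] .
  define \<mu> where "\<mu> = bilinear E"
  have \<mu>: "\<mu> \<in> square_polys U" "quasi_periodic (square_form s (monoform \<mu> {})) E"
    unfolding \<mu>_def using quasi_periodic_bilinear[OF period_relations[OF E]] by auto
  have d: "d_PL L (square_form s (monoform \<mu> {})) = square_form s (form1 (poly_deriv s 1 \<mu>) (poly_deriv s 2 \<mu>))"
    by (simp add: d_PL_square_form ext_deriv_square_poly[OF \<mu>(1)])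
  show ?thesis
    using that[of "poly_deriv s 1 \<mu>" "poly_deriv s 2 \<mu>"] poly_deriv_in_square_polys[OF \<mu>(1)]
      d_quasi_periodic[OF \<mu>(2)] coh_class_quasi_periodic[OF \<mu>(2) has_periods_quasi_periodic[OF E]]
    unfolding d F(2) by simp
qed

text \<open>
  The restriction to the lower triangle is closed, so it has a primitive there; since the square and
  the triangle have the same polynomials up to a linear substitution, this yields the potential.
\<close>

theorem square_cocycle_has_unique_potential:
  assumes "P \<in> square_polys U" "Q \<in> square_polys U" "square_form s (form1 P Q) \<in> cocycles torus L 1"
  shows "\<exists>!\<mu>. \<mu> \<in> square_polys U \<and> poly_deriv s 1 \<mu> = P \<and> poly_deriv s 2 \<mu> = Q \<and> lookup \<mu> 0 = 0"
proof (rule ex_ex1I)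
  \<comment> \<open>the triangle with vertices \<open>(0,0)\<close>, \<open>(1,0)\<close>, \<open>(1,1)\<close>: there \<open>t\<^sub>1 = s\<^sub>1 + s\<^sub>2\<close> and \<open>t\<^sub>2 = s\<^sub>2\<close> in terms
    of the barycentric coordinates \<open>s\<^sub>1\<close>, \<open>s\<^sub>2\<close>\<close>
  define x :: tsimplex where "x = ({1, 2}, {2})"
  have x: "x \<in> simps torus 2"
  proof -
    have "{1, 2} \<noteq> {..2::nat}" "{2} \<noteq> {..2::nat}"
      by force+
    then show ?thesis
      by (auto simp: x_def torus_def circle_simps_def)
  qed
  define S where "S = (square_coord 2 x :: nat \<Rightarrow> 'k mpoly)"
  \<comment> \<open>the inverse substitution\<close>
  define T where "T i = (if i = 1 then var 1 - var 2 else var 2 :: 'k mpoly)" for i :: nat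
  obtain F where F: "based_primitive F" "d_PL L F = square_form s (form1 P Q)"
    using assms(3) by (rule cocycle_has_based_primitive)
  let ?f = "F 2 x"
  have f: "degree0 ?f" "?f \<in> A_PL 2 U" "lookup ?f (0, {}) = 0"
    using F(1) x by (simp_all add: based_primitiveD zero_cochainD)
  have df: "ext_deriv s ?f = form_subst s S (form1 P Q)"
    using fun_cong[OF fun_cong[OF F(2)], of 2 x] x by (simp add: d_PL_def rep_ls_def square_form_def S_def)
  define \<mu> where "\<mu> = dt_coeff (form_subst s T ?f) {}"
  have \<mu>: "monoform \<mu> {} = form_subst s T ?f"
    unfolding \<mu>_def by (rule degree0D[symmetric, OF degree0_form_subst[OF f(1)]])
  have "{1..2} = {1, 2 :: nat}" by auto
  then have "vars_in {1, 2} (dt_coeff ?f {})"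
    using f A_PL_degree0 by metis
  then have "vars_in {1, 2} \<mu>"
    unfolding \<mu>_def by (intro vars_in_form_subst f) (auto simp: T_def intro: vars_in_diff vars_in_var)
  moreover have "lookup \<mu> c \<in> U" for c
    unfolding \<mu>_def lookup_dt_coeff using f(2) by (intro form_subst_in_subspace subspace) (simp add: A_PL_def del: split_paired_All)
  ultimately have \<mu>U: "\<mu> \<in> square_polys U"
    by (simp add: square_polys_iff)
  have TS: "poly_subst T (S i) = var i" if "i \<in> {1, 2}" for i
  proof -
    have "S 1 = var 1 + var 2" "S 2 = var 2"
      by (auto simp: S_def square_coord_def x_def bary_def)
    then show ?thesis
      using that by (auto simp: additive.add[OF additive_poly_subst] poly_subst_var T_def)
  qed
  have PQ: "keys b \<subseteq> {1, 2} \<and> (\<exists>i\<in>{1, 2}. I = {i})" if "(b, I) \<in> keys (form1 P Q)" for b I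
    using that assms(1,2)
    by (auto simp: form1_def square_polys_def in_keys_iff lookup_add lookup_monoform when_def split: if_splits)
  have "ext_deriv s (monoform \<mu> {}) = form_subst s T (form_subst s S (form1 P Q))"
    by (simp add: \<mu> ext_deriv_form_subst f df)
  also have "\<dots> = form1 P Q"
    by (rule form_subst_left_inverse[OF PQ TS])
  finally have eq: "form1 (poly_deriv s 1 \<mu>) (poly_deriv s 2 \<mu>) = form1 P Q"
    by (simp add: ext_deriv_square_poly[OF \<mu>U])
  have "poly_deriv s 1 \<mu> = P" "poly_deriv s 2 \<mu> = Q"
    using arg_cong[OF eq, of "\<lambda>\<omega>. dt_coeff \<omega> {1}"] arg_cong[OF eq, of "\<lambda>\<omega>. dt_coeff \<omega> {2}"]
    by (simp_all add: form1_def additive.add[OF additive_dt_coeff] dt_coeff_monoform)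
  moreover have "lookup \<mu> 0 = 0"
  proof -
    interpret F: vector_space "(*) :: 'k \<Rightarrow> _" by (rule vector_space_field)
    have "poly_eval (*) (T i) (\<lambda>_. 0) = 0" for i
      by (simp add: T_def poly_eval_var additive.diff[OF F.additive_poly_eval])
    then have "form_val s (form_subst s T ?f) (\<lambda>_. 0) = form_val s ?f (\<lambda>_. 0)"
      by (simp add: form_val_subst f)
    then show ?thesis
      using f(3) by (simp add: form_val_origin \<mu>_def)
  qed
  ultimately show "\<exists>\<mu>. \<mu> \<in> square_polys U \<and> poly_deriv s 1 \<mu> = P \<and> poly_deriv s 2 \<mu> = Q \<and> lookup \<mu> 0 = 0"
    using \<mu>U by blast
next
  fix \<mu> \<nu>
  assume "\<mu> \<in> square_polys U \<and> poly_deriv s 1 \<mu> = P \<and> poly_deriv s 2 \<mu> = Q \<and> lookup \<mu> 0 = 0"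
    "\<nu> \<in> square_polys U \<and> poly_deriv s 1 \<nu> = P \<and> poly_deriv s 2 \<nu> = Q \<and> lookup \<nu> 0 = 0"
  then show "\<mu> = \<nu>"
    by (intro primitive_unique[OF vector_space_axioms]) (simp_all add: ext_deriv_square_poly)
qed

end

section \<open>Integer powers of commuting bijections\<close>

definition zpow :: "('a \<Rightarrow> 'a) \<Rightarrow> int \<Rightarrow> 'a \<Rightarrow> 'a" where
  "zpow f k = (if 0 \<le> k then f ^^ nat k else inv f ^^ nat (- k))"

lemma zpow_0 [simp]: "zpow f 0 = id"
  by (simp add: zpow_def)

lemma zpow_1 [simp]: "zpow f 1 = f"
  by (simp add: zpow_def)

lemma zpow_Suc:
  assumes "bij f"
  shows "zpow f (k + 1) = f \<circ> zpow f k"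
proof (cases "0 \<le> k")
  case True
  then show ?thesis by (simp add: zpow_def nat_add_distrib)
next
  case False
  then obtain m where m: "nat (- k) = Suc m"
    by (metis gr0_implies_Suc neg_0_less_iff_less not_le zero_less_nat_eq)
  have "f \<circ> (inv f \<circ> (inv f ^^ m)) = inv f ^^ m"
    using assms by (simp add: fun_eq_iff bij_is_surj surj_f_inv_f)
  moreover have "zpow f (k + 1) = inv f ^^ m"
    using False m by (cases "k = - 1") (auto simp: zpow_def nat_diff_distrib)
  ultimately show ?thesis
    using False m by (simp add: zpow_def)
qed

lemma zpow_pred:
  assumes "bij f"
  shows "zpow f (k - 1) = inv f \<circ> zpow f k"
  using zpow_Suc[OF assms, of "k - 1"] assms by (simp add: fun_eq_iff bij_is_inj)

lemma zpow_add:
  assumes "bij f"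
  shows "zpow f (j + k) = zpow f j \<circ> zpow f k"
proof (induction j rule: int_induct[where k = 0])
  case (step1 i)
  then show ?case
    using zpow_Suc[OF assms, of "i + k"] zpow_Suc[OF assms, of i] by (simp add: add.assoc add.commute[of 1] comp_assoc)
next
  case (step2 i)
  have "i - 1 + k = i + k - 1" by simp
  then have "zpow f (i - 1 + k) = inv f \<circ> zpow f (i + k)"
    by (simp only: zpow_pred[OF assms])
  then show ?case
    by (simp only: zpow_pred[OF assms] step2 comp_assoc)
qed simp

text \<open>
  This is stated for arbitrary \<open>g\<close>, so that it can be applied first to \<open>f\<close> and \<open>g\<close> and then to \<open>g\<close> and a
  power of \<open>f\<close>.
\<close>

lemma zpow_commute:
  assumes "bij f" "f \<circ> g = g \<circ> f"
  shows "zpow f k \<circ> g = g \<circ> zpow f k"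
proof (induction k rule: int_induct[where k = 0])
  case (step1 i)
  have "zpow f (i + 1) \<circ> g = f \<circ> (zpow f i \<circ> g)"
    by (simp only: zpow_Suc[OF assms(1)] comp_assoc)
  also have "\<dots> = (f \<circ> g) \<circ> zpow f i"
    by (simp only: step1(2) comp_assoc)
  also have "\<dots> = g \<circ> zpow f (i + 1)"
    by (simp only: assms(2) zpow_Suc[OF assms(1)] comp_assoc)
  finally show ?case .
next
  case (step2 i)
  have inv: "inv f \<circ> g = g \<circ> inv f"
  proof
    fix x
    have "f (g (inv f x)) = g x"
      using fun_cong[OF assms(2), of "inv f x"] assms(1) by (simp add: bij_is_surj surj_f_inv_f)
    then show "(inv f \<circ> g) x = (g \<circ> inv f) x"
      using assms(1) by (metis bij_is_inj comp_apply inv_f_f)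
  qed
  have "zpow f (i - 1) \<circ> g = inv f \<circ> (zpow f i \<circ> g)"
    by (simp only: zpow_pred[OF assms(1)] comp_assoc)
  also have "\<dots> = (inv f \<circ> g) \<circ> zpow f i"
    by (simp only: step2(2) comp_assoc)
  also have "\<dots> = g \<circ> zpow f (i - 1)"
    by (simp only: inv zpow_pred[OF assms(1)] comp_assoc)
  finally show ?case .
qed simp

lemma linear_zpow:
  assumes "Vector_Spaces.linear s s f" "bij f"
  shows "Vector_Spaces.linear s s (zpow f k)"
proof -
  interpret vector_space s
    using linear_vector_space[OF assms(1)] by simp
  have inv: "Vector_Spaces.linear s s (inv f)"
    using assms by (simp flip: module_hom_iff_linear add: bij_module_hom_imp_inv_module_hom)
  show ?thesis
  proof (induction k rule: int_induct[where k = 0])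
    case base
    show ?case unfolding zpow_0 by (rule linear_id)
  next
    case (step1 i)
    then show ?case
      unfolding zpow_Suc[OF assms(2)] by (intro Vector_Spaces.linear_compose[OF _ assms(1)])
  next
    case (step2 i)
    then show ?case
      unfolding zpow_pred[OF assms(2)] by (intro Vector_Spaces.linear_compose[OF _ inv])
  qed
qed

lemma commuting_pair_action:
  assumes "bij f" "bij g" "f \<circ> g = g \<circ> f" "Vector_Spaces.linear s s f" "Vector_Spaces.linear s s g"
  obtains A :: "int \<times> int \<Rightarrow> 'a::ab_group_add \<Rightarrow> 'a"
  where "A 0 = id" "\<And>x y. A (x + y) = A x \<circ> A y" "A (1, 0) = f" "A (0, 1) = g"
    "\<And>x. Vector_Spaces.linear s s (A x)"
proof
  define A where "A x = zpow f (fst x) \<circ> zpow g (snd x)" for x :: "int \<times> int"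
  show "A 0 = id" "A (1, 0) = f" "A (0, 1) = g"
    by (simp_all add: A_def)
  show "Vector_Spaces.linear s s (A x)" for x
    unfolding A_def by (rule Vector_Spaces.linear_compose[OF linear_zpow[OF assms(5,2)] linear_zpow[OF assms(4,1)]])
  fix x y :: "int \<times> int"
  have "g \<circ> zpow f (fst y) = zpow f (fst y) \<circ> g"
    by (rule zpow_commute[OF assms(1,3), symmetric])
  then have comm: "zpow g (snd x) \<circ> zpow f (fst y) = zpow f (fst y) \<circ> zpow g (snd x)"
    by (rule zpow_commute[OF assms(2)])
  have "A (x + y) = zpow f (fst x) \<circ> (zpow f (fst y) \<circ> zpow g (snd x)) \<circ> zpow g (snd y)"
    by (simp only: A_def zpow_add[OF assms(1)] zpow_add[OF assms(2)] fst_add snd_add comp_assoc)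
  also have "\<dots> = A x \<circ> A y"
    by (simp only: A_def comm[symmetric] comp_assoc)
  finally show "A (x + y) = A x \<circ> A y" .
qed

section \<open>Local systems of homomorphisms\<close>

lemma is_rep_linear: "is_rep A \<Longrightarrow> Vector_Spaces.linear (scal A) (scal A) (act A g)"
  unfolding is_rep_def by blast

lemma is_rep_vector_space: "is_rep A \<Longrightarrow> vector_space (scal A)"
  using is_rep_linear linear_vector_space by blast

lemma is_rep_zero: "is_rep A \<Longrightarrow> act A 0 u = u"
  by (simp add: is_rep_def)

lemma is_rep_add:
  assumes "is_rep A"
  shows "act A (g + h) u = act A g (act A h u)"
proof -
  have "act A (g + h) = act A g \<circ> act A h"
    using assms unfolding is_rep_def by blast
  then show ?thesis by simp
qed

lemma is_rep_inverse:
  assumes "is_rep A"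
  shows "act A g (act A (- g) u) = u" "act A (- g) (act A g u) = u"
  using is_rep_add[OF assms, of g "- g"] is_rep_add[OF assms, of "- g" g] by (simp_all add: is_rep_zero[OF assms])

lemma is_rep_additive: "is_rep A \<Longrightarrow> additive (act A g)"
  by (rule linear_additive[OF is_rep_linear])

lemma Lin_additive: "f \<in> Lin A B \<Longrightarrow> additive f"
  by (simp add: Lin_def linear_additive)

lemma Lin_iff:
  assumes "vector_space (scal A)" "vector_space (scal B)"
  shows "f \<in> Lin A B \<longleftrightarrow> additive f \<and> (\<forall>c u. f (scal A c u) = scal B c (f u))"
  using assms by (auto simp: Lin_def Vector_Spaces.linear_iff additive_def)

lemma torus_action_Hom:
  fixes A :: "('k::field_char_0, 'v::ab_group_add) rep" and B :: "('k, 'w::ab_group_add) rep"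
  assumes "is_rep A" "is_rep B"
  shows "torus_action (Lin_scale B) (Lin A B) (\<lambda>g f. act B g \<circ> f \<circ> act A (- g))"
proof -
  interpret vector_space "Lin_scale B :: 'k \<Rightarrow> ('v \<Rightarrow> 'w) \<Rightarrow> _"
    by (rule Lin_scale_vector_space[OF is_rep_vector_space[OF assms(2)]])
  have Lin: "local_system torus (Hom_ls A B)"
    by (rule local_system_Hom_ls[OF assms])
  show ?thesis
  proof (intro torus_action.intro torus_action_axioms.intro vector_space_axioms)
    have "({}, {}) \<in> simps torus 0"
      by (auto simp: torus_def circle_simps_def)
    then show "subspace (Lin A B)"
      using Lin unfolding local_system_def Hom_ls_def rep_ls_def by auto
    fix g h :: "int \<times> int" and f :: "'v \<Rightarrow> 'w"
    show "Vector_Spaces.linear (Lin_scale B) (Lin_scale B) (\<lambda>f. act B g \<circ> f \<circ> act A (- g))"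
      using is_rep_linear[OF assms(2), of g] vector_space_axioms
      by (auto simp: Vector_Spaces.linear_iff Lin_scale_def fun_eq_iff)
    show "f \<in> Lin A B \<Longrightarrow> act B g \<circ> f \<circ> act A (- g) \<in> Lin A B"
      unfolding Lin_def mem_Collect_eq
      by (intro Vector_Spaces.linear_compose[OF is_rep_linear[OF assms(1)]]
          Vector_Spaces.linear_compose[OF _ is_rep_linear[OF assms(2)]])
    show "act B 0 \<circ> f \<circ> act A (- 0) = f"
      using assms by (simp add: fun_eq_iff is_rep_zero)
    show "act B (g + h) \<circ> f \<circ> act A (- (g + h)) = act B g \<circ> (act B h \<circ> f \<circ> act A (- h)) \<circ> act A (- g)"
    proof
      fix u
      have "act A (- (g + h)) u = act A (- h) (act A (- g) u)"
        using is_rep_add[OF assms(1), of "- h" "- g" u] by (simp only: minus_add add.commute)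
      then show "(act B (g + h) \<circ> f \<circ> act A (- (g + h))) u = (act B g \<circ> (act B h \<circ> f \<circ> act A (- h)) \<circ> act A (- g)) u"
        by (simp only: comp_apply is_rep_add[OF assms(2)])
    qed
  qed
qed

section \<open>Extensions with a block triangular action\<close>

text \<open>
  A representation on \<open>V' \<oplus> V\<close> whose action is known in block form at the four corners of the square
  only: the systems of homomorphisms involve only the action of corners and of their inverses.
\<close>

locale block_extension =
  fixes V :: "('k::field_char_0, 'v::ab_group_add) rep"
    and V' :: "('k, 'w::ab_group_add) rep"
    and Vt :: "('k, 'w \<times> 'v) rep"
    and E :: "int \<times> int \<Rightarrow> 'v \<Rightarrow> 'w"
  assumes V: "is_rep V" and V': "is_rep V'" and Vt: "is_rep Vt"
    and scal_Vt: "scal Vt c (w, v) = (scal V' c w, scal V c v)"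
    and E_Lin: "g \<in> {0, 1} \<times> {0, 1} \<Longrightarrow> E g \<in> Lin V V'"
    and act_Vt: "g \<in> {0, 1} \<times> {0, 1} \<Longrightarrow> act Vt g (w, v) = (act V' g w - act V' g (E g v), act V g v)"
begin

sublocale hom: torus_action "Lin_scale V'" "Lin V V'" "\<lambda>g f. act V' g \<circ> f \<circ> act V (- g)"
  by (rule torus_action_Hom[OF V V'])

sublocale row: torus_action "Lin_scale V'" "Lin Vt V'" "\<lambda>g f. act V' g \<circ> f \<circ> act Vt (- g)"
  by (rule torus_action_Hom[OF Vt V'])

sublocale col: torus_action "Lin_scale Vt" "Lin V Vt" "\<lambda>g f. act Vt g \<circ> f \<circ> act V (- g)"
  by (rule torus_action_Hom[OF V Vt])

lemma act_Vt_uminus: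
  assumes "g \<in> {0, 1} \<times> {0, 1}"
  shows "act Vt (- g) (w, v) = (act V' (- g) w + E g (act V (- g) v), act V (- g) v)"
proof -
  let ?u = "(act V' (- g) w + E g (act V (- g) v), act V (- g) v)"
  have "act Vt g ?u = (w, v)"
    using act_Vt[OF assms] by (simp add: additive.add[OF is_rep_additive[OF V']] is_rep_inverse V V')
  then show ?thesis
    using is_rep_inverse(2)[OF Vt, of g ?u] by simp
qed

text \<open>
  A quasi-periodic family enters a splitting as \<open>-F\<close> in a row and as \<open>F\<close> in a column.
\<close>

definition rowmap :: "('v \<Rightarrow> 'w) \<Rightarrow> ('w \<times> 'v \<Rightarrow> 'w)" where
  "rowmap f = row 0 (- f)"

definition colmap :: "('v \<Rightarrow> 'w) \<Rightarrow> ('v \<Rightarrow> 'w \<times> 'v)" where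
  "colmap f = col f 0"

lemma rowmap_apply [simp]: "rowmap f (w, v) = - f v"
  by (simp add: rowmap_def row_def)

lemma colmap_apply [simp]: "colmap f v = (f v, 0)"
  by (simp add: colmap_def col_def)

lemma vector_spaces: "vector_space (scal V)" "vector_space (scal V')" "vector_space (scal Vt)"
  using V V' Vt by (auto intro: is_rep_vector_space)

lemma linear_rowmap: "Vector_Spaces.linear (Lin_scale V') (Lin_scale V') rowmap"
proof -
  interpret W: vector_space "scal V'" by (rule vector_spaces)
  show ?thesis
    using hom.vector_space_axioms row.vector_space_axioms
    by (auto simp: Vector_Spaces.linear_iff fun_eq_iff Lin_scale_def)
qed

lemma linear_colmap: "Vector_Spaces.linear (Lin_scale V') (Lin_scale Vt) colmap"
proof -
  interpret W: vector_space "scal V" by (rule vector_spaces)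
  show ?thesis
    using hom.vector_space_axioms col.vector_space_axioms
    by (auto simp: Vector_Spaces.linear_iff fun_eq_iff Lin_scale_def scal_Vt)
qed

lemma maps_zero [simp]: "rowmap 0 = 0" "colmap 0 = 0"
  by (auto simp: fun_eq_iff zero_prod_def)

lemma Lin_maps:
  assumes "f \<in> Lin V V'"
  shows "rowmap f \<in> Lin Vt V'" "colmap f \<in> Lin V Vt"
proof -
  interpret W: vector_space "scal V'" by (rule vector_spaces)
  interpret W0: vector_space "scal V" by (rule vector_spaces)
  show "rowmap f \<in> Lin Vt V'" "colmap f \<in> Lin V Vt"
    using assms by (auto simp: Lin_iff vector_spaces additive_def scal_Vt)
qed

lemma Lin_consts:
  "row id 0 \<in> Lin Vt V'" "col 0 id \<in> Lin V Vt" "col id 0 \<in> Lin V' Vt" "row 0 id \<in> Lin Vt V"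
proof -
  interpret W: vector_space "scal V'" by (rule vector_spaces)
  interpret W0: vector_space "scal V" by (rule vector_spaces)
  show "row id 0 \<in> Lin Vt V'" "col 0 id \<in> Lin V Vt" "col id 0 \<in> Lin V' Vt" "row 0 id \<in> Lin Vt V"
    by (auto simp: Lin_iff vector_spaces additive_def scal_Vt row_def col_def)
qed

definition row_cochain :: "('v, 'w) cochain \<Rightarrow> ('w \<times> 'v, 'w) cochain" where
  "row_cochain F = (\<lambda>n x. if x \<in> simps torus n
     then single (0, {}) (row id 0) + Poly_Mapping.map rowmap (F n x) else 0)"

definition col_cochain :: "('v, 'w) cochain \<Rightarrow> ('v, 'w \<times> 'v) cochain" where
  "col_cochain F = (\<lambda>n x. if x \<in> simps torus n
     then single (0, {}) (col 0 id) + Poly_Mapping.map colmap (F n x) else 0)"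

lemma path_elt_unit: "path_elt v x \<in> {0, 1} \<times> {0, 1}"
  by (auto simp: path_elt_def)

text \<open>
  Multiplying out \<open>r'\<^sub>g [id, -F]\<close> and the inverse of the block matrix of \<open>g\<close> gives
  \<open>[id, -g \<cdot> (F - E g)]\<close>, so that compatibility of the row is the quasi-periodicity of \<open>F\<close>.
\<close>

lemma row_cochain_in_C_PL:
  assumes "hom.quasi_periodic F E"
  shows "row_cochain F \<in> C_PL torus (Hom_ls Vt V') 0"
proof -
  note F = hom.quasi_periodicD(2)[OF assms]
  note Z = hom.zero_cochainD[OF hom.quasi_periodicD(1)[OF assms]]
  have 0: "0 \<in> Lin Vt V'"
    by (rule row.subspace_0[OF row.subspace])
  have "single (0, {}) (row id 0) + Poly_Mapping.map rowmap (F n x) \<in> A_PL n (Lin Vt V')" if x: "x \<in> simps torus n" for n x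
    by (intro row.A_PL_add const_A_PL Lin_consts 0 map_A_PL[where h = rowmap, OF Z(2)[OF x] maps_zero(1)] Lin_maps(1))
  then have "row.zero_cochain (row_cochain F)"
    unfolding row.zero_cochain_def row_cochain_def using Z(3)
    by (simp add: degree0_add degree0_map)
  moreover have "row_cochain F m (pull torus m n \<theta> x) =
      Poly_Mapping.map (\<lambda>f. act V' (path_elt (\<theta> 0) x) \<circ> f \<circ> act Vt (- path_elt (\<theta> 0) x))
       (form_subst (Lin_scale V') (bary_pull m \<theta>) (row_cochain F n x) - single (0, {}) 0)" (is "_ = ?R")
    if \<theta>: "simplicial_op m n \<theta>" and x: "x \<in> simps torus n" for m n \<theta> x
  proof (rule poly_mapping_eqI)
    fix k
    define g where "g = path_elt (\<theta> 0) x"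
    define f where "f = lookup (form_subst (Lin_scale V') (bary_pull m \<theta>) (F n x)) k"
    have g: "g \<in> {0, 1} \<times> {0, 1}"
      unfolding g_def by (rule path_elt_unit)
    have z: "(\<lambda>f. act V' g \<circ> f \<circ> act V (- g)) 0 = 0" "(\<lambda>f. act V' g \<circ> f \<circ> act Vt (- g)) 0 = 0"
      using hom.act_0[of g] row.act_0[of g] by auto
    have rhs: "lookup (form_subst (Lin_scale V') (bary_pull m \<theta>) (row_cochain F n x)) k =
        (row id 0 when k = (0, {})) + rowmap f"
      using x by (simp add: row_cochain_def additive.add[OF row.additive_form_subst] form_subst_map[OF linear_rowmap]
          lookup_add lookup_single f_def when_def)
    have lhs: "lookup (row_cochain F m (pull torus m n \<theta> x)) k =
        (row id 0 when k = (0, {})) + rowmap (act V' g \<circ> (f - (E g when k = (0, {}))) \<circ> act V (- g))"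
      using pull_torus[OF \<theta> x] z
      by (simp add: row_cochain_def F[OF \<theta> x] lookup_add lookup_single lookup_minus f_def when_def flip: g_def)
    show "lookup (row_cochain F m (pull torus m n \<theta> x)) k = lookup ?R k"
      unfolding lhs g_def[symmetric] using z
      by (auto simp: rhs fun_eq_iff when_def row_def act_Vt_uminus[OF g] is_rep_inverse V V' additive.add[OF is_rep_additive[OF V']]
         additive.diff[OF is_rep_additive[OF V']] additive.minus[OF is_rep_additive[OF V']])
  qed
  ultimately have "row.quasi_periodic (row_cochain F) (\<lambda>_. 0)"
    by (simp add: row.quasi_periodic_def)
  then show ?thesis
    by (simp add: row.quasi_periodic_zero_iff Hom_ls_def)
qed

lemma col_cochain_in_C_PL:
  assumes "hom.quasi_periodic F E"
  shows "col_cochain F \<in> C_PL torus (Hom_ls V Vt) 0"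
proof -
  note F = hom.quasi_periodicD(2)[OF assms]
  note Z = hom.zero_cochainD[OF hom.quasi_periodicD(1)[OF assms]]
  have 0: "0 \<in> Lin V Vt"
    by (rule col.subspace_0[OF col.subspace])
  have "single (0, {}) (col 0 id) + Poly_Mapping.map colmap (F n x) \<in> A_PL n (Lin V Vt)" if x: "x \<in> simps torus n" for n x
    by (intro col.A_PL_add const_A_PL Lin_consts 0 map_A_PL[where h = colmap, OF Z(2)[OF x] maps_zero(2)] Lin_maps(2))
  then have "col.zero_cochain (col_cochain F)"
    unfolding col.zero_cochain_def col_cochain_def using Z(3)
    by (simp add: degree0_add degree0_map)
  moreover have "col_cochain F m (pull torus m n \<theta> x) =
      Poly_Mapping.map (\<lambda>f. act Vt (path_elt (\<theta> 0) x) \<circ> f \<circ> act V (- path_elt (\<theta> 0) x))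
       (form_subst (Lin_scale Vt) (bary_pull m \<theta>) (col_cochain F n x) - single (0, {}) 0)" (is "_ = ?R")
    if \<theta>: "simplicial_op m n \<theta>" and x: "x \<in> simps torus n" for m n \<theta> x
  proof (rule poly_mapping_eqI)
    fix k
    define g where "g = path_elt (\<theta> 0) x"
    define f where "f = lookup (form_subst (Lin_scale V') (bary_pull m \<theta>) (F n x)) k"
    have g: "g \<in> {0, 1} \<times> {0, 1}"
      unfolding g_def by (rule path_elt_unit)
    have z: "(\<lambda>f. act V' g \<circ> f \<circ> act V (- g)) 0 = 0" "(\<lambda>f. act Vt g \<circ> f \<circ> act V (- g)) 0 = 0"
      using hom.act_0[of g] col.act_0[of g] by auto
    have rhs: "lookup (form_subst (Lin_scale Vt) (bary_pull m \<theta>) (col_cochain F n x)) k =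
        (col 0 id when k = (0, {})) + colmap f"
      using x by (simp add: col_cochain_def additive.add[OF col.additive_form_subst] form_subst_map[OF linear_colmap]
          lookup_add lookup_single f_def when_def)
    have lhs: "lookup (col_cochain F m (pull torus m n \<theta> x)) k =
        (col 0 id when k = (0, {})) + colmap (act V' g \<circ> (f - (E g when k = (0, {}))) \<circ> act V (- g))"
      using pull_torus[OF \<theta> x] z
      by (simp add: col_cochain_def F[OF \<theta> x] lookup_add lookup_single lookup_minus f_def when_def flip: g_def)
    show "lookup (col_cochain F m (pull torus m n \<theta> x)) k = lookup ?R k"
      unfolding lhs g_def[symmetric] using z
      by (auto simp: rhs fun_eq_iff when_def col_def act_Vt[OF g] is_rep_inverse V V' additive.zero[OF is_rep_additive[OF V]]
         additive.zero[OF Lin_additive[OF E_Lin[OF g]]]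
         additive.diff[OF is_rep_additive[OF V']] additive.zero[OF is_rep_additive[OF V']])
  qed
  ultimately have "col.quasi_periodic (col_cochain F) (\<lambda>_. 0)"
    by (simp add: col.quasi_periodic_def)
  then show ?thesis
    by (simp add: col.quasi_periodic_zero_iff Hom_ls_def)
qed

end

section \<open>Splittings\<close>

lemma wedge_eq_zero:
  assumes "\<And>k l. B (lookup \<omega> k) (lookup \<eta> l) = 0"
  shows "wedge B \<omega> \<eta> = 0"
  by (simp add: wedge_def assms cong: if_cong)

lemma col_apply: "col f g u = (f u, g u)"
  by (simp add: col_def)

lemma row_apply: "row f g (w, v) = f w + g v"
  by (simp add: row_def)

lemma zero_comp [simp]: "(0 :: 'b \<Rightarrow> 'c::zero) \<circ> f = 0"
  by (simp add: fun_eq_iff)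

lemma additive_comp_left: "additive (\<lambda>u :: 'b \<Rightarrow> 'c::ab_group_add. u \<circ> f)"
  by (simp add: additive_def fun_eq_iff)

lemma additive_comp_right: "additive f \<Longrightarrow> additive ((\<circ>) f :: ('a \<Rightarrow> 'b::ab_group_add) \<Rightarrow> 'a \<Rightarrow> 'c::ab_group_add)"
  by (simp add: additive_def fun_eq_iff)

lemma T_const_single: "T_const f = (\<lambda>n x. if x \<in> simps torus n then single (0, {}) f else 0)"
  by (simp add: T_const_def cong: if_cong)

lemma (in torus_action) const_in_C_PL:
  assumes "c \<in> U" "\<And>g. g \<in> {0, 1} \<times> {0, 1} \<Longrightarrow> a g c = c"
  shows "(\<lambda>n x. if x \<in> simps torus n then single (0, {}) c else 0) \<in> C_PL torus L 0"
proof -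
  have "(single (0, {}) c :: 'l form) \<in> A_PL n U" for n
    using assms(1) subspace_0[OF subspace] by (auto simp: A_PL_def lookup_single when_def)
  moreover have "a (path_elt v x) c = c" for v x
    by (rule assms(2)) (auto simp: path_elt_def)
  ultimately have "quasi_periodic (\<lambda>n x. if x \<in> simps torus n then single (0, {}) c else 0) (\<lambda>_. 0)"
    unfolding quasi_periodic_def zero_cochain_def
    by (simp add: pull_torus del: split_paired_All)
  then show ?thesis
    by (simp add: quasi_periodic_zero_iff)
qed

lemma T_d_const:
  fixes A :: "('k::field, 'v::ab_group_add) rep" and B :: "('k, 'w::ab_group_add) rep"
  assumes "is_rep B"
  shows "T_d A B (T_const f) = 0"
proof -
  interpret vector_space "Lin_scale B :: 'k \<Rightarrow> ('v \<Rightarrow> 'w) \<Rightarrow> _"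
    by (rule Lin_scale_vector_space[OF is_rep_vector_space[OF assms]])
  show ?thesis
    by (simp add: fun_eq_iff T_d_def d_PL_def Hom_ls_def rep_ls_def T_const_single additive.zero[OF additive_ext_deriv])
qed

context block_extension
begin

abbreviation incl :: "('w, 'w \<times> 'v) cochain" where "incl \<equiv> T_const (col id 0)"
abbreviation proj :: "('w \<times> 'v, 'v) cochain" where "proj \<equiv> T_const (row 0 id)"

lemma incl_in_T_hom: "incl \<in> T_hom V' Vt 0"
proof -
  interpret T: torus_action "Lin_scale Vt" "Lin V' Vt" "\<lambda>g f. act Vt g \<circ> f \<circ> act V' (- g)"
    by (rule torus_action_Hom[OF V' Vt])
  have "act Vt g \<circ> col id 0 \<circ> act V' (- g) = col id 0" if g: "g \<in> {0, 1} \<times> {0, 1}" for g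
    by (auto simp: fun_eq_iff col_def act_Vt[OF g] is_rep_inverse V' additive.zero[OF is_rep_additive[OF V]]
       additive.zero[OF is_rep_additive[OF V']] additive.zero[OF Lin_additive[OF E_Lin[OF g]]])
  then show ?thesis
    using T.const_in_C_PL[OF Lin_consts(3)] by (simp add: T_hom_def Hom_ls_def T_const_single)
qed

lemma proj_in_T_hom: "proj \<in> T_hom Vt V 0"
proof -
  interpret T: torus_action "Lin_scale V" "Lin Vt V" "\<lambda>g f. act V g \<circ> f \<circ> act Vt (- g)"
    by (rule torus_action_Hom[OF Vt V])
  have "act V g \<circ> row 0 id \<circ> act Vt (- g) = row 0 id" if g: "g \<in> {0, 1} \<times> {0, 1}" for g
    by (auto simp: fun_eq_iff row_def act_Vt_uminus[OF g] is_rep_inverse V)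
  then show ?thesis
    using T.const_in_C_PL[OF Lin_consts(4)] by (simp add: T_hom_def Hom_ls_def T_const_single)
qed

lemma coefficient_additive:
  assumes "hom.zero_cochain F"
  shows "additive (lookup (F n x) k)"
proof (cases "x \<in> simps torus n")
  case True
  then have "lookup (F n x) k \<in> Lin V V'"
    using hom.zero_cochainD(2)[OF assms True] unfolding A_PL_def by blast
  then show ?thesis by (rule Lin_additive)
next
  case False
  then show ?thesis
    by (simp add: hom.zero_cochainD(1)[OF assms] additive_def)
qed

lemma rowmap_colmap: "additive f \<Longrightarrow> rowmap f \<circ> colmap g = 0"
  by (simp add: fun_eq_iff additive.zero)

lemma comp_row_col:
  assumes "\<And>k. additive (lookup f k)"
  shows "wedge (\<circ>) (single (0, {}) (row id 0) + Poly_Mapping.map rowmap f)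
     (single (0, {}) (col 0 id) + Poly_Mapping.map colmap f) = 0"
proof -
  let ?A = "single (0, {}) (row id 0) :: ('w \<times> 'v \<Rightarrow> 'w) form" and ?B = "single (0, {}) (col 0 id) :: ('v \<Rightarrow> 'w \<times> 'v) form"
  let ?R = "Poly_Mapping.map rowmap f" and ?C = "Poly_Mapping.map colmap f"
  have "additive (rowmap (lookup f k))" for k
    using assms[of k] by (auto simp: additive_def)
  then have "wedge (\<circ>) ?R (?B + ?C) = wedge (\<circ>) ?R ?B + wedge (\<circ>) ?R ?C"
    by (intro additive.add[OF additive_wedge_right]) (simp add: additive_comp_right)
  moreover have "wedge (\<circ>) ?R ?C = 0"
    by (rule wedge_eq_zero) (simp add: rowmap_colmap assms)
  moreover have "wedge (\<circ>) ?R ?B = Poly_Mapping.map (\<lambda>u. u \<circ> col 0 id) ?R"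
    by (rule wedge_const_right) (auto simp: fun_eq_iff additive.zero[OF assms] zero_prod_def)
  ultimately have 1: "wedge (\<circ>) ?R (?B + ?C) = Poly_Mapping.map (\<lambda>u. u \<circ> col 0 id) ?R"
    by (simp only: add_0_right)
  have 2: "wedge (\<circ>) ?A (?B + ?C) = Poly_Mapping.map ((\<circ>) (row id 0)) (?B + ?C)"
    by (rule wedge_const_left) simp
  have "wedge (\<circ>) (?A + ?R) (?B + ?C) = wedge (\<circ>) ?A (?B + ?C) + wedge (\<circ>) ?R (?B + ?C)"
    by (rule additive.add[OF additive_wedge_left]) (rule additive_comp_left)
  also have "\<dots> = 0"
  proof (rule poly_mapping_eqI)
    fix k
    have "row id 0 \<circ> (0 :: 'v \<Rightarrow> 'w \<times> 'v) = 0"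
      by (simp add: fun_eq_iff row_def zero_prod_def)
    then show "lookup (wedge (\<circ>) ?A (?B + ?C) + wedge (\<circ>) ?R (?B + ?C)) k = lookup 0 k"
      unfolding 1 2 by (auto simp: lookup_add lookup_single when_def fun_eq_iff row_def col_def)
  qed
  finally show ?thesis .
qed

lemma row_col_splitting:
  assumes "hom.quasi_periodic F E"
  shows "is_splitting V' Vt V incl proj (row_cochain F) (col_cochain F)"
proof -
  have Z: "hom.zero_cochain F"
    using assms by (simp add: hom.quasi_periodic_def)
  note add = coefficient_additive[OF Z]
  have "T_comp (row_cochain F) (col_cochain F) = 0"
    by (simp add: fun_eq_iff T_comp_def row_cochain_def col_cochain_def comp_row_col[OF add])
  moreover have "T_comp (row_cochain F) incl = T_id"
  proof (intro ext)
    fix n x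
    show "T_comp (row_cochain F) incl n x = T_id n x"
    proof (cases "x \<in> simps torus n")
      case True
      let ?\<alpha> = "single (0, {}) (row id 0) + Poly_Mapping.map rowmap (F n x)"
      have "wedge (\<circ>) ?\<alpha> (single (0, {}) (col id 0)) = Poly_Mapping.map (\<lambda>u. u \<circ> col id 0) ?\<alpha>"
        by (rule wedge_const_right)
          (auto simp: fun_eq_iff lookup_add lookup_single when_def additive.zero[OF add] zero_prod_def row_def)
      also have "\<dots> = single (0, {}) id"
        by (rule poly_mapping_eqI)
          (auto simp: fun_eq_iff lookup_add lookup_single when_def additive.zero[OF add] row_def col_def)
      finally show ?thesis
        using True by (simp add: T_comp_def T_id_def T_const_single row_cochain_def)
    qed (simp add: T_comp_def T_id_def T_const_single)
  qed
  moreover have "T_comp proj (col_cochain F) = T_id"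
  proof (intro ext)
    fix n x
    show "T_comp proj (col_cochain F) n x = T_id n x"
    proof (cases "x \<in> simps torus n")
      case True
      let ?\<beta> = "single (0, {}) (col 0 id) + Poly_Mapping.map colmap (F n x)"
      have "row 0 id \<circ> (0 :: 'v \<Rightarrow> 'w \<times> 'v) = 0"
        by (simp add: fun_eq_iff row_def zero_prod_def)
      moreover have "wedge (\<circ>) (single (0, {}) (row 0 id)) ?\<beta> = Poly_Mapping.map ((\<circ>) (row 0 id)) ?\<beta>"
        by (rule wedge_const_left) simp
      moreover have "Poly_Mapping.map ((\<circ>) (row 0 id)) ?\<beta> = single (0, {}) id"
        using calculation(1) by (intro poly_mapping_eqI)
          (auto simp: fun_eq_iff lookup_add lookup_single when_def row_def col_def)
      ultimately show ?thesis
        using True by (simp add: T_comp_def T_id_def T_const_single col_cochain_def)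
    qed (simp add: T_comp_def T_id_def T_const_single)
  qed
  moreover have "T_comp incl (row_cochain F) + T_comp (col_cochain F) proj = T_id"
  proof (intro ext)
    fix n x
    show "(T_comp incl (row_cochain F) + T_comp (col_cochain F) proj) n x = T_id n x"
    proof (cases "x \<in> simps torus n")
      case True
      let ?\<alpha> = "single (0, {}) (row id 0) + Poly_Mapping.map rowmap (F n x)"
      let ?\<beta> = "single (0, {}) (col 0 id) + Poly_Mapping.map colmap (F n x)"
      have 0: "col id 0 \<circ> (0 :: 'w \<times> 'v \<Rightarrow> 'w) = (0 :: 'w \<times> 'v \<Rightarrow> 'w \<times> 'v)"
        by (simp add: fun_eq_iff col_def zero_prod_def)
      have 1: "wedge (\<circ>) (single (0, {}) (col id 0 :: 'w \<Rightarrow> 'w \<times> 'v)) ?\<alpha> = Poly_Mapping.map ((\<circ>) (col id 0 :: 'w \<Rightarrow> 'w \<times> 'v)) ?\<alpha>"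
        by (rule wedge_const_left) simp
      have 2: "wedge (\<circ>) ?\<beta> (single (0, {}) (row 0 id :: 'w \<times> 'v \<Rightarrow> 'v)) = Poly_Mapping.map (\<lambda>u. u \<circ> (row 0 id :: 'w \<times> 'v \<Rightarrow> 'v)) ?\<beta>"
        by (rule wedge_const_right)
          (auto simp: fun_eq_iff lookup_add lookup_single when_def additive.zero[OF add] zero_prod_def col_def)
      have "Poly_Mapping.map ((\<circ>) (col id 0 :: 'w \<Rightarrow> 'w \<times> 'v)) ?\<alpha> + Poly_Mapping.map (\<lambda>u. u \<circ> (row 0 id :: 'w \<times> 'v \<Rightarrow> 'v)) ?\<beta> = single (0, {}) id"
        using 0 by (intro poly_mapping_eqI)
          (auto simp: fun_eq_iff lookup_add lookup_single when_def row_def col_def zero_prod_def)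
      then show ?thesis
        using True 1 2 by (simp add: T_comp_def T_id_def T_const_single row_cochain_def col_cochain_def)
    qed (simp add: T_comp_def T_id_def T_const_single)
  qed
  ultimately show ?thesis
    using row_cochain_in_C_PL[OF assms] col_cochain_in_C_PL[OF assms]
    by (simp add: is_splitting_def T_hom_def)
qed

lemma row_col_is_extension:
  assumes "hom.quasi_periodic F E"
  shows "is_extension V' Vt V incl proj"
proof -
  have "T_comp proj incl = 0"
  proof -
    have "wedge (\<circ>) (single (0, {}) (row 0 id)) (single (0, {}) (col id 0)) =
        Poly_Mapping.map ((\<circ>) (row 0 id)) (single (0, {}) (col id 0 :: 'w \<Rightarrow> 'w \<times> 'v) :: ('w \<Rightarrow> 'w \<times> 'v) form)"
      by (rule wedge_const_left) simp
    also have "\<dots> = (0 :: ('w \<Rightarrow> 'v) form)"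
      by (rule poly_mapping_eqI)
        (auto simp: Poly_Mapping.map.rep_eq lookup_single when_def fun_eq_iff row_def col_def)
    finally show ?thesis
      by (simp add: fun_eq_iff T_comp_def T_const_single)
  qed
  then show ?thesis
    using row_col_splitting[OF assms] incl_in_T_hom proj_in_T_hom T_d_const[OF Vt] T_d_const[OF V]
    unfolding is_extension_def by blast
qed

text \<open>
  In each coefficient, the equation \<open>p\<alpha> + \<beta>q = id\<close> expresses all entries of \<open>\<alpha>\<close> and \<open>\<beta>\<close> by
  the upper entry \<open>\<nu>\<close> of the column. That \<open>\<beta>\<close> is a cochain then means that \<open>\<nu>\<close> is quasi-periodic.
\<close>

lemma splitting_is_row_col:
  assumes "is_splitting V' Vt V incl proj \<alpha> \<beta>"
  obtains \<nu> where "hom.quasi_periodic \<nu> E" "\<alpha> = row_cochain \<nu>" "\<beta> = col_cochain \<nu>"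
proof
  define \<nu> where "\<nu> n x = Poly_Mapping.map (\<lambda>h. fst \<circ> h) (\<beta> n x)" for n x
  have z: "fst \<circ> (0 :: 'v \<Rightarrow> 'w \<times> 'v) = 0"
    by (simp add: fun_eq_iff)
  have \<nu>: "lookup (\<nu> n x) k = fst \<circ> lookup (\<beta> n x) k" for n x k
    by (simp add: \<nu>_def z)
  have \<beta>: "col.quasi_periodic \<beta> (\<lambda>_. 0)"
    using assms by (simp add: is_splitting_def T_hom_def col.quasi_periodic_zero_iff Hom_ls_def)
  have \<alpha>: "row.quasi_periodic \<alpha> (\<lambda>_. 0)"
    using assms by (simp add: is_splitting_def T_hom_def row.quasi_periodic_zero_iff Hom_ls_def)
  have Z: "col.zero_cochain \<beta>" "row.zero_cochain \<alpha>"
    using \<alpha> \<beta> by (simp_all add: col.quasi_periodic_def row.quasi_periodic_def)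
  have \<beta>Lin: "lookup (\<beta> n x) k \<in> Lin V Vt" if "x \<in> simps torus n" for n x k
    using col.zero_cochainD(2)[OF Z(1) that] unfolding A_PL_def by blast
  \<comment> \<open>\<open>p\<alpha> + \<beta>q = id\<close> in the coefficient \<open>k\<close>\<close>
  have key: "(lookup (\<alpha> n x) k (w, v), 0) + lookup (\<beta> n x) k v = (if k = (0, {}) then (w, v) else 0)"
    if x: "x \<in> simps torus n" for n x k w v
  proof -
    have 0: "col id 0 \<circ> (0 :: 'w \<times> 'v \<Rightarrow> 'w) = (0 :: 'w \<times> 'v \<Rightarrow> 'w \<times> 'v)"
      by (simp add: fun_eq_iff col_def zero_prod_def)
    have 1: "wedge (\<circ>) (single (0, {}) (col id 0 :: 'w \<Rightarrow> 'w \<times> 'v)) (\<alpha> n x) = Poly_Mapping.map ((\<circ>) (col id 0 :: 'w \<Rightarrow> 'w \<times> 'v)) (\<alpha> n x)"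
      by (rule wedge_const_left) simp
    have "lookup (\<beta> n x) k \<circ> (0 :: 'w \<times> 'v \<Rightarrow> 'v) = 0" for k
      by (simp add: fun_eq_iff additive.zero[OF Lin_additive[OF \<beta>Lin[OF x]]])
    then have 2: "wedge (\<circ>) (\<beta> n x) (single (0, {}) (row 0 id :: 'w \<times> 'v \<Rightarrow> 'v)) = Poly_Mapping.map (\<lambda>u. u \<circ> (row 0 id :: 'w \<times> 'v \<Rightarrow> 'v)) (\<beta> n x)"
      by (intro wedge_const_right) simp_all
    have "(T_comp incl \<alpha> + T_comp \<beta> proj) n x = T_id n x"
      using assms by (simp add: is_splitting_def)
    then have "Poly_Mapping.map ((\<circ>) (col id 0 :: 'w \<Rightarrow> 'w \<times> 'v)) (\<alpha> n x) + Poly_Mapping.map (\<lambda>u. u \<circ> (row 0 id :: 'w \<times> 'v \<Rightarrow> 'v)) (\<beta> n x) = single (0, {}) id"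
      using x by (simp add: T_comp_def T_id_def T_const_single 1 2)
    then have "lookup (Poly_Mapping.map ((\<circ>) (col id 0 :: 'w \<Rightarrow> 'w \<times> 'v)) (\<alpha> n x) + Poly_Mapping.map (\<lambda>u. u \<circ> (row 0 id :: 'w \<times> 'v \<Rightarrow> 'v)) (\<beta> n x)) k (w, v)
       = lookup (single (0, {}) id) k (w, v)"
      by simp
    then show ?thesis
      by (simp add: lookup_add 0 col_apply row_apply lookup_single when_def split: if_splits)
  qed
  have \<beta>_eq: "lookup (\<beta> n x) k v = (lookup (\<nu> n x) k v, if k = (0, {}) then v else 0)"
    and \<alpha>_eq: "lookup (\<alpha> n x) k (w, v) = (if k = (0, {}) then w else 0) - lookup (\<nu> n x) k v"
    if x: "x \<in> simps torus n" for n x k w v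
    using key[OF x, of k w v] by (auto simp: \<nu> prod_eq_iff zero_prod_def algebra_simps split: if_splits)
  have off: "\<nu> n x = 0" "\<alpha> n x = 0" "\<beta> n x = 0" if "x \<notin> simps torus n" for n x
    using that col.zero_cochainD(1)[OF Z(1)] row.zero_cochainD(1)[OF Z(2)] by (simp_all add: \<nu>_def)
  show \<alpha>_row: "\<alpha> = row_cochain \<nu>"
  proof (intro ext)
    fix n x
    show "\<alpha> n x = row_cochain \<nu> n x"
    proof (cases "x \<in> simps torus n")
      case True
      then show ?thesis
        by (intro poly_mapping_eqI)
          (auto simp: row_cochain_def fun_eq_iff lookup_add lookup_single when_def row_def \<alpha>_eq[OF True])
    qed (simp add: off row_cochain_def)
  qed
  show \<beta>_col: "\<beta> = col_cochain \<nu>"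
  proof (intro ext)
    fix n x
    show "\<beta> n x = col_cochain \<nu> n x"
    proof (cases "x \<in> simps torus n")
      case True
      then show ?thesis
        by (intro poly_mapping_eqI)
          (auto simp: col_cochain_def fun_eq_iff lookup_add lookup_single when_def col_def \<beta>_eq[OF True])
    qed (simp add: off col_cochain_def)
  qed
  have fst_Lin: "fst \<circ> f \<in> Lin V V'" if "f \<in> Lin V Vt" for f
  proof -
    have "fst (scal Vt c u) = scal V' c (fst u)" for c u
      by (cases u) (simp add: scal_Vt)
    then show ?thesis
      using that by (auto simp: Lin_iff vector_spaces additive_def)
  qed
  have "\<nu> n x \<in> A_PL n (Lin V V')" if "x \<in> simps torus n" for n x
    unfolding \<nu>_def by (rule map_A_PL[where h = "\<lambda>h. fst \<circ> h", OF col.zero_cochainD(2)[OF Z(1) that] z fst_Lin])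
  then have "hom.zero_cochain \<nu>"
    unfolding hom.zero_cochain_def using off
    by (simp add: \<nu>_def degree0_map z col.zero_cochainD(3)[OF Z(1)] del: split_paired_All)
  moreover have "\<nu> m (pull torus m n \<theta> x) =
      Poly_Mapping.map (\<lambda>f. act V' (path_elt (\<theta> 0) x) \<circ> f \<circ> act V (- path_elt (\<theta> 0) x))
       (form_subst (Lin_scale V') (bary_pull m \<theta>) (\<nu> n x) - single (0, {}) (E (path_elt (\<theta> 0) x)))" (is "_ = ?R")
    if \<theta>: "simplicial_op m n \<theta>" and x: "x \<in> simps torus n" for m n \<theta> x
  proof (rule poly_mapping_eqI)
    fix k
    define g where "g = path_elt (\<theta> 0) x"
    define f where "f = lookup (form_subst (Lin_scale V') (bary_pull m \<theta>) (\<nu> n x)) k"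
    have g: "g \<in> {0, 1} \<times> {0, 1}"
      unfolding g_def by (rule path_elt_unit)
    have z': "(\<lambda>f. act V' g \<circ> f \<circ> act V (- g)) 0 = 0" "(\<lambda>f. act Vt g \<circ> f \<circ> act V (- g)) 0 = 0"
      using hom.act_0[of g] col.act_0[of g] by auto
    have rhs: "lookup (form_subst (Lin_scale Vt) (bary_pull m \<theta>) (\<beta> n x)) k =
        (col 0 id when k = (0, {})) + colmap f"
      using x by (simp add: \<beta>_col col_cochain_def additive.add[OF col.additive_form_subst] form_subst_map[OF linear_colmap]
          lookup_add lookup_single f_def when_def)
    have "\<beta> m (pull torus m n \<theta> x) = Poly_Mapping.map (\<lambda>f. act Vt (path_elt (\<theta> 0) x) \<circ> f \<circ> act V (- path_elt (\<theta> 0) x))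
       (form_subst (Lin_scale Vt) (bary_pull m \<theta>) (\<beta> n x) - single (0, {}) 0)"
      using \<beta> \<theta> x unfolding col.quasi_periodic_def by blast
    then have "lookup (\<nu> m (pull torus m n \<theta> x)) k = fst \<circ> (act Vt g \<circ> ((col 0 id when k = (0, {})) + colmap f) \<circ> act V (- g))"
      using z' by (simp add: \<nu> rhs flip: g_def)
    then show "lookup (\<nu> m (pull torus m n \<theta> x)) k = lookup ?R k"
      unfolding g_def[symmetric] using z'
      by (auto simp: fun_eq_iff lookup_minus lookup_single when_def col_def act_Vt[OF g] f_def[symmetric]
         additive.zero[OF Lin_additive[OF E_Lin[OF g]]]
         additive.diff[OF is_rep_additive[OF V']] additive.zero[OF is_rep_additive[OF V']])
  qed
  ultimately show "hom.quasi_periodic \<nu> E"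
    by (simp add: hom.quasi_periodic_def)
qed

text \<open>
  The derivative of the column has entries \<open>dF\<close> and 0.
\<close>

lemma row_d_col:
  assumes "hom.quasi_periodic F E"
  shows "T_comp (row_cochain F) (T_d V Vt (col_cochain F)) = d_PL (Hom_ls V V') F"
proof (intro ext)
  fix n x
  have Z: "hom.zero_cochain F"
    using assms by (simp add: hom.quasi_periodic_def)
  note add = coefficient_additive[OF Z]
  show "T_comp (row_cochain F) (T_d V Vt (col_cochain F)) n x = d_PL (Hom_ls V V') F n x"
  proof (cases "x \<in> simps torus n")
    case True
    let ?d = "ext_deriv (Lin_scale V') (F n x)"
    have dcol: "T_d V Vt (col_cochain F) n x = Poly_Mapping.map colmap ?d"
      using True by (simp add: T_d_def d_PL_def Hom_ls_def rep_ls_def col_cochain_def additive.add[OF col.additive_ext_deriv]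
         ext_deriv_map[OF linear_colmap])
    have "wedge (\<circ>) (single (0, {}) (row id 0) + Poly_Mapping.map rowmap (F n x)) (Poly_Mapping.map colmap ?d) =
       wedge (\<circ>) (single (0, {}) (row id 0)) (Poly_Mapping.map colmap ?d) + wedge (\<circ>) (Poly_Mapping.map rowmap (F n x)) (Poly_Mapping.map colmap ?d)"
      by (rule additive.add[OF additive_wedge_left]) (rule additive_comp_left)
    moreover have "wedge (\<circ>) (Poly_Mapping.map rowmap (F n x)) (Poly_Mapping.map colmap ?d) = 0"
      by (rule wedge_eq_zero) (simp add: rowmap_colmap add)
    moreover have "wedge (\<circ>) (single (0, {}) (row id 0)) (Poly_Mapping.map colmap ?d) =
        Poly_Mapping.map ((\<circ>) (row id 0)) (Poly_Mapping.map colmap ?d)"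
      by (rule wedge_const_left) simp
    moreover have "Poly_Mapping.map ((\<circ>) (row id 0)) (Poly_Mapping.map colmap ?d) = ?d"
    proof (rule poly_mapping_eqI)
      fix k
      have "row id 0 \<circ> (0 :: 'v \<Rightarrow> 'w \<times> 'v) = 0"
        by (simp add: fun_eq_iff row_def zero_prod_def)
      then show "lookup (Poly_Mapping.map ((\<circ>) (row id 0)) (Poly_Mapping.map colmap ?d)) k = lookup ?d k"
        by (simp add: fun_eq_iff row_def)
    qed
    ultimately have "wedge (\<circ>) (single (0, {}) (row id 0) + Poly_Mapping.map rowmap (F n x)) (Poly_Mapping.map colmap ?d) = ?d"
      by (simp only: add_0_right)
    moreover have "d_PL (Hom_ls V V') F n x = ?d"
      by (simp add: d_PL_def Hom_ls_def rep_ls_def)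
    ultimately show ?thesis
      using True by (simp add: T_comp_def dcol row_cochain_def)
  next
    case False
    then show ?thesis
      by (simp add: T_comp_def row_cochain_def d_PL_def Hom_ls_def rep_ls_def hom.zero_cochainD(1)[OF Z]
         additive.zero[OF hom.additive_ext_deriv])
  qed
qed

theorem extension_class:
  assumes "hom.quasi_periodic F E"
  shows "has_extension_class V' Vt V incl proj (coh_class torus (Hom_ls V V') 1 (d_PL (Hom_ls V V') F))"
proof -
  have "T_comp \<alpha> (T_d V Vt \<beta>) \<in> cocycles torus (Hom_ls V V') 1 \<and>
      coh_class torus (Hom_ls V V') 1 (T_comp \<alpha> (T_d V Vt \<beta>)) = coh_class torus (Hom_ls V V') 1 (d_PL (Hom_ls V V') F)"
    if splitting: "is_splitting V' Vt V incl proj \<alpha> \<beta>" for \<alpha> \<beta>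
  proof -
    obtain \<nu> where \<nu>: "hom.quasi_periodic \<nu> E" "\<alpha> = row_cochain \<nu>" "\<beta> = col_cochain \<nu>"
      using splitting by (rule splitting_is_row_col)
    show ?thesis
      unfolding \<nu>(2,3) row_d_col[OF \<nu>(1)]
      using hom.d_quasi_periodic[OF \<nu>(1)] hom.coh_class_quasi_periodic[OF \<nu>(1) assms] by (simp add: Hom_ls_def)
  qed
  then show ?thesis
    using row_col_is_extension[OF assms] unfolding has_extension_class_def by blast
qed

end

section \<open>The extension defined by a potential\<close>

text \<open>
  The relations between the values of \<open>E\<close> make both products of the blocks of the generators equal to
  the block at \<open>(1,1)\<close>. Hence these blocks commute and generate an action of \<open>\<int> \<times> \<int>\<close>.
\<close>

lemma block_extension_exists:
  fixes V :: "('k::field_char_0, 'v::ab_group_add) rep" and V' :: "('k, 'w::ab_group_add) rep"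
  assumes V: "is_rep V" and V': "is_rep V'"
    and E: "E (0, 0) = 0"
      "E (0, 1) = act V' (1, 0) \<circ> (E (1, 1) - E (1, 0)) \<circ> act V (- (1, 0))"
      "E (1, 0) = act V' (0, 1) \<circ> (E (1, 1) - E (0, 1)) \<circ> act V (- (0, 1))"
    and E_Lin: "\<And>g. g \<in> {0, 1} \<times> {0, 1} \<Longrightarrow> E g \<in> Lin V V'"
  obtains Vt where "block_extension V V' Vt E" "scal Vt = module_prod.scale (scal V') (scal V)"
proof -
  define blk where "blk g = (\<lambda>(w, v). (act V' g w - act V' g (E g v), act V g v))" for g
  obtain B B' where B: "finite_dimensional_vector_space (scal V) B" "finite_dimensional_vector_space (scal V') B'"
    using V V' unfolding is_rep_def by blast
  interpret F: finite_dimensional_vector_space_prod "scal V'" "scal V" B' B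
    by (intro finite_dimensional_vector_space_prod.intro vector_space_prod.intro vector_space_pair.intro
       finite_dimensional_vector_space_pair.intro B is_rep_vector_space V V')
  let ?s = "module_prod.scale (scal V') (scal V)"
  have scale: "?s c (w, v) = (scal V' c w, scal V c v)" for c w v
    by (rule F.scale_prod)
  note addV = is_rep_additive[OF V] and addV' = is_rep_additive[OF V']
  have lin: "Vector_Spaces.linear ?s ?s (blk g)" if g: "g \<in> {0, 1} \<times> {0, 1}" for g
  proof -
    have a: "act V g (scal V c v) = scal V c (act V g v)" "act V' g (scal V' c w) = scal V' c (act V' g w)"
      "E g (scal V c v) = scal V' c (E g v)" for c v w
      using is_rep_linear[OF V] is_rep_linear[OF V'] E_Lin[OF g] by (auto simp: Lin_def Vector_Spaces.linear_iff)
    show ?thesis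
      using F.p.vector_space_axioms
      by (auto simp: Vector_Spaces.linear_iff blk_def scale a additive.diff[OF vector_space.additive_scale_right[OF is_rep_vector_space[OF V']]]
          additive.add[OF addV] additive.add[OF addV'] additive.add[OF Lin_additive[OF E_Lin[OF g]]])
  qed
  have bij: "bij (blk g)" for g
  proof (rule o_bij)
    \<comment> \<open>the inverse of a block triangular matrix\<close>
    let ?inv = "\<lambda>(w, v). (act V' (- g) w + E g (act V (- g) v), act V (- g) v)"
    show "?inv \<circ> blk g = id"
      by (auto simp: fun_eq_iff blk_def is_rep_inverse V V' additive.diff[OF addV'])
    show "blk g \<circ> ?inv = id"
      by (auto simp: fun_eq_iff blk_def is_rep_inverse V V' additive.add[OF addV'])
  qed
  have V_comm: "act V' (1, 0) (act V' (0, 1) w) = act V' (1, 1) w" "act V' (0, 1) (act V' (1, 0) w) = act V' (1, 1) w"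
    "act V (1, 0) (act V (0, 1) v) = act V (1, 1) v" "act V (0, 1) (act V (1, 0) v) = act V (1, 1) v" for v w
    by (simp_all add: V V' flip: is_rep_add)
  have E01: "E (0, 1) (act V (1, 0) v) = act V' (1, 0) (E (1, 1) v) - act V' (1, 0) (E (1, 0) v)" for v
    by (subst E(2)) (simp add: is_rep_inverse(2)[OF V] additive.diff[OF addV'] del: uminus_Pair)
  have E10: "E (1, 0) (act V (0, 1) v) = act V' (0, 1) (E (1, 1) v) - act V' (0, 1) (E (0, 1) v)" for v
    by (subst E(3)) (simp add: is_rep_inverse(2)[OF V] additive.diff[OF addV'] del: uminus_Pair)
  have blk11: "blk (1, 0) \<circ> blk (0, 1) = blk (1, 1)" "blk (0, 1) \<circ> blk (1, 0) = blk (1, 1)"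
    by (auto simp: fun_eq_iff blk_def V_comm additive.diff[OF addV'] E01 E10)
  have lins: "Vector_Spaces.linear ?s ?s (blk (1, 0))" "Vector_Spaces.linear ?s ?s (blk (0, 1))"
    by (auto intro: lin)
  have comm: "blk (1, 0) \<circ> blk (0, 1) = blk (0, 1) \<circ> blk (1, 0)"
    by (simp only: blk11)
  obtain A :: "int \<times> int \<Rightarrow> 'w \<times> 'v \<Rightarrow> 'w \<times> 'v" where A: "A 0 = id" "\<And>x y. A (x + y) = A x \<circ> A y"
      "A (1, 0) = blk (1, 0)" "A (0, 1) = blk (0, 1)" "\<And>x. Vector_Spaces.linear ?s ?s (A x)"
    using commuting_pair_action[OF bij bij comm lins] by metis
  have "A (0, 0) = blk (0, 0)"
    using A(1) by (auto simp: zero_prod_def fun_eq_iff blk_def E additive.zero[OF addV'] is_rep_zero[OF V, unfolded zero_prod_def] is_rep_zero[OF V', unfolded zero_prod_def])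
  moreover have "A (1, 1) = blk (1, 1)"
    using A(2)[of "(1, 0)" "(0, 1)"] by (simp add: A blk11)
  ultimately have A_blk: "A g = blk g" if "g \<in> {0, 1} \<times> {0, 1}" for g
    using that A(3,4) by auto
  define Vt where "Vt = \<lparr>scal = ?s, act = A\<rparr>"
  have "is_rep Vt"
    unfolding is_rep_def Vt_def using A F.p.finite_dimensional_vector_space_axioms by (auto simp del: split_paired_All)
  then have "block_extension V V' Vt E"
    by unfold_locales (use V V' E_Lin A_blk in \<open>auto simp: Vt_def scale blk_def\<close>)
  then show ?thesis
    by (rule that) (simp add: Vt_def)
qed

lemma lookup_sum_singles:
  assumes "finite A" "\<And>a. a \<notin> A \<Longrightarrow> f a = 0"
  shows "lookup (\<Sum>a\<in>A. single a (f a)) b = f b"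
  using assms by (auto simp: lookup_sum lookup_single when_def if_distrib sum.If_cases)

context block_extension
begin

lemma row_poly_eq: "row_poly (const_poly id) (- \<mu>) = const_poly (row id 0) + Poly_Mapping.map rowmap \<mu>"
proof (rule poly_mapping_eqI)
  fix b
  have "lookup (row_poly (const_poly id) (- \<mu>)) b = row (lookup (const_poly id) b) (lookup (- \<mu>) b)"
    unfolding row_poly_def
    by (rule lookup_sum_singles) (auto simp: in_keys_iff row_def fun_eq_iff)
  also have "\<dots> = lookup (const_poly (row id 0) + Poly_Mapping.map rowmap \<mu>) b"
    by (auto simp: const_poly_def lookup_add lookup_single when_def fun_eq_iff row_def)
  finally show "lookup (row_poly (const_poly id) (- \<mu>)) b = lookup (const_poly (row id 0) + Poly_Mapping.map rowmap \<mu>) b" .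
qed

lemma col_poly_eq: "col_poly \<mu> (const_poly id) = const_poly (col 0 id) + Poly_Mapping.map colmap \<mu>"
proof (rule poly_mapping_eqI)
  fix b
  have "lookup (col_poly \<mu> (const_poly id)) b = col (lookup \<mu> b) (lookup (const_poly id) b)"
    unfolding col_poly_def
    by (rule lookup_sum_singles) (auto simp: in_keys_iff col_def fun_eq_iff zero_prod_def)
  also have "\<dots> = lookup (const_poly (col 0 id) + Poly_Mapping.map colmap \<mu>) b"
    by (auto simp: const_poly_def lookup_add lookup_single when_def fun_eq_iff col_def)
  finally show "lookup (col_poly \<mu> (const_poly id)) b = lookup (const_poly (col 0 id) + Poly_Mapping.map colmap \<mu>) b" .
qed

lemma square_form_row:
  "square_form (Lin_scale V') (monoform (row_poly (const_poly id) (- \<mu>)) {}) = row_cochain (square_form (Lin_scale V') (monoform \<mu> {}))"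
  by (simp add: fun_eq_iff square_form_def row_cochain_def row_poly_eq additive.add[OF additive_monoform]
     additive.add[OF row.additive_form_subst] monoform_map form_subst_map[OF linear_rowmap])

lemma square_form_col:
  "square_form (Lin_scale Vt) (monoform (col_poly \<mu> (const_poly id)) {}) = col_cochain (square_form (Lin_scale V') (monoform \<mu> {}))"
  by (simp add: fun_eq_iff square_form_def col_cochain_def col_poly_eq additive.add[OF additive_monoform]
     additive.add[OF col.additive_form_subst] monoform_map form_subst_map[OF linear_colmap])

end

theorem lemma3p1:
  fixes V :: "('k::field_char_0, 'v::ab_group_add) rep"
    and V' :: "('k, 'w::ab_group_add) rep"
  assumes "is_rep V" and "is_rep V'"
  shows
    "(\<forall>c\<in>H_PL torus (Hom_ls V V') 1.
        \<exists>P Q. is_square_cocycle V V' P Q \<and> c = coh_class torus (Hom_ls V V') 1 (omega V' P Q))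
     \<and>
     (\<forall>P Q. is_square_cocycle V V' P Q \<longrightarrow> (\<exists>!\<mu>. is_potential V V' P Q \<mu>))
     \<and>
     (\<forall>P Q \<mu>. is_square_cocycle V V' P Q \<longrightarrow> is_potential V V' P Q \<mu> \<longrightarrow>
        (\<exists>Vt :: ('k, 'w \<times> 'v) rep.
           is_rep Vt \<and>
           scal Vt = module_prod.scale (scal V') (scal V) \<and>
           (\<forall>i\<in>{1, 2}.
              act Vt (gen i) =
                col (row (act V' (gen i))
                         (- (act V' (gen i) \<circ>
                             poly_eval (Lin_scale V') \<mu> (square_point (of_nat (2 - i)) (of_nat (i - 1))))))
                    (row 0 (act V (gen i)))) \<and>
           has_extension_class V' Vt V (T_const (col id 0)) (T_const (row 0 id))
             (coh_class torus (Hom_ls V V') 1 (omega V' P Q)) \<and>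
           is_splitting V' Vt V (T_const (col id 0)) (T_const (row 0 id))
             (square_form (Lin_scale V') (monoform (row_poly (const_poly id) (- \<mu>)) {}))
             (square_form (Lin_scale Vt) (monoform (col_poly \<mu> (const_poly id)) {}))))"
proof -
  interpret hom: torus_action "Lin_scale V'" "Lin V V'" "\<lambda>g f. act V' g \<circ> f \<circ> act V (- g)"
    by (rule torus_action_Hom[OF assms])
  have Hom: "Hom_ls V V' = hom.L"
    by (simp add: Hom_ls_def)
  have origin: "square_point 0 0 = (\<lambda>_. 0 :: 'k)"
    by (auto simp: square_point_def)
  have potential: "is_potential V V' P Q \<mu> \<longleftrightarrow> \<mu> \<in> square_polys (Lin V V') \<and>
     poly_deriv (Lin_scale V') 1 \<mu> = P \<and> poly_deriv (Lin_scale V') 2 \<mu> = Q \<and> lookup \<mu> 0 = 0" for P Q \<mu>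
    by (simp add: is_potential_def origin hom.poly_eval_origin)
  note cocycle = is_square_cocycle_def omega_def Hom
  show ?thesis
  proof (intro conjI ballI allI impI, goal_cases)
    case (1 c)
    then obtain \<omega> where \<omega>: "\<omega> \<in> cocycles torus hom.L 1" "c = coh_class torus hom.L 1 \<omega>"
      unfolding H_PL_def quotient_def coh_class_def Hom by blast
    obtain P Q where "P \<in> square_polys (Lin V V')" "Q \<in> square_polys (Lin V V')"
        "square_form (Lin_scale V') (form1 P Q) \<in> cocycles torus hom.L 1"
        "coh_class torus hom.L 1 (square_form (Lin_scale V') (form1 P Q)) = coh_class torus hom.L 1 \<omega>"
      using \<omega>(1) by (rule hom.class_has_square_representative)
    then show ?case
      unfolding cocycle \<omega>(2) by (intro exI[of _ P] exI[of _ Q]) simp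
  next
    case (2 P Q)
    then show ?case
      unfolding potential cocycle by (intro hom.square_cocycle_has_unique_potential) auto
  next
    case (3 P Q \<mu>)
    then have \<mu>: "\<mu> \<in> square_polys (Lin V V')" "poly_deriv (Lin_scale V') 1 \<mu> = P"
        "poly_deriv (Lin_scale V') 2 \<mu> = Q" "lookup \<mu> 0 = 0"
      by (auto simp: potential)
    define F where "F = square_form (Lin_scale V') (monoform \<mu> {})"
    define E where "E g = poly_eval (Lin_scale V') \<mu> (square_point (of_int (fst g)) (of_int (snd g)))"
      for g :: "int \<times> int"
    have d: "ext_deriv (Lin_scale V') (monoform \<mu> {}) = form1 P Q"
      using hom.ext_deriv_square_poly[OF \<mu>(1)] \<mu> by simp
    have dF: "d_PL (Hom_ls V V') F = omega V' P Q"
      unfolding F_def Hom hom.d_PL_square_form d omega_def ..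
    have "square_form (Lin_scale V') (ext_deriv (Lin_scale V') (monoform \<mu> {})) \<in> C_PL torus hom.L 1"
      using 3(1) unfolding d cocycle cocycles_def by blast
    then have E: "hom.has_periods F E"
      unfolding F_def E_def by (rule hom.square_form_periods[OF \<mu>(1,4)])
    note qp = hom.has_periods_quasi_periodic[OF E]
    obtain Vt where Vt: "block_extension V V' Vt E" "scal Vt = module_prod.scale (scal V') (scal V)"
      using block_extension_exists[OF assms hom.period_relations[OF E]] by metis
    interpret X: block_extension V V' Vt E by (rule Vt(1))
    have act: "act Vt (gen i) = col (row (act V' (gen i)) (- (act V' (gen i) \<circ>
          poly_eval (Lin_scale V') \<mu> (square_point (of_nat (2 - i)) (of_nat (i - 1))))))
        (row 0 (act V (gen i)))" if "i \<in> {1, 2}" for i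
    proof -
      have "gen i \<in> {0, 1} \<times> {0, 1}"
        by (auto simp: gen_def)
      moreover have "E (gen i) = poly_eval (Lin_scale V') \<mu> (square_point (of_nat (2 - i)) (of_nat (i - 1)))"
        using that by (auto simp: E_def gen_def)
      ultimately show ?thesis
        using X.act_Vt[of "gen i"] by (auto simp: fun_eq_iff col_def row_def)
    qed
    note ext = X.extension_class[OF qp, unfolded dF]
    note split = X.row_col_splitting[OF qp, unfolded F_def, folded X.square_form_row X.square_form_col]
    show ?case
      by (intro exI[of _ Vt] conjI ballI X.Vt Vt(2) act ext split)
  qed
qed

end
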